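(* Assume hypotheses (H1) and (H2) of the context, that $\beta\in(\frac12,1)$ and that $\mu(y\in Y:\varphi(y)>n)=cn^{-\beta}+O(n^{-2\beta})$, where $c>0$. Let $\gamma=\min\{1-\beta,\beta-\frac12\}$. Let $\nu$ be an absolutely continuous (with respect to $\mu$) probability measure on $Y$ with density $g\in\mathcal{B}$. Then there is a constant $C>0$ independent of $\nu$ such that, for all $n\ge1$ and $t\in[0,1]$, $$\bigl|\nu\{\tfrac1nZ_n\le t\}-\mathbb{P}(\zeta_\beta\le t)\bigr|\le C\|g\|n^{-\gamma}.$$
   Context: Setting. $(X,\mu)$ is an infinite measure space, $f:X\to X$ a conservative measure preserving map, $Y\subset X$ measurable with $\mu(Y)\in(0,\infty)$, and $\mu$ is rescaled so that $\mu(Y)=1$. Let $\varphi:Y\to\mathbb{Z}^+$, $\varphi(y)=\inf\{n\ge1:f^ny\in Y\}$ (finite a.e.), and $F=f^\varphi:Y\to Y$ the first return map. Let $R:L^1(Y)\to L^1(Y)$ be the transfer operator of $F$: $\int_YRv\,w\,d\mu=\int_Yv\,w\circ F\,d\mu$ for bounded measurable $w$. Set $R_nv=R(1_{\{\varphi=n\}}v)$ ($n\ge1$), and $R(z)v=R(z^\varphi v)=\sum_{n\ge1}z^nR_nv$ for $z\in\bar{\mathbb{D}}=\{z\in\mathbb{C}:|z|\le1\}$. $\mathcal{B}\subset L^\infty(Y)$ is a (real) Banach space of functions containing the constants with norm satisfying $|v|_\infty\le\|v\|$ (complexified when $z$ is complex), such that: (H1) there is $C_0>0$ such that for all $n\ge1$,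 $R_n:\mathcal{B}\to\mathcal{B}$ is bounded with $\|R_n\|\le C_0\mu(\varphi=n)$. (H2) (i) the eigenvalue $1$ is simple and isolated in the spectrum of $R(1):\mathcal{B}\to\mathcal{B}$; (ii) for $z\in\bar{\mathbb{D}}\setminus\{1\}$ the spectrum of $R(z):\mathcal{B}\to\mathcal{B}$ does not contain $1$. For $x\in\bigcup_{j=0}^nf^{-j}Y$, $n\ge1$, $Z_n(x)=\max\{0\le j\le n:f^jx\in Y\}$. $\zeta_\beta$ is a random variable with values in $[0,1]$ and distribution $$\mathbb{P}(\zeta_\beta\le t)=d_\beta\int_0^t\frac{1}{u^{1-\beta}}\frac{1}{(1-u)^\beta}\,du,\quad t\in[0,1],\qquad d_\beta=\tfrac1\pi\sin\beta\pi.$$ *)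

theory Defs
  imports "HOL-Probability.Probability" "HOL-Library.Landau_Symbols"
begin

section \<open>Infinite measure preserving maps and first returns\<close>

definition measure_preserving_map :: "'a measure \<Rightarrow> ('a \<Rightarrow> 'a) \<Rightarrow> bool" where
  "measure_preserving_map M f \<longleftrightarrow> f \<in> M \<rightarrow>\<^sub>M M \<and>
     (\<forall>A\<in>sets M. emeasure M (f -` A \<inter> space M) = emeasure M A)"

text \<open>Every wandering set is null; the map is not assumed to be invertible.\<close>

definition conservative_map :: "'a measure \<Rightarrow> ('a \<Rightarrow> 'a) \<Rightarrow> bool" where
  "conservative_map M f \<longleftrightarrow>
     (\<forall>A\<in>sets M. disjoint_family (\<lambda>n. (f ^^ n) -` A \<inter> space M) \<longrightarrow> emeasure M A = 0)"

text \<open>The value is \<^term>\<open>\<infinity>\<close> at the points that never return to \<open>Y\<close>.\<close>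

definition return_time :: "('a \<Rightarrow> 'a) \<Rightarrow> 'a set \<Rightarrow> 'a \<Rightarrow> enat" where
  "return_time f Y y = (INF n\<in>{n. 1 \<le> n \<and> (f ^^ n) y \<in> Y}. enat n)"

text \<open>At the points that never return (a null set) the value is chosen to be \<open>y\<close>, so that
  the map sends \<open>Y\<close> into \<open>Y\<close> everywhere and is measurable even if the measure on \<open>Y\<close> is not
  complete.\<close>

definition return_map :: "('a \<Rightarrow> 'a) \<Rightarrow> 'a set \<Rightarrow> 'a \<Rightarrow> 'a" where
  "return_map f Y y = (case return_time f Y y of enat n \<Rightarrow> (f ^^ n) y | \<infinity> \<Rightarrow> y)"

text \<open>Meaningful only if the orbit of \<open>x\<close> meets \<open>Y\<close> up to time \<open>n\<close>, in particular for \<open>x \<in> Y\<close>.\<close>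

definition last_visit :: "('a \<Rightarrow> 'a) \<Rightarrow> 'a set \<Rightarrow> nat \<Rightarrow> 'a \<Rightarrow> nat" where
  "last_visit f Y n x = Max {j. j \<le> n \<and> (f ^^ j) x \<in> Y}"

text \<open>\<open>R\<close> acts on representatives of the elements of real \<open>L\<^sup>1(N)\<close>; the duality determines
  \<open>R v\<close> up to null sets.\<close>

definition transfer_operator ::
    "'a measure \<Rightarrow> ('a \<Rightarrow> 'a) \<Rightarrow> (('a \<Rightarrow> real) \<Rightarrow> ('a \<Rightarrow> real)) \<Rightarrow> bool" where
  "transfer_operator N F R \<longleftrightarrow>
     (\<forall>v. integrable N v \<longrightarrow>
        integrable N (R v) \<and>
        (\<forall>w\<in>borel_measurable N. (\<exists>K. \<forall>y\<in>space N. \<bar>w y\<bar> \<le> K) \<longrightarrow>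
           (LINT y|N. R v y * w y) = (LINT y|N. v y * w (F y))))"


section \<open>Banach spaces of bounded functions\<close>

text \<open>A real Banach space contained in \<open>L\<^sup>\<infinity>(N)\<close> is an abstract Banach space \<open>'b\<close> with a map
  \<open>J\<close> that selects for each element a representative of its class modulo null sets. Hence \<open>J\<close> is
  linear and injective only modulo null sets.\<close>

definition banach_function_space :: "'a measure \<Rightarrow> ('b::banach \<Rightarrow> 'a \<Rightarrow> real) \<Rightarrow> bool" where
  "banach_function_space N J \<longleftrightarrow>
     (\<forall>v. J v \<in> borel_measurable N) \<and>
     (\<forall>u v. AE y in N. J (u + v) y = J u y + J v y) \<and>
     (\<forall>r v. AE y in N. J (r *\<^sub>R v) y = r * J v y) \<and>
     (\<forall>v. (AE y in N. J v y = 0) \<longrightarrow> v = 0) \<and>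
     (\<forall>v. AE y in N. \<bar>J v y\<bar> \<le> norm v) \<and>
     (\<exists>e. AE y in N. J e y = 1)"


section \<open>Complexification and spectrum\<close>

text \<open>The complexification of \<open>'b\<close> is \<open>'b \<times> 'b\<close>, the pair \<open>(u, v)\<close> standing for \<open>u + \<i>v\<close>.
  The product norm is not homogeneous for complex scalars in general, but it is equivalent to
  norms that are, and boundedness of operators, convergence and spectra depend on the norm only
  up to equivalence. \<open>cscale z\<close> is multiplication by \<open>z\<close>.\<close>

lift_definition cscale :: "complex \<Rightarrow> ('b::real_normed_vector \<times> 'b) \<Rightarrow>\<^sub>L ('b \<times> 'b)" is
  "\<lambda>z p. (Re z *\<^sub>R fst p - Im z *\<^sub>R snd p, Im z *\<^sub>R fst p + Re z *\<^sub>R snd p)"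
  by (intro bounded_linear_Pair bounded_linear_sub bounded_linear_add
      bounded_linear_const_scaleR bounded_linear_fst bounded_linear_snd)

lift_definition complexify ::
    "('b::real_normed_vector \<Rightarrow>\<^sub>L 'b) \<Rightarrow> ('b \<times> 'b) \<Rightarrow>\<^sub>L ('b \<times> 'b)" is
  "\<lambda>T p. (T (fst p), T (snd p))"
  by (intro bounded_linear_Pair)
    (auto intro: bounded_linear_compose bounded_linear_fst bounded_linear_snd)

definition inverse_of :: "('c::real_normed_vector \<Rightarrow>\<^sub>L 'c) \<Rightarrow> ('c \<Rightarrow>\<^sub>L 'c) \<Rightarrow> bool" where
  "inverse_of S T \<longleftrightarrow> S o\<^sub>L T = id_blinfun \<and> T o\<^sub>L S = id_blinfun"

definition spectrum :: "(('b::real_normed_vector \<times> 'b) \<Rightarrow>\<^sub>L ('b \<times> 'b)) \<Rightarrow> complex set" where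
  "spectrum T = {\<kappa>. \<nexists>S. inverse_of S (cscale \<kappa> - T)}"

definition resolvent ::
    "(('b::real_normed_vector \<times> 'b) \<Rightarrow>\<^sub>L ('b \<times> 'b)) \<Rightarrow> complex \<Rightarrow> ('b \<times> 'b) \<Rightarrow>\<^sub>L ('b \<times> 'b)" where
  "resolvent T \<kappa> = (THE S. inverse_of S (cscale \<kappa> - T))"

text \<open>The Riesz projection \<open>(2\<pi>\<i>)\<^bsup>-1\<^esup> \<integral> (\<zeta> - T)\<^bsup>-1\<^esup> d\<zeta>\<close> over the positively oriented circle
  \<open>\<zeta> = \<kappa> + r e\<^bsup>\<i>\<theta>\<^esup>\<close>, \<open>0 \<le> \<theta> \<le> 2\<pi>\<close>.\<close>

definition riesz_projection ::
    "(('b::banach \<times> 'b) \<Rightarrow>\<^sub>L ('b \<times> 'b)) \<Rightarrow> complex \<Rightarrow> real \<Rightarrow> ('b \<times> 'b) \<Rightarrow>\<^sub>L ('b \<times> 'b)" where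
  "riesz_projection T \<kappa> r = (1 / (2 * pi)) *\<^sub>R
     integral {0..2 * pi}
       (\<lambda>\<theta>. cscale (of_real r * cis \<theta>) o\<^sub>L resolvent T (\<kappa> + of_real r * cis \<theta>))"

definition eigenvalue :: "(('b::real_normed_vector \<times> 'b) \<Rightarrow>\<^sub>L ('b \<times> 'b)) \<Rightarrow> complex \<Rightarrow> bool" where
  "eigenvalue T \<kappa> \<longleftrightarrow> (\<exists>v. v \<noteq> 0 \<and> blinfun_apply T v = blinfun_apply (cscale \<kappa>) v)"

text \<open>As usual for isolated points of the spectrum, simple means that the algebraic
  multiplicity, i.e. the complex dimension of the range of the spectral projection, is one. The
  projection is the same for all radii \<open>r\<close> that separate \<open>\<kappa>\<close> from the rest of the spectrum.\<close>

definition simple_isolated_eigenvalue ::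
    "(('b::banach \<times> 'b) \<Rightarrow>\<^sub>L ('b \<times> 'b)) \<Rightarrow> complex \<Rightarrow> bool" where
  "simple_isolated_eigenvalue T \<kappa> \<longleftrightarrow>
     eigenvalue T \<kappa> \<and> \<kappa> isolated_in spectrum T \<and>
     (\<exists>r>0. cball \<kappa> r \<inter> spectrum T = {\<kappa>} \<and>
        (\<exists>v. v \<noteq> 0 \<and> range (blinfun_apply (riesz_projection T \<kappa> r)) =
                      range (\<lambda>z. blinfun_apply (cscale z) v)))"

text \<open>\<open>R(z) = \<Sum>\<^bsub>n\<ge>1\<^esub> z\<^sup>n R\<^sub>n\<close> on the complexification; the operator with index \<open>0\<close> is not used.\<close>

definition return_series ::
    "(nat \<Rightarrow> ('b::banach \<Rightarrow>\<^sub>L 'b)) \<Rightarrow> complex \<Rightarrow> ('b \<times> 'b) \<Rightarrow>\<^sub>L ('b \<times> 'b)" where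
  "return_series Rn z = (\<Sum>n. cscale (z ^ Suc n) o\<^sub>L complexify (Rn (Suc n)))"

end

theory Submission
  imports Defs
begin

text \<open>
  Let \<open>u\<^sub>j\<close> be the renewal sequence of the return time distribution, and suppose for a moment that
  first returns were independent. A point is in \<open>Y\<close> at time \<open>j\<close> with probability \<open>u\<^sub>j\<close> and then
  needs more than \<open>n - j\<close> steps to return with probability \<open>\<mu>(\<phi> > n - j) \<sim> c (n - j)\<^sup>-\<^sup>\<beta>\<close>. Since
  \<open>u\<^sub>j\<close> is asymptotic to a multiple of \<open>j\<^sup>\<beta>\<^sup>-\<^sup>1\<close>, the distribution function of \<open>Z\<^sub>n / n\<close> is, up to
  errors, a Riemann sum of the integral of \<open>x\<^sup>\<beta>\<^sup>-\<^sup>1 (1 - x)\<^sup>-\<^sup>\<beta>\<close>. The proof carries this out with error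
  terms, and with operators in place of probabilities. If \<open>u\<^sub>j\<close> is known up to \<open>O(j\<^sup>-\<^sup>\<kappa>)\<close>, where
  \<open>\<kappa> = min (2 - 2 \<beta>) (1 / 2)\<close>, the convolution of this error with the tails is \<open>O(n\<^sup>1\<^sup>-\<^sup>\<kappa>\<^sup>-\<^sup>\<beta>)\<close>, and
  \<open>\<kappa> + \<beta> - 1 = \<gamma>\<close>; this is \<open>last_visit_estimate\<close>, with the Riemann sum in
  \<open>arcsine_riemann_sum\<close>.

  All asymptotics of sequences come from one principle, \<open>power_series_coefficient_bound\<close>: a power
  series on the unit disc that is of size \<open>\<bar>1 - z\<bar>\<^sup>\<kappa>\<^sup>-\<^sup>1\<close> and correspondingly \<open>\<beta>\<close>-Hoelder continuous has
  coefficients \<open>O(n\<^sup>-\<^sup>\<kappa>)\<close> if \<open>\<kappa> < \<beta>\<close>. The class of functions with such a power singularity at \<open>1\<close>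
  (\<open>symbol\<close>) is closed under sums and products, and under inverses where the size of the inverse is
  known, which reduces the work to algebraic identities between generating functions.

  In the scalar case, \<open>1 - p(z) = a (1 - z)\<^sup>\<beta> + (1 - z) E(z)\<close> for the generating function \<open>p\<close> of the
  return time, where the coefficients of \<open>E\<close> are \<open>O(n\<^sup>-\<^sup>2\<^sup>\<beta>)\<close>. With \<open>V(z) = (1 - z)\<^sup>1\<^sup>-\<^sup>\<beta> / (1 - p(z))\<close> this
  says \<open>a / (1 - p) = (1 - z)\<^sup>-\<^sup>\<beta> - E V\<close>. The principle applies to \<open>V\<close>, and convolution with the
  summable coefficients of \<open>E\<close> preserves the rate (\<open>renewal_asymptotics\<close>).

  For the operators, let \<open>T(z) = (1 - R(z))\<^sup>-\<^sup>1\<close> and \<open>P v = \<integral> v d\<mu>\<close>. The return map preserves \<open>\<mu>\<close>, so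
  \<open>R(1)\<close> fixes the constants and the integral, and \<open>P\<close> is the spectral projection at \<open>1\<close>. The constant
  term \<open>S\<close> of the Laurent expansion of the resolvent of \<open>R(1)\<close> at \<open>1\<close> inverts \<open>1 - R(1)\<close> up to \<open>P\<close>
  (\<open>reduced_resolvent_exists\<close>). From \<open>S\<close> and \<open>D(z) = R(1) - R(z)\<close>, which has order \<open>\<beta>\<close>, one reads off
  that \<open>T(z) - P / (1 - p(z))\<close> is of order \<open>0\<close> (\<open>T_singular_part\<close>). Hence visits under the initial
  density \<open>g\<close> behave like the scalar renewal sequence up to \<open>O(\<parallel>g\<parallel> n\<^sup>-\<^sup>\<kappa>)\<close>
  (\<open>operator_renewal_coefficients\<close>).

  The dynamics enters through the functionals \<open>v \<mapsto> \<integral> v 1\<^sub>Y(f\<^sup>n) w(f\<^sup>n) d\<mu>\<close>. Decomposing with respect to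
  the first return, they satisfy the renewal equation of the operators \<open>R\<^sub>n\<close>, and this identifies
  their generating function as \<open>v \<mapsto> \<integral> T(z) v w d\<mu>\<close>.
\<close>


section \<open>Sums of powers\<close>

lemma powr_mean_value:
  fixes x p :: real
  assumes "0 < x"
  obtains \<xi> where "x < \<xi>" "\<xi> < x + 1" "(x + 1) powr p - x powr p = p * \<xi> powr (p - 1)"
proof -
  have "\<exists>z. x < z \<and> z < x + 1 \<and> (x+1) powr p - x powr p = (x + 1 - x) * (p * z powr (p - 1))"
    using assms by (intro MVT2) (auto intro!: derivative_eq_intros simp: powr_diff)
  then show ?thesis using that by auto
qed

lemma sum_powr_le:
  assumes "0 < a" "a < (1::real)"
  shows "(\<Sum>j=1..n. real j powr - a) \<le> real n powr (1 - a) / (1 - a)"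
proof (induction n)
  case (Suc n)
  show ?case
  proof (cases "n = 0")
    case True
    then show ?thesis using assms by simp
  next
    case False
    then obtain \<xi> where \<xi>: "real n < \<xi>" "\<xi> < real n + 1"
      "(real n + 1) powr (1 - a) - real n powr (1 - a) = (1 - a) * \<xi> powr (1 - a - 1)"
      using powr_mean_value[of "real n" "1 - a"] by auto
    have "(real n + 1) powr - a \<le> \<xi> powr - a"
      using \<xi> assms by (intro powr_mono2') auto
    then have "(real n + 1) powr - a \<le> ((real n + 1) powr (1 - a) - real n powr (1 - a)) / (1 - a)"
      using \<xi> assms by simp
    then show ?thesis using Suc by (simp add: diff_divide_distrib add.commute)
  qed
qed simp

lemma sum_powr_bounded:
  assumes "1 < (a::real)"
  shows "(\<Sum>j=1..n. real j powr - a) \<le> a / (a - 1)"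
proof (cases "n = 0")
  case False
  then have "0 < n" by simp
  then have "(\<Sum>j=1..n. real j powr - a) \<le> a / (a - 1) - real n powr (1 - a) / (a - 1)"
  proof (induction n rule: nat_induct_non_zero)
    case 1
    then show ?case using assms by (simp add: diff_divide_distrib[symmetric])
  next
    case (Suc n)
    obtain \<xi> where \<xi>: "real n < \<xi>" "\<xi> < real n + 1"
      "(real n + 1) powr (1 - a) - real n powr (1 - a) = (1 - a) * \<xi> powr (1 - a - 1)"
      using powr_mean_value[of "real n" "1 - a"] Suc by auto
    have "(real n + 1) powr - a \<le> \<xi> powr - a"
      using \<xi> assms by (intro powr_mono2') auto
    moreover have "\<xi> powr - a = (real n powr (1 - a) - (real n + 1) powr (1 - a)) / (a - 1)"
      using \<xi> assms by (simp add: field_simps)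
    ultimately show ?case using Suc by (simp add: diff_divide_distrib add.commute)
  qed
  then show ?thesis using assms by (smt (verit) divide_nonneg_nonneg powr_ge_zero)
qed (use assms in simp)

lemma sum_powr_growth:
  assumes "0 < a" "a \<noteq> (1::real)" "0 \<le> t" "1 - a \<le> t"
  shows "\<exists>C\<ge>0. \<forall>n\<ge>1. (\<Sum>j=1..n. real j powr - a) \<le> C * real n powr t"
proof (cases "a < 1")
  case True
  have "(\<Sum>j=1..n. real j powr - a) \<le> 1 / (1 - a) * real n powr t" if "n \<ge> 1" for n
  proof -
    have "real n powr (1 - a) \<le> real n powr t" using that assms by (intro powr_mono) auto
    then have "real n powr (1 - a) / (1 - a) \<le> real n powr t / (1 - a)"
      using True by (intro divide_right_mono) auto
    then show ?thesis using sum_powr_le[of a n] True assms by auto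
  qed
  then show ?thesis using True by (intro exI[of _ "1 / (1 - a)"]) auto
next
  case False
  then have a: "1 < a" using assms by auto
  have "(\<Sum>j=1..n. real j powr - a) \<le> a / (a - 1) * real n powr t" if "n \<ge> 1" for n
  proof -
    have "1 \<le> real n powr t" using that assms by (simp add: ge_one_powr_ge_zero)
    then have "a / (a - 1) * 1 \<le> a / (a - 1) * real n powr t"
      using a by (intro mult_left_mono) auto
    then show ?thesis using sum_powr_bounded[of a n] a by auto
  qed
  then show ?thesis using a by (intro exI[of _ "a / (a - 1)"]) auto
qed

text \<open>One of \<open>j\<close> and \<open>n - j\<close> is at least \<open>n / 2\<close>; its power is pulled out of the sum.\<close>

lemma power_convolution_split:
  assumes "0 \<le> a" "0 \<le> (b::real)"
  shows "(\<Sum>j=1..<n. real j powr - a * real (n - j) powr - b)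
     \<le> 2 powr b * real n powr - b * (\<Sum>j=1..n. real j powr - a)
      + 2 powr a * real n powr - a * (\<Sum>j=1..n. real j powr - b)"
proof -
  have half: "real k powr - s \<le> 2 powr s * real n powr - s" if "n \<le> 2 * k" "1 \<le> n" "0 \<le> s" for k s
  proof -
    have "real k powr - s \<le> (real n / 2) powr - s" using that by (intro powr_mono2') auto
    also have "\<dots> = 2 powr s * real n powr - s"
      by (simp add: powr_divide powr_minus field_simps)
    finally show ?thesis .
  qed
  have "(\<Sum>j=1..<n. real j powr - a * real (n - j) powr - b)
      \<le> (\<Sum>j=1..<n. 2 powr b * real n powr - b * real j powr - a
                    + 2 powr a * real n powr - a * real (n - j) powr - b)"
  proof (rule sum_mono)
    fix j assume j: "j \<in> {1..<n}"
    show "real j powr - a * real (n - j) powr - b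
       \<le> 2 powr b * real n powr - b * real j powr - a
          + 2 powr a * real n powr - a * real (n - j) powr - b"
    proof (cases "2 * j \<le> n")
      case True
      then have "real (n - j) powr - b \<le> 2 powr b * real n powr - b"
        using j assms by (intro half) auto
      then have "real j powr - a * real (n - j) powr - b
          \<le> real j powr - a * (2 powr b * real n powr - b)"
        by (intro mult_left_mono) auto
      then show ?thesis by (simp add: mult.commute add_increasing2)
    next
      case False
      then have "real j powr - a \<le> 2 powr a * real n powr - a"
        using j assms by (intro half) auto
      then have "real j powr - a * real (n - j) powr - b
          \<le> 2 powr a * real n powr - a * real (n - j) powr - b"
        by (intro mult_right_mono) auto
      then show ?thesis by (simp add: add_increasing)
    qed
  qed
  also have "\<dots> = 2 powr b * real n powr - b * (\<Sum>j=1..<n. real j powr - a)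
      + 2 powr a * real n powr - a * (\<Sum>j=1..<n. real (n - j) powr - b)"
    by (simp add: sum.distrib sum_distrib_left)
  also have "(\<Sum>j=1..<n. real (n - j) powr - b) = (\<Sum>j=1..<n. real j powr - b)"
    by (rule sum.reindex_bij_witness[of _ "\<lambda>j. n - j" "\<lambda>j. n - j"]) auto
  also have "2 powr b * real n powr - b * (\<Sum>j=1..<n. real j powr - a)
      + 2 powr a * real n powr - a * (\<Sum>j=1..<n. real j powr - b)
     \<le> 2 powr b * real n powr - b * (\<Sum>j=1..n. real j powr - a)
      + 2 powr a * real n powr - a * (\<Sum>j=1..n. real j powr - b)"
    by (intro add_mono mult_left_mono sum_mono2) auto
  finally show ?thesis .
qed

text \<open>The exponent \<open>\<tau>\<close> is limited by the two ends of the sum, where one of the factors is of order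
  \<open>1\<close>, and by the bulk, which has \<open>n\<close> terms of order \<open>n powr - (a + b)\<close>.\<close>

lemma power_convolution:
  assumes "0 < a" "0 < (b::real)" "a \<noteq> 1" "b \<noteq> 1" "\<tau> \<le> a" "\<tau> \<le> b" "\<tau> \<le> a + b - 1"
  shows "\<exists>C\<ge>0. \<forall>n\<ge>1. (\<Sum>j=1..<n. real j powr - a * real (n - j) powr - b) \<le> C * real n powr - \<tau>"
proof -
  obtain A where A: "A \<ge> 0" "\<And>n. n \<ge> 1 \<Longrightarrow> (\<Sum>j=1..n. real j powr - a) \<le> A * real n powr (b - \<tau>)"
    using sum_powr_growth[of a "b - \<tau>"] assms by auto
  obtain B where B: "B \<ge> 0" "\<And>n. n \<ge> 1 \<Longrightarrow> (\<Sum>j=1..n. real j powr - b) \<le> B * real n powr (a - \<tau>)"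
    using sum_powr_growth[of b "a - \<tau>"] assms by auto
  show ?thesis
  proof (intro exI[of _ "2 powr b * A + 2 powr a * B"] conjI allI impI)
    fix n :: nat assume n: "n \<ge> 1"
    have "(\<Sum>j=1..<n. real j powr - a * real (n - j) powr - b)
     \<le> 2 powr b * real n powr - b * (\<Sum>j=1..n. real j powr - a)
      + 2 powr a * real n powr - a * (\<Sum>j=1..n. real j powr - b)"
      using assms by (intro power_convolution_split) auto
    also have "\<dots> \<le> 2 powr b * real n powr - b * (A * real n powr (b - \<tau>))
      + 2 powr a * real n powr - a * (B * real n powr (a - \<tau>))"
      using A B n by (intro add_mono mult_left_mono) auto
    also have "\<dots> = 2 powr b * A * (real n powr - b * real n powr (b - \<tau>))
      + 2 powr a * B * (real n powr - a * real n powr (a - \<tau>))" by simp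
    also have "\<dots> = (2 powr b * A + 2 powr a * B) * real n powr - \<tau>"
      by (simp add: powr_add[symmetric] algebra_simps)
    finally show "(\<Sum>j=1..<n. real j powr - a * real (n - j) powr - b)
       \<le> (2 powr b * A + 2 powr a * B) * real n powr - \<tau>" .
  qed (use A B in auto)
qed


section \<open>Functions with a power singularity at 1\<close>

abbreviation unit_disc :: "complex set" where "unit_disc \<equiv> ball 0 1"

text \<open>The functions that behave at \<open>1\<close> like \<open>(1 - z) powr a\<close>: they are bounded by
  \<open>\<bar>1 - z\<bar> powr a\<close>, and rescaled to unit size they are \<open>\<beta>\<close>-Hoelder continuous at the scale
  \<open>\<bar>1 - z\<bar>\<close>, uniformly in \<open>z\<close>. As for the symbols of pseudodifferential operators, the orders
  \<open>a\<close> add under multiplication and change sign under inversion, so that generating functions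
  can be estimated by algebra alone. Two points are compared only if their distances from \<open>1\<close>
  differ at most by a fixed factor; the factor \<open>9 \<ge> 1 + 2 \<pi>\<close> admits the points \<open>z\<close> and
  \<open>z e\<^bsup>\<i>\<pi>/n\<^esup>\<close> with \<open>\<bar>z\<bar> = 1 - 1 / (2 n)\<close>.\<close>

definition symbol_with ::
    "real \<Rightarrow> real \<Rightarrow> real \<Rightarrow> (complex \<Rightarrow> 'x::real_normed_vector) \<Rightarrow> bool" where
  "symbol_with C \<beta> a F \<longleftrightarrow>
     (\<forall>z\<in>unit_disc. norm (F z) \<le> C * norm (1 - z) powr a) \<and>
     (\<forall>z\<in>unit_disc. \<forall>z'\<in>unit_disc. norm (1 - z) \<le> 9 * norm (1 - z') \<longrightarrow>
        norm (1 - z') \<le> 9 * norm (1 - z) \<longrightarrow>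
        norm (F z - F z') \<le> C * norm (z - z') powr \<beta> * norm (1 - z) powr (a - \<beta>))"

definition symbol :: "real \<Rightarrow> real \<Rightarrow> (complex \<Rightarrow> 'x::real_normed_vector) \<Rightarrow> bool" where
  "symbol \<beta> a F \<longleftrightarrow> (\<exists>C\<ge>0. symbol_with C \<beta> a F)"

lemma symbol_withI:
  assumes "\<And>z. norm z < 1 \<Longrightarrow> norm (F z) \<le> C * norm (1 - z) powr a"
    and "\<And>z z'. norm z < 1 \<Longrightarrow> norm z' < 1 \<Longrightarrow> norm (1 - z) \<le> 9 * norm (1 - z') \<Longrightarrow>
        norm (1 - z') \<le> 9 * norm (1 - z) \<Longrightarrow>
        norm (F z - F z') \<le> C * norm (z - z') powr \<beta> * norm (1 - z) powr (a - \<beta>)"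
  shows "symbol_with C \<beta> a F"
  using assms unfolding symbol_with_def by auto

lemma symbol_withD:
  assumes "symbol_with C \<beta> a F"
  shows "norm z < 1 \<Longrightarrow> norm (F z) \<le> C * norm (1 - z) powr a"
    and "norm z < 1 \<Longrightarrow> norm z' < 1 \<Longrightarrow> norm (1 - z) \<le> 9 * norm (1 - z') \<Longrightarrow>
        norm (1 - z') \<le> 9 * norm (1 - z) \<Longrightarrow>
        norm (F z - F z') \<le> C * norm (z - z') powr \<beta> * norm (1 - z) powr (a - \<beta>)"
  using assms unfolding symbol_with_def by auto

text \<open>The two estimates can be proved with different constants.\<close>

lemma symbolI:
  assumes "\<And>z. norm z < 1 \<Longrightarrow> norm (F z) \<le> C * norm (1 - z) powr a"
    and "\<And>z z'. norm z < 1 \<Longrightarrow> norm z' < 1 \<Longrightarrow> norm (1 - z) \<le> 9 * norm (1 - z') \<Longrightarrow>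
        norm (1 - z') \<le> 9 * norm (1 - z) \<Longrightarrow>
        norm (F z - F z') \<le> C' * norm (z - z') powr \<beta> * norm (1 - z) powr (a - \<beta>)"
  shows "symbol \<beta> a F"
proof -
  let ?K = "max 0 (max C C')"
  have "symbol_with ?K \<beta> a F"
  proof (rule symbol_withI)
    fix z :: complex assume "norm z < 1"
    then have "norm (F z) \<le> C * norm (1 - z) powr a" by (rule assms)
    also have "\<dots> \<le> ?K * norm (1 - z) powr a" by (intro mult_right_mono) auto
    finally show "norm (F z) \<le> ?K * norm (1 - z) powr a" .
  next
    fix z z' :: complex
    assume "norm z < 1" "norm z' < 1" "norm (1 - z) \<le> 9 * norm (1 - z')"
       "norm (1 - z') \<le> 9 * norm (1 - z)"
    then have "norm (F z - F z') \<le> C' * norm (z - z') powr \<beta> * norm (1 - z) powr (a - \<beta>)"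
      by (rule assms)
    also have "\<dots> \<le> ?K * norm (z - z') powr \<beta> * norm (1 - z) powr (a - \<beta>)"
      by (intro mult_right_mono) auto
    finally show "norm (F z - F z') \<le> ?K * norm (z - z') powr \<beta> * norm (1 - z) powr (a - \<beta>)" .
  qed
  then show ?thesis unfolding symbol_def by (intro exI[of _ ?K]) auto
qed

lemma disc_distance_pos:
  assumes "norm (z::complex) < 1"
  shows "0 < norm (1 - z)"
  using assms by auto

lemma disc_distance_le2:
  assumes "norm (z::complex) < 1"
  shows "norm (1 - z) \<le> 2"
  using assms norm_triangle_ineq4[of 1 z] by simp

lemma powr_comparable:
  assumes "0 < x" "0 < y" "x \<le> 9 * y" "y \<le> 9 * (x::real)"
  shows "y powr s \<le> 9 powr \<bar>s\<bar> * x powr s"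
proof (cases "0 \<le> s")
  case True
  then have "y powr s \<le> (9 * x) powr s" using assms by (intro powr_mono2) auto
  then show ?thesis using True assms by (simp add: powr_mult)
next
  case False
  then have "y powr s \<le> (x / 9) powr s" using assms by (intro powr_mono2') auto
  also have "\<dots> = 9 powr \<bar>s\<bar> * x powr s"
    using False assms by (simp add: powr_divide powr_minus_divide)
  finally show ?thesis .
qed

lemma symbol_weaken:
  assumes "symbol \<beta> a F" "b \<le> a"
  shows "symbol \<beta> b F"
proof -
  obtain C where C: "C \<ge> 0" "symbol_with C \<beta> a F" using assms unfolding symbol_def by auto
  have le: "norm (1 - z) powr (a - t) \<le> 2 powr (a - b) * norm (1 - z) powr (b - t)"
    if "norm z < 1" for z :: complex and t
  proof -
    have "norm (1 - z) powr (a - t) = norm (1 - z) powr (a - b) * norm (1 - z) powr (b - t)"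
      by (simp add: powr_add[symmetric])
    also have "\<dots> \<le> 2 powr (a - b) * norm (1 - z) powr (b - t)"
      using disc_distance_le2[OF that] assms by (intro mult_right_mono powr_mono2) auto
    finally show ?thesis .
  qed
  show ?thesis
  proof (rule symbolI)
    fix z :: complex assume z: "norm z < 1"
    have "norm (F z) \<le> C * norm (1 - z) powr a" using C z by (intro symbol_withD)
    also have "\<dots> \<le> C * (2 powr (a - b) * norm (1 - z) powr b)"
      using C le[OF z, of 0] by (intro mult_left_mono) auto
    finally show "norm (F z) \<le> C * 2 powr (a - b) * norm (1 - z) powr b" by simp
  next
    fix z z' :: complex
    assume z: "norm z < 1" and *: "norm z' < 1" "norm (1 - z) \<le> 9 * norm (1 - z')"
       "norm (1 - z') \<le> 9 * norm (1 - z)"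
    have "norm (F z - F z') \<le> C * norm (z - z') powr \<beta> * norm (1 - z) powr (a - \<beta>)"
      using C z * by (intro symbol_withD)
    also have "\<dots> \<le> C * norm (z - z') powr \<beta> * (2 powr (a - b) * norm (1 - z) powr (b - \<beta>))"
      using C le[OF z, of \<beta>] by (intro mult_left_mono) auto
    finally show "norm (F z - F z')
       \<le> C * 2 powr (a - b) * norm (z - z') powr \<beta> * norm (1 - z) powr (b - \<beta>)"
      by (simp add: mult_ac)
  qed
qed

lemma symbol_const: "symbol \<beta> 0 (\<lambda>_. c)"
proof (rule symbolI[where C = "norm c" and C' = 0])
  fix z :: complex assume "norm z < 1"
  then show "norm c \<le> norm c * norm (1 - z) powr 0"
    using disc_distance_pos by auto
qed auto

lemma symbol_add:
  assumes "symbol \<beta> a F" "symbol \<beta> a G"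
  shows "symbol \<beta> a (\<lambda>z. F z + G z)"
proof -
  obtain C where C: "C \<ge> 0" "symbol_with C \<beta> a F" using assms unfolding symbol_def by auto
  obtain D where D: "D \<ge> 0" "symbol_with D \<beta> a G" using assms unfolding symbol_def by auto
  show ?thesis
  proof (rule symbolI[where C = "C + D" and C' = "C + D"])
    fix z :: complex assume z: "norm z < 1"
    show "norm (F z + G z) \<le> (C + D) * norm (1 - z) powr a"
      using symbol_withD(1)[OF C(2) z] symbol_withD(1)[OF D(2) z] norm_triangle_ineq[of "F z" "G z"]
      by (simp add: algebra_simps)
  next
    fix z z' :: complex
    assume *: "norm z < 1" "norm z' < 1" "norm (1 - z) \<le> 9 * norm (1 - z')"
       "norm (1 - z') \<le> 9 * norm (1 - z)"
    show "norm (F z + G z - (F z' + G z'))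
       \<le> (C + D) * norm (z - z') powr \<beta> * norm (1 - z) powr (a - \<beta>)"
      using symbol_withD(2)[OF C(2) *] symbol_withD(2)[OF D(2) *]
        norm_triangle_ineq[of "F z - F z'" "G z - G z'"]
      by (simp add: algebra_simps)
  qed
qed

text \<open>Stated for bounded bilinear products, as it is applied to complex numbers, to scalar multiples
  and to the composition of operators.\<close>

lemma symbol_bilinear:
  assumes "bounded_bilinear mul" "symbol \<beta> a F" "symbol \<beta> b G"
  shows "symbol \<beta> (a + b) (\<lambda>z. mul (F z) (G z))"
proof -
  interpret bounded_bilinear mul by fact
  obtain K where K: "K \<ge> 0" "\<And>x y. norm (mul x y) \<le> norm x * norm y * K"
    using nonneg_bounded by blast
  obtain C where C: "C \<ge> 0" "symbol_with C \<beta> a F" using assms unfolding symbol_def by auto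
  obtain D where D: "D \<ge> 0" "symbol_with D \<beta> b G" using assms unfolding symbol_def by auto
  have prod_le: "norm (mul x y) \<le> X * Y * K" if "norm x \<le> X" "norm y \<le> Y" for x y X Y
  proof -
    have "0 \<le> X" "0 \<le> Y" using that norm_ge_zero[of x] norm_ge_zero[of y] by linarith+
    then have "norm x * norm y * K \<le> X * Y * K"
      using that K by (intro mult_mono) auto
    then show ?thesis using K(2)[of x y] by linarith
  qed
  show ?thesis
  proof (rule symbolI[where C = "K * C * D" and C' = "K * C * D * (1 + 9 powr \<bar>a\<bar>)"])
    fix z :: complex assume z: "norm z < 1"
    have "norm (mul (F z) (G z)) \<le> C * norm (1 - z) powr a * (D * norm (1 - z) powr b) * K"
      using symbol_withD(1)[OF C(2) z] symbol_withD(1)[OF D(2) z] by (rule prod_le)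
    also have "\<dots> = K * C * D * norm (1 - z) powr (a + b)"
      by (simp add: powr_add)
    finally show "norm (mul (F z) (G z)) \<le> K * C * D * norm (1 - z) powr (a + b)" .
  next
    fix z z' :: complex
    assume *: "norm z < 1" "norm z' < 1" "norm (1 - z) \<le> 9 * norm (1 - z')"
       "norm (1 - z') \<le> 9 * norm (1 - z)"
    let ?h = "norm (z - z') powr \<beta>" and ?d = "norm (1 - z)"
    have pos: "0 < ?d" using * disc_distance_pos by auto
    have F: "norm (F z') \<le> C * (9 powr \<bar>a\<bar> * ?d powr a)"
      using symbol_withD(1)[OF C(2) *(2)] powr_comparable[of ?d "norm (1 - z')" a]
        * disc_distance_pos[OF *(1)] disc_distance_pos[OF *(2)] C(1)
      by (meson mult_left_mono order_trans)
    have "norm (mul (F z) (G z) - mul (F z') (G z'))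
        = norm (mul (F z - F z') (G z) + mul (F z') (G z - G z'))"
      by (simp add: diff_left diff_right)
    also have "\<dots> \<le> norm (mul (F z - F z') (G z)) + norm (mul (F z') (G z - G z'))"
      by (rule norm_triangle_ineq)
    also have "norm (mul (F z - F z') (G z)) \<le> C * ?h * ?d powr (a - \<beta>) * (D * ?d powr b) * K"
      using symbol_withD(2)[OF C(2) *] symbol_withD(1)[OF D(2) *(1)] by (rule prod_le)
    also have "\<dots> = K * C * D * ?h * ?d powr (a + b - \<beta>)"
      by (simp add: powr_add[symmetric] algebra_simps)
    also have "norm (mul (F z') (G z - G z'))
       \<le> C * (9 powr \<bar>a\<bar> * ?d powr a) * (D * ?h * ?d powr (b - \<beta>)) * K"
      using F symbol_withD(2)[OF D(2) *] by (rule prod_le)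
    also have "\<dots> = K * C * D * 9 powr \<bar>a\<bar> * ?h * ?d powr (a + b - \<beta>)"
      by (simp add: powr_add[symmetric] algebra_simps)
    finally show "norm (mul (F z) (G z) - mul (F z') (G z'))
       \<le> K * C * D * (1 + 9 powr \<bar>a\<bar>) * ?h * ?d powr (a + b - \<beta>)"
      by (simp add: algebra_simps)
  qed
qed

lemma symbol_mult:
  fixes F G :: "complex \<Rightarrow> 'x::real_normed_algebra"
  assumes "symbol \<beta> a F" "symbol \<beta> b G"
  shows "symbol \<beta> (a + b) (\<lambda>z. F z * G z)"
  using symbol_bilinear[OF bounded_bilinear_mult assms] .

lemma symbol_linear:
  assumes "bounded_linear L" "symbol \<beta> a F"
  shows "symbol \<beta> a (\<lambda>z. L (F z))"
proof -
  have "bounded_bilinear (\<lambda>(x::real) y. x *\<^sub>R L y)"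
    by (rule bounded_bilinear.comp[OF bounded_bilinear_scaleR bounded_linear_ident assms(1)])
  from symbol_bilinear[OF this symbol_const[of \<beta> 1] assms(2)] show ?thesis by simp
qed

lemma symbol_minus:
  assumes "symbol \<beta> a F"
  shows "symbol \<beta> a (\<lambda>z. - F z)"
  using symbol_linear[OF bounded_linear_minus[OF bounded_linear_ident] assms] .

lemma symbol_diff:
  assumes "symbol \<beta> a F" "symbol \<beta> a G"
  shows "symbol \<beta> a (\<lambda>z. F z - G z)"
  using symbol_add[OF assms(1) symbol_minus[OF assms(2)]] by simp

lemma symbol_cong:
  assumes "\<And>z. norm z < 1 \<Longrightarrow> F z = G z" "symbol \<beta> a F"
  shows "symbol \<beta> a G"
  using assms unfolding symbol_def symbol_with_def by auto

text \<open>Inversion, for operators as well as for scalars: the resolvent identity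
  \<open>S z - S z' = S z (A z' - A z) S z'\<close> turns the smoothness of \<open>A\<close> into that of \<open>S\<close>.\<close>

lemma symbol_resolvent:
  assumes mul: "bounded_bilinear mul" "bounded_bilinear mul'"
    and A: "symbol \<beta> a A"
    and S: "\<And>z. norm z < 1 \<Longrightarrow> norm (S z) \<le> C * norm (1 - z) powr (- a)"
    and id: "\<And>z z'. norm z < 1 \<Longrightarrow> norm z' < 1 \<Longrightarrow> S z - S z' = mul' (mul (S z) (A z' - A z)) (S z')"
  shows "symbol \<beta> (- a) S"
proof -
  obtain K where K: "K \<ge> 0" "\<And>x y. norm (mul x y) \<le> norm x * norm y * K"
    using bounded_bilinear.nonneg_bounded[OF mul(1)] by blast
  obtain K' where K': "K' \<ge> 0" "\<And>x y. norm (mul' x y) \<le> norm x * norm y * K'"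
    using bounded_bilinear.nonneg_bounded[OF mul(2)] by blast
  obtain D where D: "D \<ge> 0" "symbol_with D \<beta> a A" using A unfolding symbol_def by auto
  have C: "C \<ge> 0" using S[of 0] order_trans[OF norm_ge_zero] by fastforce
  show ?thesis
  proof (rule symbolI[where C = C and C' = "C * D * K * (C * 9 powr \<bar>a\<bar>) * K'"])
    fix z z' :: complex
    assume *: "norm z < 1" "norm z' < 1" "norm (1 - z) \<le> 9 * norm (1 - z')"
       "norm (1 - z') \<le> 9 * norm (1 - z)"
    let ?h = "norm (z - z') powr \<beta>" and ?d = "norm (1 - z)"
    have S': "norm (S z') \<le> C * (9 powr \<bar>a\<bar> * ?d powr - a)"
      using S[OF *(2)] powr_comparable[of ?d "norm (1 - z')" "-a"]
        * disc_distance_pos[OF *(1)] disc_distance_pos[OF *(2)] C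
      by (smt (verit, best) mult_left_mono abs_minus_cancel)
    have "norm (mul (S z) (A z' - A z)) \<le> norm (S z) * norm (A z' - A z) * K" by (rule K)
    also have "\<dots> \<le> C * ?d powr - a * (D * ?h * ?d powr (a - \<beta>)) * K"
      using S[OF *(1)] symbol_withD(2)[OF D(2) *] K(1) C D(1)
      by (intro mult_mono mult_nonneg_nonneg) (auto simp: norm_minus_commute)
    finally have 1: "norm (mul (S z) (A z' - A z)) \<le> C * ?d powr - a * (D * ?h * ?d powr (a - \<beta>)) * K" .
    have "norm (S z - S z') \<le> norm (mul (S z) (A z' - A z)) * norm (S z') * K'"
      using id[OF *(1,2)] K'(2) by simp
    also have "\<dots> \<le> C * ?d powr - a * (D * ?h * ?d powr (a - \<beta>)) * K * (C * (9 powr \<bar>a\<bar> * ?d powr - a)) * K'"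
      using 1 S' K K' C D by (intro mult_mono) auto
    also have "\<dots> = C * D * K * (C * 9 powr \<bar>a\<bar>) * K' * ?h * (?d powr - a * ?d powr (a - \<beta>) * ?d powr - a)"
      by (simp add: mult_ac)
    also have "?d powr - a * ?d powr (a - \<beta>) * ?d powr - a = ?d powr (- a - \<beta>)"
      unfolding powr_add[symmetric] by (rule arg_cong[where f = "\<lambda>t. ?d powr t"]) simp
    finally show "norm (S z - S z')
       \<le> C * D * K * (C * 9 powr \<bar>a\<bar>) * K' * ?h * ?d powr (- a - \<beta>)" .
  qed (use S in auto)
qed

lemma symbol_inverse:
  fixes F :: "complex \<Rightarrow> complex"
  assumes F: "symbol \<beta> a F" and c: "0 < c" "\<And>z. norm z < 1 \<Longrightarrow> c * norm (1 - z) powr a \<le> norm (F z)"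
  shows "symbol \<beta> (- a) (\<lambda>z. 1 / F z)"
proof (rule symbol_resolvent[OF bounded_bilinear_mult bounded_bilinear_mult F])
  have pos: "0 < c * norm (1 - z) powr a" if "norm z < 1" for z :: complex
    using disc_distance_pos[OF that] c by auto
  have nz: "F z \<noteq> 0" if "norm z < 1" for z
    using c(2)[OF that] pos[OF that] by auto
  show "norm (1 / F z) \<le> 1 / c * norm (1 - z) powr - a" if "norm z < 1" for z
  proof -
    have "norm (1 / F z) = 1 / norm (F z)" by (simp add: norm_divide)
    also have "\<dots> \<le> 1 / (c * norm (1 - z) powr a)"
      using c(2)[OF that] pos[OF that] by (intro frac_le) auto
    finally show ?thesis by (simp add: powr_minus_divide)
  qed
  show "1 / F z - 1 / F z' = 1 / F z * (F z' - F z) * (1 / F z')" if "norm z < 1" "norm z' < 1" for z z'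
    using nz that by (simp add: field_simps)
qed

lemma Re_one_minus_pos: "norm (z::complex) < 1 \<Longrightarrow> 0 < Re (1 - z)"
  using complex_Re_le_cmod[of z] by simp

lemma norm_powr_one_minus: "norm ((1 - z) powr of_real s :: complex) = norm (1 - z) powr s"
  by (simp add: norm_powr_real_powr')

text \<open>Points closer to each other than half of their distance to \<open>1\<close> are joined by a segment
  that keeps away from \<open>1\<close>, and the derivative is bounded there; for the others the size of the
  function is already small enough.\<close>

lemma symbol_powr:
  assumes \<beta>: "0 < \<beta>" "\<beta> \<le> 1"
  shows "symbol \<beta> s (\<lambda>z. (1 - z) powr of_real s)"
proof (rule symbolI[where C = 1 and C' = "max (\<bar>s\<bar> * 9 powr \<bar>s - 1\<bar>) ((1 + 9 powr \<bar>s\<bar>) * 2 powr \<beta>)"])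
  fix z z' :: complex
  assume *: "norm z < 1" "norm z' < 1" "norm (1 - z) \<le> 9 * norm (1 - z')"
     "norm (1 - z') \<le> 9 * norm (1 - z)"
  let ?h = "norm (z - z')" and ?d = "norm (1 - z)"
  let ?F = "\<lambda>z. (1 - z) powr of_real s :: complex"
  have d: "0 < ?d" using * disc_distance_pos by auto
  let ?M = "max (\<bar>s\<bar> * 9 powr \<bar>s - 1\<bar>) ((1 + 9 powr \<bar>s\<bar>) * 2 powr \<beta>)"
  show "norm (?F z - ?F z') \<le> ?M * ?h powr \<beta> * ?d powr (s - \<beta>)"
  proof (cases "?h < ?d / 2")
    case True
    then have hd: "?h \<le> ?d" using norm_ge_zero[of "1 - z"] by linarith
    define B where "B = unit_disc \<inter> ball z (?d / 2)"
    have "norm (?F z - ?F z') \<le> (\<bar>s\<bar> * (9 powr \<bar>s - 1\<bar> * ?d powr (s - 1))) * norm (z - z')"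
    proof (rule field_differentiable_bound)
      show "convex B" unfolding B_def by (intro convex_Int convex_ball)
      show "z \<in> B" "z' \<in> B" using * True d unfolding B_def by (auto simp: dist_norm)
      fix w assume w: "w \<in> B"
      then have w1: "norm w < 1" and wz: "norm (z - w) < ?d / 2"
        unfolding B_def by (auto simp: dist_norm)
      have "1 - w \<notin> \<real>\<^sub>\<le>\<^sub>0" using Re_one_minus_pos[OF w1] by (auto simp: complex_nonpos_Reals_iff)
      then show "(?F has_field_derivative (- of_real s * (1 - w) powr (of_real s - 1))) (at w within B)"
        by (auto intro!: derivative_eq_intros)
      have tri: "norm (1 - w) \<le> ?d + norm (z - w)" "?d \<le> norm (1 - w) + norm (z - w)"
        using norm_triangle_ineq[of "1 - z" "z - w"] norm_triangle_ineq[of "1 - w" "w - z"]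
        by (auto simp: norm_minus_commute)
      then have "norm (1 - w) powr (s - 1) \<le> 9 powr \<bar>s - 1\<bar> * ?d powr (s - 1)"
        using wz d disc_distance_pos[OF w1] by (intro powr_comparable) linarith+
      moreover have "norm ((1 - w) powr (of_real s - 1)) = norm (1 - w) powr (s - 1)"
        using norm_powr_one_minus[of w "s - 1"] by simp
      ultimately show "norm (- of_real s * (1 - w) powr (of_real s - 1))
            \<le> \<bar>s\<bar> * (9 powr \<bar>s - 1\<bar> * ?d powr (s - 1))"
        by (simp add: norm_mult mult_left_mono)
    qed
    also have "norm (z - z') \<le> ?h powr \<beta> * ?d powr (1 - \<beta>)"
    proof (cases "?h = 0")
      case False
      then have "?h = ?h powr \<beta> * ?h powr (1 - \<beta>)" by (simp add: powr_add[symmetric])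
      also have "\<dots> \<le> ?h powr \<beta> * ?d powr (1 - \<beta>)"
        using \<beta> hd d by (intro mult_left_mono powr_mono2) auto
      finally show ?thesis .
    qed auto
    also have "\<bar>s\<bar> * (9 powr \<bar>s - 1\<bar> * ?d powr (s - 1)) * (?h powr \<beta> * ?d powr (1 - \<beta>))
        = \<bar>s\<bar> * 9 powr \<bar>s - 1\<bar> * ?h powr \<beta> * (?d powr (s - 1) * ?d powr (1 - \<beta>))"
      by (simp add: mult_ac)
    also have "?d powr (s - 1) * ?d powr (1 - \<beta>) = ?d powr (s - \<beta>)"
      by (simp add: powr_add[symmetric])
    also have "\<bar>s\<bar> * 9 powr \<bar>s - 1\<bar> * ?h powr \<beta> * ?d powr (s - \<beta>) \<le> ?M * ?h powr \<beta> * ?d powr (s - \<beta>)"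
      by (intro mult_right_mono) auto
    finally show ?thesis by (simp add: mult_left_mono)
  next
    case False
    have "norm (?F z - ?F z') \<le> norm (?F z) + norm (?F z')" by (rule norm_triangle_ineq4)
    also have "\<dots> = ?d powr s + norm (1 - z') powr s" by (simp only: norm_powr_one_minus)
    also have "\<dots> \<le> (1 + 9 powr \<bar>s\<bar>) * ?d powr s"
      using powr_comparable[of ?d "norm (1 - z')" s] * d disc_distance_pos[OF *(2)]
      by (simp add: algebra_simps)
    also have "?d powr s = ?d powr \<beta> * ?d powr (s - \<beta>)" by (simp add: powr_add[symmetric])
    also have "?d powr \<beta> \<le> (2 * ?h) powr \<beta>" using False \<beta> d by (intro powr_mono2) auto
    also have "(2 * ?h) powr \<beta> = 2 powr \<beta> * ?h powr \<beta>" by (simp add: powr_mult)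
    also have "(1 + 9 powr \<bar>s\<bar>) * (2 powr \<beta> * ?h powr \<beta> * ?d powr (s - \<beta>))
       = ((1 + 9 powr \<bar>s\<bar>) * 2 powr \<beta>) * ?h powr \<beta> * ?d powr (s - \<beta>)" by simp
    also have "\<dots> \<le> ?M * ?h powr \<beta> * ?d powr (s - \<beta>)"
      by (intro mult_right_mono) auto
    finally show ?thesis by (simp add: mult_left_mono mult_right_mono)
  qed
qed (simp add: norm_powr_one_minus)


section \<open>Decay of the coefficients of a power series\<close>

lemma has_integral_cis:
  fixes m :: int
  shows "((\<lambda>\<theta>. cis (of_int m * \<theta>)) has_integral (if m = 0 then of_real (2 * pi) else 0)) {-pi..pi}"
proof (cases "m = 0")
  case True
  then show ?thesis using has_integral_const_real[of "1::complex" "-pi" pi]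
    by (simp add: scaleR_conv_of_real)
next
  case False
  have "((\<lambda>\<theta>. cis (of_int m * \<theta>)) has_integral
     (- \<i> / of_int m * cis (of_int m * pi)) - (- \<i> / of_int m * cis (of_int m * (-pi)))) {-pi..pi}"
  proof (rule fundamental_theorem_of_calculus)
    fix x :: real
    have "((\<lambda>\<theta>. cis (of_int m * \<theta>)) has_derivative (\<lambda>t. (of_int m * t) *\<^sub>R (\<i> * cis (of_int m * x)))) (at x within {-pi..pi})"
      by (auto intro!: derivative_eq_intros)
    then have "((\<lambda>\<theta>. cis (of_int m * \<theta>)) has_vector_derivative (of_int m *\<^sub>R (\<i> * cis (of_int m * x)))) (at x within {-pi..pi})"
      unfolding has_vector_derivative_def by (simp add: mult.commute)
    from has_vector_derivative_mult_right[OF this, of "- \<i> / of_int m"] False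
    show "((\<lambda>\<theta>. - \<i> / of_int m * cis (of_int m * \<theta>)) has_vector_derivative cis (of_int m * x)) (at x within {-pi..pi})"
      by (simp add: scaleR_conv_of_real)
  qed simp
  moreover have "cis (of_int m * pi) = cis (of_int m * (-pi))"
  proof -
    have "sin (of_int m * pi) = 0" using sin_zero_iff_int2 by auto
    then show ?thesis by (simp add: cis.code complex_eq_iff)
  qed
  ultimately show ?thesis using False by simp
qed

lemma norm_cis_minus_one: "norm (1 - cis x) \<le> \<bar>x\<bar>"
proof -
  have "(norm (1 - cis x))\<^sup>2 = 1 - 2 * cos x + ((sin x)\<^sup>2 + (cos x)\<^sup>2)"
    unfolding cmod_power2 by (simp add: power2_eq_square algebra_simps)
  also have "\<dots> = 2 - 2 * cos x" using sin_cos_squared_add[of x] by simp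
  also have "\<dots> = (2 * sin (x / 2))\<^sup>2"
    using cos_double_sin[of "x / 2"] by (simp add: power_mult_distrib)
  also have "\<dots> \<le> \<bar>x\<bar>\<^sup>2"
    using abs_sin_x_le_abs_x[of "x / 2"] by (intro power2_le_iff_abs_le[THEN iffD2]) (auto simp: abs_mult)
  finally show ?thesis by (rule power2_le_imp_le) simp
qed

text \<open>On a circle of radius less than \<open>1\<close> the series converges uniformly and is integrated term by
  term.\<close>

lemma fourier_coefficient:
  assumes r: "0 \<le> r" "r < 1"
    and F: "\<And>z. norm z < 1 \<Longrightarrow> (\<lambda>k. f k * z ^ k) sums F z"
  shows "((\<lambda>\<theta>. F (of_real r * cis \<theta>) * cis (- real n * \<theta>)) has_integral
           of_real (2 * pi * r ^ n) * f n) {-pi..pi}"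
proof -
  define g where "g k \<theta> = f k * (of_real r * cis \<theta>) ^ k * cis (- real n * \<theta>)" for k \<theta>
  have g_eq: "g k \<theta> = (f k * of_real r ^ k) * cis (of_int (int k - int n) * \<theta>)" for k \<theta>
    unfolding g_def by (simp add: power_mult_distrib Complex.DeMoivre cis_mult algebra_simps)
  have g_sums: "(\<lambda>k. g k \<theta>) sums (F (of_real r * cis \<theta>) * cis (- real n * \<theta>))" for \<theta>
    unfolding g_def using r by (intro sums_mult2 F) (simp add: norm_mult)
  have unif: "uniform_limit {-pi..pi} (\<lambda>N \<theta>. \<Sum>k<N. g k \<theta>) (\<lambda>\<theta>. F (of_real r * cis \<theta>) * cis (- real n * \<theta>)) sequentially"
  proof -
    have "uniform_limit {-pi..pi} (\<lambda>N \<theta>. \<Sum>k<N. g k \<theta>) (\<lambda>\<theta>. \<Sum>k. g k \<theta>) sequentially"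
    proof (rule Weierstrass_m_test)
      define \<rho> where "\<rho> = (1 + r) / 2"
      have \<rho>: "0 \<le> \<rho>" "\<rho> < 1" "r < \<rho>" using r by (auto simp: \<rho>_def)
      then have "norm (of_real \<rho> :: complex) < 1" by simp
      then have "summable (\<lambda>k. f k * of_real \<rho> ^ k)" using F sums_summable by blast
      moreover have "norm (of_real r :: complex) < norm (of_real \<rho> :: complex)" using \<rho> r by simp
      ultimately show "summable (\<lambda>k. norm (f k * of_real r ^ k))" by (rule powser_insidea)
      show "norm (g k \<theta>) \<le> norm (f k * of_real r ^ k)" for k \<theta>
        unfolding g_eq by (simp add: norm_mult)
    qed
    moreover have "(\<Sum>k. g k \<theta>) = F (of_real r * cis \<theta>) * cis (- real n * \<theta>)" for \<theta>
      using g_sums by (simp add: sums_iff)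
    ultimately show ?thesis by simp
  qed
  have cont: "continuous_on {-pi..pi} (\<lambda>\<theta>. \<Sum>k<N. g k \<theta>)" for N
    unfolding g_def by (intro continuous_intros)
  obtain I J where I: "\<And>N. ((\<lambda>\<theta>. \<Sum>k<N. g k \<theta>) has_integral I N) {-pi..pi}"
    and J: "((\<lambda>\<theta>. F (of_real r * cis \<theta>) * cis (- real n * \<theta>)) has_integral J) {-pi..pi}"
    and lim: "(I \<longlongrightarrow> J) sequentially"
    by (rule uniform_limit_integral[OF unif cont sequentially_bot]) (rule that; assumption)
  have "I N = of_real (2 * pi * r ^ n) * f n" if "n < N" for N
  proof -
    have "((\<lambda>\<theta>. \<Sum>k<N. g k \<theta>) has_integral
        (\<Sum>k<N. (f k * of_real r ^ k) * (if int k - int n = 0 then of_real (2 * pi) else 0))) {-pi..pi}"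
      unfolding g_eq by (intro has_integral_sum has_integral_mult_right has_integral_cis) auto
    also have "(\<Sum>k<N. (f k * of_real r ^ k) * (if int k - int n = 0 then of_real (2 * pi) else 0))
       = (\<Sum>k<N. if k = n then of_real (2 * pi * r ^ n) * f n else 0)"
      by (intro sum.cong) auto
    also have "\<dots> = of_real (2 * pi * r ^ n) * f n" using that by simp
    finally show ?thesis using I has_integral_unique by blast
  qed
  then have "(I \<longlongrightarrow> of_real (2 * pi * r ^ n) * f n) sequentially"
    by (intro tendsto_eventually) (auto simp: eventually_sequentially intro!: exI[of _ "Suc n"])
  with lim J show ?thesis using LIMSEQ_unique by blast
qed

lemma sin_ge_quarter:
  assumes "0 \<le> x" "x \<le> pi / 2"
  shows "x / 4 \<le> sin x"
proof (cases "x \<le> pi / 3")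
  case True
  show ?thesis
  proof (cases "x = 0")
    case False
    then obtain z where z: "0 < z" "z < x" "sin x - sin 0 = (x - 0) * cos z"
      using MVT2[of 0 x sin cos] assms by auto
    have "cos (pi / 3) \<le> cos z" using z True by (intro cos_monotone_0_pi_le) auto
    then have "1 / 2 \<le> cos z" by (simp add: cos_60)
    then have "x * (1/4) \<le> x * cos z" using assms by (intro mult_left_mono) auto
    then show ?thesis using z by simp
  qed simp
next
  case False
  have "sin (pi / 6) \<le> sin x" using False assms by (intro sin_monotone_2pi_le) auto
  then show ?thesis using assms pi_less_4 by (simp add: sin_30)
qed

text \<open>\<open>\<bar>1 - r e\<^bsup>\<i>\<theta>\<^esup>\<bar>\<^sup>2 = (1 - r)\<^sup>2 + 4 r sin\<^sup>2 (\<theta> / 2)\<close>.\<close>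

lemma norm_one_minus_polar:
  assumes r: "1 / 2 \<le> r" "r < 1" and \<theta>: "\<theta> \<in> {-pi..pi}"
  shows "((1 - r) + \<bar>\<theta>\<bar>) / 8 \<le> norm (1 - of_real r * cis \<theta>)"
proof -
  have "(norm (1 - of_real r * cis \<theta>))\<^sup>2 = (1 - r * cos \<theta>)\<^sup>2 + (r * sin \<theta>)\<^sup>2"
    unfolding cmod_power2 by simp
  also have "\<dots> = 1 - 2 * r * cos \<theta> + r\<^sup>2 * ((sin \<theta>)\<^sup>2 + (cos \<theta>)\<^sup>2)"
    by algebra
  also have "\<dots> = 1 - 2 * r * cos \<theta> + r\<^sup>2" using sin_cos_squared_add[of \<theta>] by simp
  also have "\<dots> = (1 - r)\<^sup>2 + 2 * r * (1 - cos \<theta>)" by (simp add: power2_eq_square algebra_simps)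
  also have "1 - cos \<theta> = 2 * (sin (\<bar>\<theta>\<bar> / 2))\<^sup>2"
    using cos_double_sin[of "\<bar>\<theta>\<bar> / 2"] by simp
  finally have eq: "(norm (1 - of_real r * cis \<theta>))\<^sup>2 = (1 - r)\<^sup>2 + 4 * r * (sin (\<bar>\<theta>\<bar> / 2))\<^sup>2"
    by simp
  have "(\<bar>\<theta>\<bar> / 8)\<^sup>2 \<le> (sin (\<bar>\<theta>\<bar> / 2))\<^sup>2"
    using sin_ge_quarter[of "\<bar>\<theta>\<bar> / 2"] \<theta> by (intro power_mono) auto
  then have "2 * (\<bar>\<theta>\<bar> / 8)\<^sup>2 \<le> 4 * r * (sin (\<bar>\<theta>\<bar> / 2))\<^sup>2"
    using r by (intro mult_mono) auto
  moreover have "(((1 - r) + \<bar>\<theta>\<bar>) / 8)\<^sup>2 \<le> (1 - r)\<^sup>2 + 2 * (\<bar>\<theta>\<bar> / 8)\<^sup>2"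
  proof -
    have "0 \<le> (1 - r - \<bar>\<theta>\<bar>)\<^sup>2" by simp
    moreover have "0 \<le> (1 - r)\<^sup>2" by simp
    ultimately show ?thesis by (simp add: power2_eq_square field_simps)
  qed
  ultimately have "(((1 - r) + \<bar>\<theta>\<bar>) / 8)\<^sup>2 \<le> (norm (1 - of_real r * cis \<theta>))\<^sup>2"
    using eq by simp
  then show ?thesis by (rule power2_le_imp_le) simp
qed

lemma has_integral_power_peak:
  fixes s :: real
  assumes s: "0 < s" and e: "0 < \<epsilon>"
  shows "((\<lambda>\<theta>. (\<epsilon> + \<bar>\<theta>\<bar>) powr (- 1 - s)) has_integral 2 * (\<epsilon> powr - s - (\<epsilon> + pi) powr - s) / s) {-pi..pi}"
proof -
  have exponent: "- s - 1 = - 1 - s" by simp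
  have "((\<lambda>\<theta>. (\<epsilon> + \<bar>\<theta>\<bar>) powr (- 1 - s)) has_integral
      - ((\<epsilon> + pi) powr - s) / s - (- ((\<epsilon> + 0) powr - s) / s)) {0..pi}"
  proof (rule fundamental_theorem_of_calculus)
    fix x :: real assume x: "x \<in> {0..pi}"
    have "((\<lambda>x. - ((\<epsilon> + x) powr - s) / s) has_real_derivative (\<epsilon> + x) powr (- s - 1)) (at x within {0..pi})"
      using s e x by (auto intro!: derivative_eq_intros)
    then show "((\<lambda>x. - ((\<epsilon> + x) powr - s) / s) has_vector_derivative (\<epsilon> + \<bar>x\<bar>) powr (- 1 - s)) (at x within {0..pi})"
      using x unfolding has_real_derivative_iff_has_vector_derivative exponent by simp
  qed simp
  moreover have "((\<lambda>\<theta>. (\<epsilon> + \<bar>\<theta>\<bar>) powr (- 1 - s)) has_integral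
      ((\<epsilon> - 0) powr - s) / s - ((\<epsilon> - (-pi)) powr - s) / s) {-pi..0}"
  proof (rule fundamental_theorem_of_calculus)
    fix x :: real assume x: "x \<in> {-pi..0}"
    have "((\<lambda>x. ((\<epsilon> - x) powr - s) / s) has_real_derivative (\<epsilon> - x) powr (- s - 1)) (at x within {-pi..0})"
      using s e x by (auto intro!: derivative_eq_intros)
    then show "((\<lambda>x. ((\<epsilon> - x) powr - s) / s) has_vector_derivative (\<epsilon> + \<bar>x\<bar>) powr (- 1 - s)) (at x within {-pi..0})"
      using x unfolding has_real_derivative_iff_has_vector_derivative exponent by simp
  qed simp
  ultimately have "((\<lambda>\<theta>. (\<epsilon> + \<bar>\<theta>\<bar>) powr (- 1 - s)) has_integral
      (((\<epsilon> - 0) powr - s) / s - ((\<epsilon> - (-pi)) powr - s) / s)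
    + (- ((\<epsilon> + pi) powr - s) / s - (- ((\<epsilon> + 0) powr - s) / s))) {-pi..pi}"
    by (intro has_integral_combine[where b = pi and a = "-pi" and c = 0]) auto
  then show ?thesis by (simp add: diff_divide_distrib algebra_simps)
qed

text \<open>With \<open>\<omega> = e\<^bsup>\<i>\<pi>/n\<^esup>\<close> the function \<open>F z - F (\<omega> z)\<close> has \<open>n\<close>-th coefficient \<open>2 f n\<close>, since
  \<open>\<omega> ^ n = -1\<close>. On the circle of radius \<open>1 - 1 / (2 n)\<close> it is bounded by
  a multiple of \<open>n powr - \<beta> * \<bar>1 - z\<bar> powr (\<kappa> - 1 - \<beta>)\<close>, and as \<open>\<kappa> < \<beta>\<close> the mean of this bound is
  dominated by the points at distance of order \<open>1 / n\<close> from \<open>1\<close>. The constant \<open>K\<close> does not depend on \<open>F\<close>; this is what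
  makes the final estimate uniform in the initial density and in the observable.\<close>

lemma power_series_coefficient_bound:
  assumes \<kappa>: "0 < \<kappa>" "\<kappa> < \<beta>"
  shows "\<exists>K\<ge>0. \<forall>C F f. (\<forall>z. norm z < 1 \<longrightarrow> (\<lambda>k. f k * z ^ k) sums F z) \<longrightarrow>
      symbol_with C \<beta> (\<kappa> - 1) F \<longrightarrow> (\<forall>n\<ge>1. norm (f n) \<le> K * C * real n powr - \<kappa>)"
proof -
  define s where "s = \<beta> - \<kappa>"
  have s: "0 < s" using \<kappa> by (simp add: s_def)
  define K where "K = (pi powr \<beta> * 8 powr (1 + s) * (2 * 2 powr s / s)) / (2 * pi)"
  have K: "K \<ge> 0" using s by (simp add: K_def)
  show ?thesis
  proof (intro exI[of _ K] conjI allI impI K)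
    fix C :: real and F :: "complex \<Rightarrow> complex" and f :: "nat \<Rightarrow> complex" and n :: nat
    assume sums: "\<forall>z. norm z < 1 \<longrightarrow> (\<lambda>k. f k * z ^ k) sums F z"
      and sym: "symbol_with C \<beta> (\<kappa> - 1) F" and n: "1 \<le> n"
    define r where "r = 1 - 1 / (2 * real n)"
    have r: "1 / 2 \<le> r" "r < 1" "1 - r = 1 / (2 * real n)"
      using n by (auto simp: r_def field_simps)
    define \<omega> where "\<omega> = cis (pi / real n)"
    have norm\<omega>: "norm \<omega> = 1" by (simp add: \<omega>_def)
    have \<omega>n: "\<omega> ^ n = -1" using n by (simp add: \<omega>_def Complex.DeMoivre)
    have C: "C \<ge> 0" using symbol_withD(1)[OF sym, of 0] order_trans[OF norm_ge_zero] by fastforce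
    define G where "G \<theta> = (F (of_real r * cis \<theta>) - F (\<omega> * (of_real r * cis \<theta>))) * cis (- real n * \<theta>)" for \<theta>
    have G: "(G has_integral of_real (4 * pi * r ^ n) * f n) {-pi..pi}"
    proof -
      have "((\<lambda>\<theta>. F (of_real r * cis \<theta>) * cis (- real n * \<theta>)) has_integral
           of_real (2 * pi * r ^ n) * f n) {-pi..pi}"
        using r sums by (intro fourier_coefficient) auto
      moreover have "((\<lambda>\<theta>. F (\<omega> * (of_real r * cis \<theta>)) * cis (- real n * \<theta>)) has_integral
           of_real (2 * pi * r ^ n) * (f n * \<omega> ^ n)) {-pi..pi}"
      proof (rule fourier_coefficient[where F = "\<lambda>z. F (\<omega> * z)" and f = "\<lambda>k. f k * \<omega> ^ k"])
        fix z :: complex assume "norm z < 1"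
        then have "norm (\<omega> * z) < 1" by (simp add: norm_mult norm\<omega>)
        then have "(\<lambda>k. f k * (\<omega> * z) ^ k) sums F (\<omega> * z)" using sums by blast
        then show "(\<lambda>k. f k * \<omega> ^ k * z ^ k) sums F (\<omega> * z)"
          by (simp add: power_mult_distrib mult.assoc)
      qed (use r in auto)
      ultimately have "((\<lambda>\<theta>. F (of_real r * cis \<theta>) * cis (- real n * \<theta>)
            - F (\<omega> * (of_real r * cis \<theta>)) * cis (- real n * \<theta>)) has_integral
           of_real (2 * pi * r ^ n) * f n - of_real (2 * pi * r ^ n) * (f n * \<omega> ^ n)) {-pi..pi}"
        by (rule has_integral_diff)
      then show ?thesis unfolding G_def \<omega>n by (simp add: algebra_simps)
    qed
    let ?L = "C * (pi / real n) powr \<beta> * 8 powr (1 + s)"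
    have G_le: "norm (G \<theta>) \<le> ?L * ((1 - r) + \<bar>\<theta>\<bar>) powr (- 1 - s)" if \<theta>: "\<theta> \<in> {-pi..pi}" for \<theta>
    proof -
      define z where "z = of_real r * cis \<theta>"
      have z: "norm z < 1" "norm (\<omega> * z) < 1" using r by (auto simp: z_def norm_mult norm\<omega>)
      have "z - \<omega> * z = (1 - \<omega>) * z" by (simp add: algebra_simps)
      then have "norm (z - \<omega> * z) \<le> norm (1 - \<omega>) * 1"
        using z by (simp add: norm_mult mult_left_le)
      also have "\<dots> \<le> pi / real n" using norm_cis_minus_one[of "pi / real n"] by (simp add: \<omega>_def)
      finally have h: "norm (z - \<omega> * z) \<le> pi / real n" .
      have dist: "1 / (2 * real n) \<le> norm (1 - w)" if "norm w = r" for w :: complex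
        using norm_triangle_ineq2[of 1 w] that r by simp
      have d: "1 / (2 * real n) \<le> norm (1 - z)" "1 / (2 * real n) \<le> norm (1 - \<omega> * z)"
        using r by (auto intro!: dist simp: z_def norm_mult norm\<omega>)
      have "pi / real n \<le> 8 * (1 / (2 * real n))" using pi_less_4 n by (simp add: field_simps)
      then have near: "norm (1 - z) \<le> 9 * norm (1 - \<omega> * z)" "norm (1 - \<omega> * z) \<le> 9 * norm (1 - z)"
        using d h norm_triangle_ineq[of "1 - z" "z - \<omega> * z"]
          norm_triangle_ineq[of "1 - \<omega> * z" "\<omega> * z - z"] norm_minus_commute[of z "\<omega> * z"]
        by simp_all
      have "norm (G \<theta>) = norm (F z - F (\<omega> * z))" by (simp add: G_def z_def norm_mult)
      also have "\<dots> \<le> C * norm (z - \<omega> * z) powr \<beta> * norm (1 - z) powr (\<kappa> - 1 - \<beta>)"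
        using z near by (rule symbol_withD(2)[OF sym])
      also have "\<dots> \<le> C * (pi / real n) powr \<beta> * (((1 - r) + \<bar>\<theta>\<bar>) / 8) powr (\<kappa> - 1 - \<beta>)"
      proof (intro mult_mono)
        show "norm (z - \<omega> * z) powr \<beta> \<le> (pi / real n) powr \<beta>"
          using h \<kappa> by (intro powr_mono2) auto
        show "norm (1 - z) powr (\<kappa> - 1 - \<beta>) \<le> (((1 - r) + \<bar>\<theta>\<bar>) / 8) powr (\<kappa> - 1 - \<beta>)"
          unfolding z_def using norm_one_minus_polar[of r \<theta>] r \<theta> \<kappa> by (intro powr_mono2') auto
      qed (use C in auto)
      also have "\<kappa> - 1 - \<beta> = - 1 - s" by (simp add: s_def)
      also have "(((1 - r) + \<bar>\<theta>\<bar>) / 8) powr (- 1 - s) = 8 powr (1 + s) * ((1 - r) + \<bar>\<theta>\<bar>) powr (- 1 - s)"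
        using r powr_minus_divide[of "8::real" "1 + s"] by (simp add: powr_divide)
      finally show ?thesis by (simp only: mult.assoc)
    qed
    have "0 < 1 - r" using r(2) by simp
    note peak = has_integral_mult_right[OF has_integral_power_peak[OF s this], of ?L]
    have "norm (integral {-pi..pi} G) \<le> integral {-pi..pi} (\<lambda>\<theta>. ?L * ((1 - r) + \<bar>\<theta>\<bar>) powr (- 1 - s))"
    proof (rule integral_norm_bound_integral)
      show "G integrable_on {-pi..pi}" using G by blast
      show "(\<lambda>\<theta>. ?L * ((1 - r) + \<bar>\<theta>\<bar>) powr (- 1 - s)) integrable_on {-pi..pi}"
        using peak by blast
    qed (rule G_le)
    also have "\<dots> = ?L * (2 * ((1 - r) powr - s - ((1 - r) + pi) powr - s) / s)"
      using peak by (rule integral_unique)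
    also have "\<dots> \<le> ?L * (2 * (1 - r) powr - s / s)"
      using s C by (intro mult_left_mono divide_right_mono) auto
    also have "(1 - r) powr - s = 2 powr s * real n powr s"
      unfolding r(3) using n by (simp add: powr_divide powr_minus_divide powr_mult)
    also have "?L * (2 * (2 powr s * real n powr s) / s) = 2 * pi * K * C * (real n powr - \<beta> * real n powr s)"
      using n by (simp add: K_def powr_divide powr_minus_divide) (simp add: mult_ac)
    also have "real n powr - \<beta> * real n powr s = real n powr - \<kappa>"
      by (simp add: powr_add[symmetric] s_def)
    finally have "norm (integral {-pi..pi} G) \<le> 2 * pi * K * C * real n powr - \<kappa>" .
    then have *: "4 * pi * r ^ n * norm (f n) \<le> 2 * pi * K * C * real n powr - \<kappa>"
      using integral_unique[OF G] r(1) by (simp add: norm_mult norm_power)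
    \<comment> \<open>The radius was chosen so close to \<open>1\<close> that \<open>r ^ n\<close> stays bounded from below.\<close>
    have "1 - real n * (1 / (2 * real n)) \<le> (1 - 1 / (2 * real n)) ^ n"
      using Bernoulli_inequality[of "- (1 / (2 * real n))" n] n by (simp add: divide_le_eq)
    then have "1 / 2 \<le> r ^ n" using n by (simp add: r_def)
    then have "4 * pi * (1/2) * norm (f n) \<le> 4 * pi * r ^ n * norm (f n)"
      by (intro mult_right_mono mult_left_mono) auto
    with * have "2 * pi * norm (f n) \<le> 2 * pi * (K * C * real n powr - \<kappa>)" by (simp add: mult_ac)
    then show "norm (f n) \<le> K * C * real n powr - \<kappa>" by simp
  qed
qed


section \<open>Coefficients of powers of 1 - z\<close>

text \<open>The coefficients of \<open>(1 - z) powr (- s)\<close>.\<close>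

definition negbin :: "real \<Rightarrow> nat \<Rightarrow> real" where
  "negbin s n = pochhammer s n / fact n"

lemma negbin_sums:
  assumes "norm (z::complex) < 1"
  shows "(\<lambda>n. of_real (negbin s n) * z ^ n) sums (1 - z) powr of_real (- s)"
proof -
  have "(\<lambda>n. (of_real (- s) gchoose n) * (- z) ^ n) sums (1 + - z) powr of_real (- s)"
    using assms by (intro gen_binomial_complex) simp
  moreover have "(of_real (- s) gchoose n) * (- z) ^ n = of_real (negbin s n) * z ^ n" for n
  proof -
    have "(of_real (- s) gchoose n) * (- z) ^ n
        = ((-1) ^ n * (- z) ^ n) * (of_real (pochhammer s n) / fact n)"
      by (simp add: gbinomial_pochhammer pochhammer_of_real)
    also have "(-1) ^ n * (- z) ^ n = z ^ n" by (simp flip: power_mult_distrib)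
    finally show ?thesis by (simp add: negbin_def)
  qed
  ultimately show ?thesis by simp
qed

lemma negbin_Suc: "negbin s (Suc n) = negbin s n * ((s + real n) / (real n + 1))"
  by (simp add: negbin_def pochhammer_Suc field_simps)

lemma negbin_pos: "0 < s \<Longrightarrow> 0 < negbin s n"
  by (simp add: negbin_def pochhammer_pos)

lemma negbin_tendsto:
  assumes "0 < s"
  shows "(\<lambda>n. negbin s n * real n powr (1 - s)) \<longlonglongrightarrow> 1 / Gamma s"
proof -
  have "(\<lambda>n. rGamma_series s n * (real n / (real n + s))) \<longlonglongrightarrow> rGamma s * 1"
  proof (rule tendsto_mult)
    have "(\<lambda>n. 1 / (1 + s * inverse (real n))) \<longlonglongrightarrow> 1 / (1 + s * 0)"
      by (intro tendsto_intros lim_inverse_n) auto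
    moreover have "eventually (\<lambda>n. 1 / (1 + s * inverse (real n)) = real n / (real n + s)) sequentially"
      using eventually_gt_at_top[of 0] by eventually_elim (use assms in \<open>simp add: field_simps\<close>)
    ultimately show "(\<lambda>n. real n / (real n + s)) \<longlonglongrightarrow> 1"
      by (simp add: filterlim_cong)
  qed (rule rGamma_series_LIMSEQ)
  moreover have "eventually (\<lambda>n. rGamma_series s n * (real n / (real n + s))
      = negbin s n * real n powr (1 - s)) sequentially"
    using eventually_gt_at_top[of 0]
  proof eventually_elim
    case (elim n)
    then have "exp (s * ln (real n)) = real n powr s" by (simp add: powr_def)
    moreover have "real n powr (1 - s) = real n / real n powr s" using elim by (simp add: powr_diff)
    moreover have "pochhammer s (n + 1) = pochhammer s n * (real n + s)"
      by (simp add: pochhammer_Suc add.commute)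
    moreover have "real n + s \<noteq> 0" using assms by linarith
    ultimately show ?case
      by (simp add: rGamma_series_def negbin_def)
  qed
  ultimately show ?thesis by (simp add: filterlim_cong rGamma_inverse_Gamma inverse_eq_divide)
qed

text \<open>Gautschi's inequality. The coefficients times \<open>n powr (1 - s)\<close> increase and times
  \<open>(n + 1) powr (1 - s)\<close> decrease to the same limit \<open>1 / Gamma s\<close>.\<close>

lemma negbin_bounds:
  assumes s: "0 < s" "s < 1" and n: "1 \<le> n"
  shows "negbin s n \<le> real n powr (s - 1) / Gamma s"
    and "(real n + 1) powr (s - 1) / Gamma s \<le> negbin s n"
proof -
  define x where "x n = negbin s n * real n powr (1 - s)" for n
  define y where "y n = negbin s n * (real n + 1) powr (1 - s)" for n
  have lim: "x \<longlonglongrightarrow> 1 / Gamma s" unfolding x_def using s by (intro negbin_tendsto) auto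
  have inc: "x m \<le> x (Suc m)" if m: "1 \<le> m" for m
  proof -
    have "(real m / (real m + 1)) powr (1 - s) * 1 powr s \<le> (1 - s) * (real m / (real m + 1)) + s * 1"
      using s m by (intro Youngs_inequality_0) auto
    also have "\<dots> = (s + real m) / (real m + 1)" by (simp add: field_simps)
    finally have "real m powr (1 - s) \<le> (s + real m) / (real m + 1) * (real m + 1) powr (1 - s)"
      using m by (simp add: powr_divide field_simps)
    then have "negbin s m * real m powr (1 - s)
        \<le> negbin s m * ((s + real m) / (real m + 1) * (real m + 1) powr (1 - s))"
      using negbin_pos[OF s(1), of m] by (intro mult_left_mono) auto
    then show ?thesis by (simp add: x_def negbin_Suc mult_ac add_ac)
  qed
  have dec: "y (Suc m) \<le> y m" for m
  proof -
    have "((real m + 2) / (real m + 1)) powr (1 - s) * 1 powr s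
        \<le> (1 - s) * ((real m + 2) / (real m + 1)) + s * 1"
      using s by (intro Youngs_inequality_0) auto
    also have "\<dots> = (real m + 2 - s) / (real m + 1)" by (simp add: field_simps)
    finally have "(real m + 2) powr (1 - s) \<le> (real m + 2 - s) / (real m + 1) * (real m + 1) powr (1 - s)"
      by (simp add: powr_divide field_simps)
    then have "(s + real m) / (real m + 1) * (real m + 2) powr (1 - s)
       \<le> (s + real m) / (real m + 1) * ((real m + 2 - s) / (real m + 1) * (real m + 1) powr (1 - s))"
      using s by (intro mult_left_mono) auto
    also have "\<dots> = ((s + real m) * (real m + 2 - s)) / (real m + 1)\<^sup>2 * (real m + 1) powr (1 - s)"
      by (simp add: power2_eq_square)
    also have "\<dots> \<le> 1 * (real m + 1) powr (1 - s)"
    proof (intro mult_right_mono)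
      have "0 \<le> (1 - s)\<^sup>2" by simp
      then have "(s + real m) * (real m + 2 - s) \<le> (real m + 1)\<^sup>2"
        by (simp add: power2_eq_square algebra_simps)
      then show "((s + real m) * (real m + 2 - s)) / (real m + 1)\<^sup>2 \<le> 1"
        by simp
    qed auto
    finally have "negbin s m * ((s + real m) / (real m + 1) * (real m + 2) powr (1 - s))
        \<le> negbin s m * (real m + 1) powr (1 - s)"
      using negbin_pos[OF s(1), of m] by (intro mult_left_mono) auto
    moreover have "1 + (1 + real m) = real m + 2" by simp
    ultimately show ?thesis by (simp add: y_def negbin_Suc mult_ac add_ac)
  qed
  have limy: "y \<longlonglongrightarrow> 1 / Gamma s"
  proof -
    have "(\<lambda>n. x n * (1 + inverse (real n)) powr (1 - s)) \<longlonglongrightarrow> 1 / Gamma s * (1 + 0) powr (1 - s)"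
      by (intro tendsto_intros lim lim_inverse_n) auto
    moreover have "eventually (\<lambda>n. x n * (1 + inverse (real n)) powr (1 - s) = y n) sequentially"
      using eventually_gt_at_top[of 0]
    proof eventually_elim
      case (elim n)
      then have "real n * (1 + inverse (real n)) = real n + 1" by (simp add: field_simps)
      then show ?case using elim by (simp add: x_def y_def flip: powr_mult)
    qed
    ultimately show ?thesis by (simp add: filterlim_cong)
  qed
  have "x n \<le> 1 / Gamma s"
  proof (rule LIMSEQ_le_const[OF lim], intro exI[of _ n] allI impI)
    fix m assume "n \<le> m"
    then show "x n \<le> x m"
    proof (induction m rule: dec_induct)
      case (step k)
      then show ?case using inc[of k] n by linarith
    qed simp
  qed
  then have "x n * real n powr (s - 1) \<le> 1 / Gamma s * real n powr (s - 1)"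
    by (intro mult_right_mono) auto
  moreover have "x n * real n powr (s - 1) = negbin s n"
    using n by (simp add: x_def mult.assoc powr_add[symmetric])
  ultimately show "negbin s n \<le> real n powr (s - 1) / Gamma s" by simp
  have "1 / Gamma s \<le> y n"
  proof (rule LIMSEQ_le_const2[OF limy], intro exI[of _ n] allI impI)
    fix m assume "n \<le> m"
    then show "y m \<le> y n"
    proof (induction m rule: dec_induct)
      case (step k)
      then show ?case using dec[of k] by linarith
    qed simp
  qed
  then have "1 / Gamma s * (real n + 1) powr (s - 1) \<le> y n * (real n + 1) powr (s - 1)"
    by (intro mult_right_mono) auto
  also have "\<dots> = negbin s n" by (simp add: y_def mult.assoc powr_add[symmetric])
  finally show "(real n + 1) powr (s - 1) / Gamma s \<le> negbin s n" by simp
qed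

lemma negbin_asymptotic:
  assumes s: "0 < s" "s < 1" and n: "1 \<le> n"
  shows "\<bar>negbin s n - real n powr (s - 1) / Gamma s\<bar> \<le> 1 / Gamma s * real n powr (s - 2)"
proof -
  have G: "0 < Gamma s" using s by (intro Gamma_real_pos)
  obtain \<xi> where \<xi>: "real n < \<xi>" "(real n + 1) powr (s - 1) - real n powr (s - 1) = (s - 1) * \<xi> powr (s - 1 - 1)"
    using powr_mean_value[of "real n" "s - 1"] n by auto
  have "\<xi> powr (s - 2) \<le> real n powr (s - 2)" using \<xi> s n by (intro powr_mono2') auto
  then have "(1 - s) * \<xi> powr (s - 2) \<le> 1 * real n powr (s - 2)"
    using s by (intro mult_mono) auto
  moreover have "real n powr (s - 1) - (real n + 1) powr (s - 1) = (1 - s) * \<xi> powr (s - 2)"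
    using \<xi> by (simp add: algebra_simps)
  ultimately have "(real n powr (s - 1) - (real n + 1) powr (s - 1)) / Gamma s \<le> real n powr (s - 2) / Gamma s"
    using G by (intro divide_right_mono) auto
  then show ?thesis using negbin_bounds[OF s n] by (simp add: diff_divide_distrib)
qed

lemma Gamma_reflection_real:
  assumes "0 < x" "x < 1"
  shows "Gamma x * Gamma (1 - x) = pi / sin (pi * x)"
proof -
  have 1: "1 - complex_of_real x = complex_of_real (1 - x)"
    and 2: "complex_of_real pi * complex_of_real x = complex_of_real (pi * x)" by simp_all
  have "complex_of_real (Gamma x * Gamma (1 - x)) = complex_of_real (pi / sin (pi * x))"
    using Gamma_reflection_complex[of "of_real x"]
    unfolding 1 2 Gamma_complex_of_real sin_of_real of_real_mult[symmetric] of_real_divide[symmetric] .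
  then show ?thesis by (simp only: of_real_eq_iff)
qed


section \<open>Renewal sequences with regularly varying tails\<close>

lemma holder_imp_symbol:
  fixes F :: "complex \<Rightarrow> 'x::real_normed_vector"
  assumes "\<And>z z'. norm z \<le> 1 \<Longrightarrow> norm z' \<le> 1 \<Longrightarrow> norm (F z - F z') \<le> C * norm (z - z') powr \<beta>"
    and "F 1 = 0"
  shows "symbol \<beta> \<beta> F"
proof (rule symbolI)
  fix z :: complex assume "norm z < 1"
  then show "norm (F z) \<le> C * norm (1 - z) powr \<beta>"
    using assms(1)[of z 1] assms(2) by (simp add: norm_minus_commute)
next
  fix z z' :: complex assume *: "norm z < 1" "norm z' < 1"
  then show "norm (F z - F z') \<le> C * norm (z - z') powr \<beta> * norm (1 - z) powr (\<beta> - \<beta>)"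
    using assms(1)[of z z'] disc_distance_pos[OF *(1)] by simp
qed

lemma holder_imp_continuous_on:
  fixes F :: "complex \<Rightarrow> 'x::real_normed_vector"
  assumes \<beta>: "0 < \<beta>"
    and F: "\<And>z z'. norm z \<le> 1 \<Longrightarrow> norm z' \<le> 1 \<Longrightarrow> norm (F z - F z') \<le> C * norm (z - z') powr \<beta>"
  shows "continuous_on (cball 0 1) F"
  unfolding continuous_on_def
proof
  fix w :: complex assume w: "w \<in> cball 0 1"
  have "((\<lambda>z. C * norm (z - w) powr \<beta>) \<longlongrightarrow> C * norm (w - w) powr \<beta>) (at w within cball 0 1)"
    using \<beta> by (intro tendsto_intros) auto
  then have "((\<lambda>z. C * norm (z - w) powr \<beta>) \<longlongrightarrow> 0) (at w within cball 0 1)" by simp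
  then have "((\<lambda>z. F z - F w) \<longlongrightarrow> 0) (at w within cball 0 1)"
  proof (rule Lim_null_comparison[rotated])
    show "eventually (\<lambda>z. norm (F z - F w) \<le> C * norm (z - w) powr \<beta>) (at w within cball 0 1)"
      unfolding eventually_at_filter using F w by (intro always_eventually) auto
  qed
  then show "(F \<longlongrightarrow> F w) (at w within cball 0 1)" by (rule Lim_null[THEN iffD2])
qed

lemma norm_power_diff_le:
  fixes z w :: complex
  assumes "norm z \<le> 1" "norm w \<le> 1"
  shows "norm (z ^ n - w ^ n) \<le> min 2 (real n * norm (z - w))"
proof -
  have "norm (z ^ n - w ^ n) \<le> real n * norm (z - w)"
    using assms by (rule norm_power_diff)
  moreover have "norm (z ^ n - w ^ n) \<le> norm z ^ n + norm w ^ n"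
    by (metis norm_power norm_triangle_ineq4)
  moreover have "norm z ^ n \<le> 1" "norm w ^ n \<le> 1" using assms by (auto intro: power_le_one)
  ultimately show ?thesis by simp
qed

lemma power_series_unique:
  assumes "\<And>z::complex. norm z < 1 \<Longrightarrow> (\<lambda>k. f k * z ^ k) sums F z"
    and "\<And>z::complex. norm z < 1 \<Longrightarrow> (\<lambda>k. g k * z ^ k) sums F z"
  shows "f n = g n"
proof -
  have "of_real (2 * pi * (1 / 2) ^ n) * f n = of_real (2 * pi * (1 / 2) ^ n) * g n"
    using fourier_coefficient[where r = "1 / 2" and n = n and F = F] assms
    by (intro has_integral_unique) auto
  then show ?thesis by simp
qed

lemma summable_norm_in_disc:
  assumes "\<And>z::complex. norm z < 1 \<Longrightarrow> (\<lambda>k. f k * z ^ k) sums F z" "norm z < 1"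
  shows "summable (\<lambda>k. norm (f k * z ^ k))"
proof -
  obtain \<rho> where \<rho>: "norm z < \<rho>" "\<rho> < 1" using assms(2) dense by blast
  then have "0 < \<rho>" by (smt (verit) norm_ge_zero)
  then have "norm (of_real \<rho> :: complex) < 1" "norm z < norm (of_real \<rho> :: complex)" using \<rho> by auto
  moreover from this have "summable (\<lambda>k. f k * of_real \<rho> ^ k)" using assms(1) sums_summable by blast
  ultimately show ?thesis using powser_insidea by blast
qed

lemma power_series_mult:
  assumes "\<And>z::complex. norm z < 1 \<Longrightarrow> (\<lambda>k. f k * z ^ k) sums F z"
    and "\<And>z::complex. norm z < 1 \<Longrightarrow> (\<lambda>k. g k * z ^ k) sums G z" and z: "norm z < 1"
  shows "(\<lambda>n. (\<Sum>i\<le>n. f i * g (n - i)) * z ^ n) sums (F z * G z)"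
proof -
  have "(\<lambda>n. \<Sum>i\<le>n. (f i * z ^ i) * (g (n - i) * z ^ (n - i))) sums
      ((\<Sum>k. f k * z ^ k) * (\<Sum>k. g k * z ^ k))"
    using assms summable_norm_in_disc[of f F] summable_norm_in_disc[of g G]
    by (intro Cauchy_product_sums) auto
  also have "(\<Sum>k. f k * z ^ k) = F z" using assms by (simp add: sums_iff)
  also have "(\<Sum>k. g k * z ^ k) = G z" using assms by (simp add: sums_iff)
  also have "(\<lambda>n. \<Sum>i\<le>n. (f i * z ^ i) * (g (n - i) * z ^ (n - i)))
      = (\<lambda>n. (\<Sum>i\<le>n. f i * g (n - i)) * z ^ n)"
  proof
    fix n
    have "(f i * z ^ i) * (g (n - i) * z ^ (n - i)) = f i * g (n - i) * z ^ n" if "i \<le> n" for i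
    proof -
      have "z ^ n = z ^ i * z ^ (n - i)" using that by (simp flip: power_add)
      then show ?thesis by simp
    qed
    then show "(\<Sum>i\<le>n. (f i * z ^ i) * (g (n - i) * z ^ (n - i))) = (\<Sum>i\<le>n. f i * g (n - i)) * z ^ n"
      unfolding sum_distrib_right by (intro sum.cong) auto
  qed
  finally show ?thesis .
qed

fun renewal_sequence :: "(nat \<Rightarrow> real) \<Rightarrow> nat \<Rightarrow> real" where
  "renewal_sequence p n = (if n = 0 then 1 else \<Sum>k<n. p (n - k) * renewal_sequence p k)"

declare renewal_sequence.simps [simp del]

text \<open>A probability distribution \<open>p\<close> on the positive integers with regularly varying tails \<open>q\<close>.
  In the application \<open>p n\<close> is the probability of a first return at time \<open>n\<close>.\<close>

locale regular_tail =
  fixes p q :: "nat \<Rightarrow> real" and \<beta> c K :: real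
  assumes beta: "1 / 2 < \<beta>" "\<beta> < 1" and c_pos: "0 < c"
    and p_nonneg: "0 \<le> p n" and p_0: "p 0 = 0"
    and q_eq: "q n = 1 - (\<Sum>k\<le>n. p k)"
    and tail: "1 \<le> n \<Longrightarrow> \<bar>q n - c * real n powr - \<beta>\<bar> \<le> K * real n powr (- 2 * \<beta>)"
begin

lemma K_nonneg: "0 \<le> K"
  using tail[of 1] by simp

lemma q_tendsto: "q \<longlonglongrightarrow> 0"
proof -
  have "(\<lambda>n. K * real n powr (- 2 * \<beta>)) \<longlonglongrightarrow> K * 0" "(\<lambda>n. c * real n powr - \<beta>) \<longlonglongrightarrow> c * 0"
    using beta by (intro tendsto_mult tendsto_const tendsto_neg_powr filterlim_real_sequentially; simp)+
  then have lim: "(\<lambda>n. K * real n powr (- 2 * \<beta>)) \<longlonglongrightarrow> 0" "(\<lambda>n. c * real n powr - \<beta>) \<longlonglongrightarrow> 0" by auto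
  have "(\<lambda>n. q n - c * real n powr - \<beta>) \<longlonglongrightarrow> 0"
    using lim(1) by (rule Lim_null_comparison[rotated])
      (use tail in \<open>auto simp: eventually_sequentially intro!: exI[of _ 1]\<close>)
  from tendsto_add[OF this lim(2)] show ?thesis by simp
qed

lemma q_antimono: "m \<le> n \<Longrightarrow> q n \<le> q m"
  unfolding q_eq using p_nonneg by (simp add: sum_mono2)

lemma q_nonneg: "0 \<le> q n"
  by (rule LIMSEQ_le_const2[OF q_tendsto]) (use q_antimono in blast)

lemma q_0: "q 0 = 1" by (simp add: q_eq p_0)

lemma p_Suc: "p (Suc n) = q n - q (Suc n)" by (simp add: q_eq)

lemma p_sums: "p sums 1"
proof -
  have "(\<lambda>n. 1 - q n) \<longlonglongrightarrow> 1 - 0" by (intro tendsto_intros q_tendsto)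
  then have "(\<lambda>n. \<Sum>k\<le>n. p k) \<longlonglongrightarrow> 1" by (simp add: q_eq)
  then show ?thesis unfolding sums_def_le .
qed

lemma p_summable: "summable p" using p_sums sums_summable by blast

lemma q_upper: "1 \<le> n \<Longrightarrow> q n \<le> (c + K) * real n powr - \<beta>"
proof -
  assume n: "1 \<le> n"
  have "real n powr (- 2 * \<beta>) \<le> real n powr - \<beta>" using n beta by (intro powr_mono) auto
  then have "K * real n powr (- 2 * \<beta>) \<le> K * real n powr - \<beta>" using K_nonneg by (intro mult_left_mono)
  then show ?thesis using tail[OF n] by (simp add: algebra_simps)
qed

text \<open>Summation by parts: the mass below \<open>N\<close> contributes the partial sums of the tails,
  of order \<open>N powr (1 - \<beta>)\<close>, and the mass above \<open>N\<close> contributes \<open>q N\<close>; the cut is at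
  \<open>N = 1 / \<delta>\<close>.\<close>

lemma truncated_mean_bound:
  "\<exists>C\<ge>0. \<forall>\<delta>. 0 \<le> \<delta> \<longrightarrow> \<delta> \<le> 2 \<longrightarrow>
     summable (\<lambda>n. p n * min 2 (real n * \<delta>)) \<and> (\<Sum>n. p n * min 2 (real n * \<delta>)) \<le> C * \<delta> powr \<beta>"
proof -
  define C where "C = 3 * (1 + (c + K) / (1 - \<beta>)) + 2 * (c + K)"
  have C: "0 \<le> C" using beta c_pos K_nonneg by (auto simp: C_def intro!: add_nonneg_nonneg divide_nonneg_pos)
  have summ: "summable (\<lambda>n. p n * min 2 (real n * \<delta>))" if "0 \<le> \<delta>" for \<delta>
  proof (rule summable_comparison_test'[where N = 0])
    show "summable (\<lambda>n. 2 * p n)" using p_summable by (rule summable_mult)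
    show "norm (p n * min 2 (real n * \<delta>)) \<le> 2 * p n" for n
      using p_nonneg[of n] that mult_left_mono[of "min 2 (real n * \<delta>)" 2 "p n"] by (simp add: abs_mult)
  qed
  have "(\<Sum>n. p n * min 2 (real n * \<delta>)) \<le> C * \<delta> powr \<beta>" if \<delta>: "0 < \<delta>" "\<delta> \<le> 2" for \<delta>
  proof (rule suminf_le_const[OF summ])
    fix m :: nat
    define N where "N = nat \<lceil>1 / \<delta>\<rceil>"
    have "1 / \<delta> \<le> real N" unfolding N_def using \<delta> by linarith
    moreover have "real N \<le> 1 / \<delta> + 1" unfolding N_def using \<delta> by (simp add: nat_ceiling_le_eq)
    moreover have "1 \<le> 2 / \<delta>" using \<delta> by simp
    ultimately have N: "1 / \<delta> \<le> real N" "real N \<le> 3 / \<delta>" by (auto simp: field_simps)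
    then have N1: "1 \<le> N" using \<delta> by (cases "N = 0") (auto simp: field_simps)
    have abel: "(\<Sum>n\<le>N. real n * p n) = (\<Sum>n<N. q n) - real N * q N" for N
      by (induction N) (simp_all add: p_0 p_Suc algebra_simps)
    have "(\<Sum>n<m. p n * min 2 (real n * \<delta>))
        \<le> (\<Sum>n<m. (if n \<le> N then \<delta> * (real n * p n) else 0) + (if N < n then 2 * p n else 0))"
    proof (rule sum_mono)
      fix n
      have "p n * min 2 (real n * \<delta>) \<le> p n * (real n * \<delta>)" "p n * min 2 (real n * \<delta>) \<le> p n * 2"
        using p_nonneg[of n] by (auto intro!: mult_left_mono)
      then show "p n * min 2 (real n * \<delta>)
         \<le> (if n \<le> N then \<delta> * (real n * p n) else 0) + (if N < n then 2 * p n else 0)"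
        by (auto simp: mult_ac)
    qed
    also have "\<dots> = (\<Sum>n<m. if n \<le> N then \<delta> * (real n * p n) else 0) + (\<Sum>n<m. if N < n then 2 * p n else 0)"
      by (rule sum.distrib)
    finally have split: "(\<Sum>n<m. p n * min 2 (real n * \<delta>))
      \<le> (\<Sum>n<m. if n \<le> N then \<delta> * (real n * p n) else 0) + (\<Sum>n<m. if N < n then 2 * p n else 0)" .
    have low: "(\<Sum>n<m. if n \<le> N then \<delta> * (real n * p n) else 0) \<le> \<delta> * (\<Sum>n\<le>N. real n * p n)"
    proof -
      have "(\<Sum>n<m. if n \<le> N then \<delta> * (real n * p n) else 0) = (\<Sum>n\<in>{..<m} \<inter> {..N}. \<delta> * (real n * p n))"
        by (subst sum.inter_restrict) (auto intro!: sum.cong)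
      also have "\<dots> \<le> (\<Sum>n\<le>N. \<delta> * (real n * p n))"
        using \<delta> p_nonneg by (intro sum_mono2) auto
      finally show ?thesis by (simp add: sum_distrib_left)
    qed
    have parts: "(\<Sum>n\<le>N. real n * p n) \<le> (\<Sum>n<N. q n)"
      using abel[of N] q_nonneg[of N] by simp
    have high: "(\<Sum>n<m. if N < n then 2 * p n else 0) \<le> 2 * q N"
    proof -
      have "(\<Sum>n<m. if N < n then 2 * p n else 0) = (\<Sum>n\<in>{..<m} \<inter> {N<..}. 2 * p n)"
        by (subst sum.inter_restrict) (auto intro!: sum.cong)
      also have "\<dots> \<le> (\<Sum>n\<in>{N<..N+m}. 2 * p n)"
        using p_nonneg by (intro sum_mono2) auto
      also have "\<dots> = 2 * (q N - q (N + m))"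
      proof (induction m)
        case (Suc m)
        have "{N<..N + Suc m} = insert (Suc (N + m)) {N<..N+m}" by auto
        then show ?case using Suc by (simp add: p_Suc algebra_simps)
      qed simp
      finally show ?thesis using q_nonneg[of "N + m"] by simp
    qed
    have qN: "q N \<le> (c + K) * real N powr - \<beta>" using N1 by (rule q_upper)
    have sum_q: "(\<Sum>n<N. q n) \<le> (1 + (c + K) / (1 - \<beta>)) * real N powr (1 - \<beta>)"
    proof -
      have "{..<N} = insert 0 {1..<N}" using N1 by auto
      then have "(\<Sum>n<N. q n) = 1 + (\<Sum>n=1..<N. q n)" by (simp add: q_0)
      also have "(\<Sum>n=1..<N. q n) \<le> (\<Sum>n=1..<N. (c + K) * real n powr - \<beta>)"
        by (intro sum_mono q_upper) auto
      also have "\<dots> \<le> (\<Sum>n=1..N. (c + K) * real n powr - \<beta>)"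
        using c_pos K_nonneg by (intro sum_mono2) auto
      also have "\<dots> \<le> (c + K) * (real N powr (1 - \<beta>) / (1 - \<beta>))"
        unfolding sum_distrib_left[symmetric] using c_pos K_nonneg beta
        by (intro mult_left_mono sum_powr_le) auto
      finally have "(\<Sum>n<N. q n) \<le> 1 + (c + K) * (real N powr (1 - \<beta>) / (1 - \<beta>))" by simp
      moreover have "1 \<le> real N powr (1 - \<beta>)" using N1 beta by (simp add: ge_one_powr_ge_zero)
      moreover have "(1 + (c + K) / (1 - \<beta>)) * real N powr (1 - \<beta>)
          = real N powr (1 - \<beta>) + (c + K) * (real N powr (1 - \<beta>) / (1 - \<beta>))"
        by (simp add: distrib_right)
      ultimately show ?thesis by linarith
    qed
    have low': "\<delta> * ((1 + (c + K) / (1 - \<beta>)) * real N powr (1 - \<beta>)) \<le> 3 * (1 + (c + K) / (1 - \<beta>)) * \<delta> powr \<beta>"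
    proof -
      have "real N powr (1 - \<beta>) \<le> (3 / \<delta>) powr (1 - \<beta>)" using N beta by (intro powr_mono2) auto
      also have "\<dots> = 3 powr (1 - \<beta>) / \<delta> powr (1 - \<beta>)" using \<delta> by (simp add: powr_divide)
      also have "\<dots> \<le> 3 powr 1 / \<delta> powr (1 - \<beta>)" using beta by (intro divide_right_mono powr_mono) auto
      finally have "\<delta> * real N powr (1 - \<beta>) \<le> \<delta> * (3 / \<delta> powr (1 - \<beta>))" using \<delta> by (intro mult_left_mono) auto
      also have "\<dots> = 3 * \<delta> powr \<beta>" using \<delta> by (simp add: powr_diff)
      finally have "(1 + (c + K) / (1 - \<beta>)) * (\<delta> * real N powr (1 - \<beta>)) \<le> (1 + (c + K) / (1 - \<beta>)) * (3 * \<delta> powr \<beta>)"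
        using beta c_pos K_nonneg by (intro mult_left_mono) (auto intro!: add_nonneg_nonneg divide_nonneg_pos)
      then show ?thesis by (simp only: mult_ac)
    qed
    have "real N powr - \<beta> \<le> \<delta> powr \<beta>"
    proof -
      have "real N powr - \<beta> \<le> (1 / \<delta>) powr - \<beta>" using N \<delta> beta by (intro powr_mono2') auto
      then show ?thesis using \<delta> by (simp add: powr_divide powr_minus_divide)
    qed
    then have "(c + K) * real N powr - \<beta> \<le> (c + K) * \<delta> powr \<beta>"
      using c_pos K_nonneg by (intro mult_left_mono) auto
    moreover have "\<delta> * (\<Sum>n\<le>N. real n * p n) \<le> \<delta> * ((1 + (c + K) / (1 - \<beta>)) * real N powr (1 - \<beta>))"
      using parts sum_q \<delta> by (intro mult_left_mono) auto
    moreover have "C * \<delta> powr \<beta> = 3 * (1 + (c + K) / (1 - \<beta>)) * \<delta> powr \<beta> + 2 * ((c + K) * \<delta> powr \<beta>)"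
      by (simp add: C_def distrib_right)
    ultimately show "(\<Sum>n<m. p n * min 2 (real n * \<delta>)) \<le> C * \<delta> powr \<beta>"
      using split low high qN low' by linarith
  qed (use that in auto)
  then have "(\<Sum>n. p n * min 2 (real n * \<delta>)) \<le> C * \<delta> powr \<beta>" if "0 \<le> \<delta>" "\<delta> \<le> 2" for \<delta>
    using that by (cases "\<delta> = 0") auto
  then show ?thesis using summ C by (intro exI[of _ C] conjI allI impI) simp_all
qed

text \<open>A series \<open>\<Sum> z ^ n A\<^sub>n\<close> whose coefficients are dominated by \<open>p n\<close> has the exponent \<open>\<beta>\<close>
  of the tails as a Hoelder exponent, because \<open>\<bar>z ^ n - z' ^ n\<bar>\<close> is at most \<open>min 2 (n \<bar>z - z'\<bar>)\<close>. This serves for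
  \<open>p\<close> itself and for the return operators.\<close>

lemma series_holder:
  fixes f :: "nat \<Rightarrow> complex \<Rightarrow> 'x::banach"
  assumes summ: "\<And>z. norm z \<le> 1 \<Longrightarrow> summable (\<lambda>n. f n z)"
    and diff: "\<And>n z z'. norm z \<le> 1 \<Longrightarrow> norm z' \<le> 1 \<Longrightarrow> norm (f n z - f n z') \<le> L * p n * norm (z ^ n - z' ^ n)"
    and L: "0 \<le> L"
  shows "\<exists>C\<ge>0. \<forall>z z'. norm z \<le> 1 \<longrightarrow> norm z' \<le> 1 \<longrightarrow>
     norm ((\<Sum>n. f n z) - (\<Sum>n. f n z')) \<le> C * norm (z - z') powr \<beta>"
proof -
  from truncated_mean_bound obtain C where C0: "C \<ge> 0"
    and C1: "\<forall>\<delta>. 0 \<le> \<delta> \<longrightarrow> \<delta> \<le> 2 \<longrightarrow>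
     summable (\<lambda>n. p n * min 2 (real n * \<delta>)) \<and> (\<Sum>n. p n * min 2 (real n * \<delta>)) \<le> C * \<delta> powr \<beta>"
    by (elim exE conjE)
  have C: "C \<ge> 0" "\<And>\<delta>. 0 \<le> \<delta> \<Longrightarrow> \<delta> \<le> 2 \<Longrightarrow> summable (\<lambda>n. p n * min 2 (real n * \<delta>))"
    "\<And>\<delta>. 0 \<le> \<delta> \<Longrightarrow> \<delta> \<le> 2 \<Longrightarrow> (\<Sum>n. p n * min 2 (real n * \<delta>)) \<le> C * \<delta> powr \<beta>"
    using C0 C1 by simp_all
  show ?thesis
  proof (intro exI[of _ "L * C"] conjI allI impI)
    fix z z' :: complex assume z: "norm z \<le> 1" "norm z' \<le> 1"
    let ?\<delta> = "norm (z - z')"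
    have \<delta>: "0 \<le> ?\<delta>" "?\<delta> \<le> 2" using norm_triangle_ineq4[of z z'] z by auto
    have le: "norm (f n z - f n z') \<le> L * (p n * min 2 (real n * ?\<delta>))" for n
    proof -
      have "norm (f n z - f n z') \<le> (L * p n) * norm (z ^ n - z' ^ n)" using diff z by simp
      also have "\<dots> \<le> (L * p n) * min 2 (real n * ?\<delta>)"
        using L p_nonneg[of n] norm_power_diff_le[OF z] by (intro mult_left_mono) auto
      finally show ?thesis by simp
    qed
    have summ': "summable (\<lambda>n. L * (p n * min 2 (real n * ?\<delta>)))" using C(2)[OF \<delta>] by (rule summable_mult)
    have "norm ((\<Sum>n. f n z) - (\<Sum>n. f n z')) = norm (\<Sum>n. f n z - f n z')"
      using summ z by (simp add: suminf_diff)
    also have "\<dots> \<le> (\<Sum>n. L * (p n * min 2 (real n * ?\<delta>)))"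
      using le summ' by (intro norm_suminf_le) auto
    also have "\<dots> = L * (\<Sum>n. p n * min 2 (real n * ?\<delta>))" by (rule suminf_mult[OF C(2)[OF \<delta>]])
    also have "\<dots> \<le> L * (C * ?\<delta> powr \<beta>)" using C(3)[OF \<delta>] L by (rule mult_left_mono)
    finally show "norm ((\<Sum>n. f n z) - (\<Sum>n. f n z')) \<le> L * C * ?\<delta> powr \<beta>" by simp
  qed (use L C in auto)
qed

definition pgf :: "complex \<Rightarrow> complex" where
  "pgf z = (\<Sum>n. of_real (p n) * z ^ n)"

lemma pgf_summable: "norm (z::complex) \<le> 1 \<Longrightarrow> summable (\<lambda>n. of_real (p n) * z ^ n)"
  by (rule summable_comparison_test'[OF p_summable, where N = 0])
    (auto simp: norm_mult norm_power p_nonneg intro!: mult_left_le power_le_one)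

lemma pgf_sums: "norm z \<le> 1 \<Longrightarrow> (\<lambda>n. of_real (p n) * z ^ n) sums pgf z"
  unfolding pgf_def by (rule summable_sums[OF pgf_summable])

lemma pgf_1: "pgf 1 = 1"
  using sums_of_real[OF p_sums, where 'a = complex] unfolding pgf_def by (simp add: sums_iff)

lemma pgf_holder: "\<exists>C\<ge>0. \<forall>z z'. norm z \<le> 1 \<longrightarrow> norm z' \<le> 1 \<longrightarrow> norm (pgf z - pgf z') \<le> C * norm (z - z') powr \<beta>"
  unfolding pgf_def
proof (rule series_holder[where L = 1])
  show "norm (of_real (p n) * z ^ n - of_real (p n) * z' ^ n) \<le> 1 * p n * norm (z ^ n - z' ^ n)" for n and z z' :: complex
    unfolding right_diff_distrib[symmetric] norm_mult using p_nonneg[of n] by simp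
qed (simp_all add: pgf_summable)

lemma pgf_symbol: "symbol \<beta> \<beta> (\<lambda>z. 1 - pgf z)"
proof -
  obtain C where C: "\<And>z z'. norm z \<le> 1 \<Longrightarrow> norm z' \<le> 1 \<Longrightarrow> norm (pgf z - pgf z') \<le> C * norm (z - z') powr \<beta>"
    using pgf_holder by blast
  show ?thesis
    by (rule holder_imp_symbol[where C = C]) (use C pgf_1 in \<open>auto simp: norm_minus_commute\<close>)
qed

text \<open>The rate of the error terms of the renewal sequences; it exceeds the rate \<open>\<gamma>\<close> of the arcsine
  law by \<open>1 - \<beta>\<close>. The correction to \<open>(1 - z) powr (- \<beta>)\<close> in \<open>1 / (1 - p)\<close> has the size
  \<open>\<bar>1 - z\<bar> powr (1 - 2 * \<beta>)\<close>, which suggests coefficients of order \<open>n powr - (2 - 2 * \<beta>)\<close>. The bound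
  \<open>1 / 2\<close> keeps the rate below the Hoelder exponent \<open>\<beta>\<close>.\<close>

abbreviation \<kappa> :: real where "\<kappa> \<equiv> min (2 - 2 * \<beta>) (1 / 2)"

text \<open>The tails \<open>q\<close> are compared with the coefficients of \<open>scale * (1 - z) powr (\<beta> - 1)\<close>, which are
  asymptotic to \<open>c * n powr - \<beta>\<close>; the difference is summable because \<open>2 \<beta> > 1\<close>.\<close>

definition scale :: real where "scale = c * Gamma (1 - \<beta>)"

definition tail_error :: "nat \<Rightarrow> real" where "tail_error n = q n - scale * negbin (1 - \<beta>) n"

lemma scale_pos: "0 < scale"
  unfolding scale_def using c_pos beta by (intro mult_pos_pos Gamma_real_pos) auto

lemma tail_error_bound: "\<exists>C\<ge>0. \<forall>n\<ge>1. \<bar>tail_error n\<bar> \<le> C * real n powr - (2 * \<beta>)"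
proof (intro exI[of _ "K + c"] conjI allI impI)
  fix n :: nat assume n: "1 \<le> n"
  have G: "0 < Gamma (1 - \<beta>)" using beta by (intro Gamma_real_pos) auto
  have exponents: "1 - \<beta> - 1 = - \<beta>" "1 - \<beta> - 2 = - \<beta> - 1" by simp_all
  have "\<bar>negbin (1 - \<beta>) n - real n powr - \<beta> / Gamma (1 - \<beta>)\<bar> \<le> 1 / Gamma (1 - \<beta>) * real n powr (- \<beta> - 1)"
    using negbin_asymptotic[of "1 - \<beta>" n] beta n
    unfolding exponents by simp
  then have "scale * \<bar>negbin (1 - \<beta>) n - real n powr - \<beta> / Gamma (1 - \<beta>)\<bar>
      \<le> scale * (1 / Gamma (1 - \<beta>) * real n powr (- \<beta> - 1))"
    using scale_pos by (intro mult_left_mono) auto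
  moreover have "scale * \<bar>negbin (1 - \<beta>) n - real n powr - \<beta> / Gamma (1 - \<beta>)\<bar>
      = \<bar>scale * negbin (1 - \<beta>) n - c * real n powr - \<beta>\<bar>"
    using scale_pos G by (subst abs_of_pos[OF scale_pos, symmetric], subst abs_mult[symmetric])
      (simp add: scale_def right_diff_distrib)
  moreover have "scale * (1 / Gamma (1 - \<beta>) * real n powr (- \<beta> - 1)) = c * real n powr (- \<beta> - 1)"
    using G by (simp add: scale_def)
  moreover have "real n powr (- \<beta> - 1) \<le> real n powr - (2 * \<beta>)" using n beta by (intro powr_mono) auto
  then have "c * real n powr (- \<beta> - 1) \<le> c * real n powr - (2 * \<beta>)" using c_pos by simp
  moreover have "\<bar>q n - c * real n powr - \<beta>\<bar> \<le> K * real n powr - (2 * \<beta>)" using tail[OF n] by simp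
  ultimately show "\<bar>tail_error n\<bar> \<le> (K + c) * real n powr - (2 * \<beta>)"
    unfolding tail_error_def by (simp add: distrib_right abs_if split: if_splits)
qed (use K_nonneg c_pos in auto)

lemma tail_error_summable: "summable (\<lambda>n. \<bar>tail_error n\<bar>)"
proof -
  obtain C where C: "C \<ge> 0" "\<And>n. 1 \<le> n \<Longrightarrow> \<bar>tail_error n\<bar> \<le> C * real n powr - (2 * \<beta>)"
    using tail_error_bound by blast
  show ?thesis
  proof (rule summable_comparison_test'[where N = 1])
    have "summable (\<lambda>n. real n powr - (2 * \<beta>))" using beta by (subst summable_real_powr_iff) auto
    then show "summable (\<lambda>n. C * real n powr - (2 * \<beta>))" by (rule summable_mult)
  qed (use C in auto)
qed

definition tail_error_gf :: "complex \<Rightarrow> complex" where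
  "tail_error_gf z = (\<Sum>n. of_real (tail_error n) * z ^ n)"

lemma tail_error_gf_summable: "norm z \<le> 1 \<Longrightarrow> summable (\<lambda>n. of_real (tail_error n) * z ^ n :: complex)"
  by (rule summable_comparison_test'[OF tail_error_summable, where N = 0])
    (auto simp: norm_mult norm_power intro!: mult_left_le power_le_one)

lemma tail_error_gf_bound: "norm z \<le> 1 \<Longrightarrow> norm (tail_error_gf z) \<le> (\<Sum>n. \<bar>tail_error n\<bar>)"
  unfolding tail_error_gf_def
  by (intro norm_suminf_le tail_error_summable)
    (auto simp: norm_mult norm_power intro!: mult_left_le power_le_one)

text \<open>\<open>1 - p = (1 - z) Q\<close>, where \<open>Q\<close> is the generating function of the tails.\<close>

lemma one_minus_pgf_eq:
  assumes z: "norm z < 1"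
  shows "1 - pgf z = of_real scale * (1 - z) powr of_real \<beta> + (1 - z) * tail_error_gf z"
proof -
  define Q where "Q = of_real scale * (1 - z) powr of_real (\<beta> - 1) + tail_error_gf z"
  have Q: "(\<lambda>n. of_real (q n) * z ^ n) sums Q"
  proof -
    have "(\<lambda>n. of_real scale * (of_real (negbin (1 - \<beta>) n) * z ^ n) + of_real (tail_error n) * z ^ n) sums Q"
      unfolding Q_def tail_error_gf_def using negbin_sums[OF z, of "1 - \<beta>"] z
      by (intro sums_add sums_mult summable_sums tail_error_gf_summable) auto
    moreover have "of_real scale * (of_real (negbin (1 - \<beta>) n) * z ^ n) + of_real (tail_error n) * z ^ n
        = of_real (q n) * z ^ n" for n
      by (simp add: tail_error_def algebra_simps)
    ultimately show ?thesis by simp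
  qed
  have "(\<lambda>n. z * (of_real (q n) * z ^ n)) sums (z * Q)" using Q by (rule sums_mult)
  then have "(\<lambda>n. (case n of 0 \<Rightarrow> 0 | Suc m \<Rightarrow> z * (of_real (q m) * z ^ m))) sums (z * Q)"
    using sums_Suc_iff[of "\<lambda>n. (case n of 0 \<Rightarrow> 0 | Suc m \<Rightarrow> z * (of_real (q m) * z ^ m))" "z * Q"] by simp
  from sums_diff[OF Q this]
  have "(\<lambda>n. of_real (q n) * z ^ n - (case n of 0 \<Rightarrow> 0 | Suc m \<Rightarrow> z * (of_real (q m) * z ^ m))) sums ((1 - z) * Q)"
    by (simp add: algebra_simps)
  moreover have "(\<lambda>n. (if n = 0 then 1 else 0) - of_real (p n) * z ^ n) sums (1 - pgf z)"
    using sums_single[of 0 "\<lambda>_. 1::complex"] z by (intro sums_diff pgf_sums) auto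
  moreover have "of_real (q n) * z ^ n - (case n of 0 \<Rightarrow> 0 | Suc m \<Rightarrow> z * (of_real (q m) * z ^ m))
      = (if n = 0 then 1 else 0) - of_real (p n) * z ^ n" for n
    by (cases n) (simp_all add: q_0 p_0 p_Suc algebra_simps)
  ultimately have "1 - pgf z = (1 - z) * Q" using sums_unique2 by simp
  also have "\<dots> = of_real scale * ((1 - z) powr 1 * (1 - z) powr of_real (\<beta> - 1)) + (1 - z) * tail_error_gf z"
    by (simp add: Q_def algebra_simps)
  also have "(1 - z) powr 1 * (1 - z) powr of_real (\<beta> - 1) = (1 - z) powr of_real \<beta>"
    by (subst powr_add[symmetric]) simp
  finally show ?thesis .
qed

end


text \<open>Aperiodicity means that the \<open>n\<close> with \<open>p n > 0\<close> have no common divisor greater than \<open>1\<close>; it is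
  stated here in terms of the generating function, the form in which it excludes further
  singularities of \<open>1 / (1 - p)\<close> on the unit circle.\<close>

locale aperiodic_regular_tail = regular_tail +
  assumes pgf_neq_1: "norm z \<le> 1 \<Longrightarrow> z \<noteq> 1 \<Longrightarrow> pgf z \<noteq> 1"
begin

text \<open>Near \<open>1\<close> the term \<open>scale * (1 - z) powr \<beta>\<close> dominates the remainder of order \<open>1 - z\<close>; on the rest
  of the disc compactness and aperiodicity give a bound.\<close>

lemma one_minus_pgf_lower: "\<exists>c0>0. \<forall>z. norm z < 1 \<longrightarrow> c0 * norm (1 - z) powr \<beta> \<le> norm (1 - pgf z)"
proof -
  define E where "E = (\<Sum>n. \<bar>tail_error n\<bar>) + 1"
  have E: "0 < E" unfolding E_def using suminf_nonneg[OF tail_error_summable] by (simp add: add_nonneg_pos)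
  define \<delta> where "\<delta> = (scale / (2 * E)) powr (1 / (1 - \<beta>))"
  have \<delta>: "0 < \<delta>" unfolding \<delta>_def using scale_pos E by simp
  have near: "scale / 2 * norm (1 - z) powr \<beta> \<le> norm (1 - pgf z)"
    if z: "norm z < 1" and d: "norm (1 - z) \<le> \<delta>" for z
  proof -
    let ?d = "norm (1 - z)"
    have pos: "0 < ?d" using disc_distance_pos[OF z] .
    have "?d powr (1 - \<beta>) \<le> \<delta> powr (1 - \<beta>)" using d beta by (intro powr_mono2) auto
    also have "\<dots> = scale / (2 * E)" unfolding \<delta>_def powr_powr using beta scale_pos E by simp
    finally have "?d powr (1 - \<beta>) * E \<le> scale / (2 * E) * E" using E by (intro mult_right_mono) auto
    then have small: "?d powr (1 - \<beta>) * E \<le> scale / 2" using E by simp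
    have "norm ((1 - z) * tail_error_gf z) \<le> ?d * E"
      using tail_error_gf_bound[of z] z by (auto simp: norm_mult E_def intro!: mult_left_mono)
    also have "?d = ?d powr \<beta> * ?d powr (1 - \<beta>)" using pos by (simp add: powr_add[symmetric])
    also have "\<dots> * E = ?d powr \<beta> * (?d powr (1 - \<beta>) * E)" by simp
    also have "\<dots> \<le> ?d powr \<beta> * (scale / 2)" using small by (intro mult_left_mono) auto
    finally have 1: "norm ((1 - z) * tail_error_gf z) \<le> ?d powr \<beta> * (scale / 2)" .
    have "norm (of_real scale * (1 - z) powr of_real \<beta>) = scale * ?d powr \<beta>"
      using scale_pos by (simp add: norm_mult norm_powr_one_minus)
    then show ?thesis
      using 1 one_minus_pgf_eq[OF z] norm_triangle_ineq2[of "of_real scale * (1 - z) powr of_real \<beta>" "- ((1 - z) * tail_error_gf z)"]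
      by (simp add: mult.commute)
  qed
  define A where "A = cball 0 1 - ball (1::complex) \<delta>"
  have "compact A" unfolding A_def by (intro compact_diff) auto
  have cont: "continuous_on (cball 0 1) pgf"
  proof -
    obtain C where C: "\<And>z z'. norm z \<le> 1 \<Longrightarrow> norm z' \<le> 1 \<Longrightarrow> norm (pgf z - pgf z') \<le> C * norm (z - z') powr \<beta>"
      using pgf_holder by blast
    then show ?thesis using beta by (intro holder_imp_continuous_on[of \<beta> pgf C]) auto
  qed
  have "\<exists>m>0. \<forall>z\<in>A. m \<le> norm (1 - pgf z)"
  proof (cases "A = {}")
    case False
    have "continuous_on A (\<lambda>z. norm (1 - pgf z))"
      by (intro continuous_intros continuous_on_subset[OF cont]) (auto simp: A_def)
    then obtain w where w: "w \<in> A" "\<And>z. z \<in> A \<Longrightarrow> norm (1 - pgf w) \<le> norm (1 - pgf z)"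
      using continuous_attains_inf[OF \<open>compact A\<close> False] by blast
    have "w \<noteq> 1" "norm w \<le> 1" using w(1) \<delta> by (auto simp: A_def)
    then have "0 < norm (1 - pgf w)" using pgf_neq_1 by fastforce
    then show ?thesis using w by blast
  qed (auto intro: exI[of _ 1])
  then obtain m where m: "0 < m" "\<And>z. z \<in> A \<Longrightarrow> m \<le> norm (1 - pgf z)" by blast
  show ?thesis
  proof (intro exI[of _ "min (scale / 2) (m / 2)"] conjI allI impI)
    fix z :: complex assume z: "norm z < 1"
    show "min (scale / 2) (m / 2) * norm (1 - z) powr \<beta> \<le> norm (1 - pgf z)"
    proof (cases "norm (1 - z) \<le> \<delta>")
      case True
      have "min (scale / 2) (m / 2) * norm (1 - z) powr \<beta> \<le> scale / 2 * norm (1 - z) powr \<beta>"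
        by (intro mult_right_mono) auto
      then show ?thesis using near[OF z True] by linarith
    next
      case False
      have "norm (1 - z) powr \<beta> \<le> 2 powr \<beta>" using disc_distance_le2[OF z] beta by (intro powr_mono2) auto
      also have "\<dots> \<le> 2 powr 1" using beta by (intro powr_mono) auto
      finally have "min (scale / 2) (m / 2) * norm (1 - z) powr \<beta> \<le> m / 2 * 2"
        using scale_pos m by (intro mult_mono) auto
      also have "\<dots> \<le> norm (1 - pgf z)" using m(2)[of z] z False by (auto simp: A_def dist_norm)
      finally show ?thesis .
    qed
  qed (use scale_pos m in auto)
qed

lemma renewal_symbol: "symbol \<beta> (- \<beta>) (\<lambda>z. 1 / (1 - pgf z))"
proof -
  obtain c0 where "0 < c0" "\<And>z. norm z < 1 \<Longrightarrow> c0 * norm (1 - z) powr \<beta> \<le> norm (1 - pgf z)"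
    using one_minus_pgf_lower by blast
  then show ?thesis by (intro symbol_inverse[OF pgf_symbol])
qed

abbreviation u :: "nat \<Rightarrow> real" where "u \<equiv> renewal_sequence p"

lemma u_0: "u 0 = 1" by (simp add: renewal_sequence.simps)

lemma u_rec: "0 < n \<Longrightarrow> u n = (\<Sum>k<n. p (n - k) * u k)" by (simp add: renewal_sequence.simps[of p n])

lemma u_bounds: "0 \<le> u n \<and> u n \<le> 1"
proof (induction n rule: less_induct)
  case (less n)
  show ?case
  proof (cases "n = 0")
    case False
    have "(\<Sum>k<n. p (n - k) * u k) \<le> (\<Sum>k<n. p (n - k))"
      using less p_nonneg by (intro sum_mono mult_left_le) auto
    also have "\<dots> = (\<Sum>k=1..n. p k)"
      by (rule sum.reindex_bij_witness[of _ "\<lambda>k. n - k" "\<lambda>k. n - k"]) (use False in auto)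
    also have "\<dots> \<le> (\<Sum>k\<le>n. p k)" using p_nonneg by (intro sum_mono2) auto
    also have "\<dots> \<le> 1" using q_nonneg[of n] by (simp add: q_eq)
    finally show ?thesis using less p_nonneg False by (auto simp: u_rec intro!: sum_nonneg)
  qed (simp add: u_0)
qed

lemma u_summable: "norm (z::complex) < 1 \<Longrightarrow> summable (\<lambda>n. of_real (u n) * z ^ n)"
proof (rule summable_comparison_test'[where N = 0])
  assume "norm z < 1"
  then show "summable (\<lambda>n. norm z ^ n)" by simp
  show "norm (of_real (u n) * z ^ n) \<le> norm z ^ n" for n
    using u_bounds[of n] by (simp add: norm_mult norm_power mult_left_le_one_le)
qed

lemma u_sums:
  assumes z: "norm (z::complex) < 1"
  shows "(\<lambda>n. of_real (u n) * z ^ n) sums (1 / (1 - pgf z))"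
proof -
  define U where "U z = (\<Sum>n. of_real (u n) * z ^ n)" for z :: complex
  have U: "(\<lambda>n. of_real (u n) * z ^ n) sums U z" if "norm z < 1" for z :: complex
    unfolding U_def using u_summable[OF that] by (rule summable_sums)
  have P: "(\<lambda>n. (of_real (if n = 0 then 1 else - p n)) * z ^ n) sums (1 - pgf z)" if "norm z < 1" for z :: complex
  proof -
    have "(\<lambda>n. (if n = 0 then 1 else 0) - of_real (p n) * z ^ n) sums (1 - pgf z)"
      using sums_single[of 0 "\<lambda>_. 1::complex"] that by (intro sums_diff pgf_sums) auto
    moreover have "(if n = 0 then 1 else 0) - of_real (p n) * z ^ n
        = (of_real (if n = 0 then 1 else - p n)) * z ^ n" for n
      using p_0 by simp
    ultimately show ?thesis by simp
  qed
  have "(\<lambda>n. (\<Sum>i\<le>n. of_real (if i = 0 then 1 else - p i) * of_real (u (n - i))) * z ^ n)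
      sums ((1 - pgf z) * U z)"
    by (rule power_series_mult[OF P U z])
  moreover have "(\<Sum>i\<le>n. of_real (if i = 0 then 1 else - p i) * of_real (u (n - i)))
      = (if n = 0 then 1 else 0 :: complex)" for n
  proof (cases "n = 0")
    case False
    have "(\<Sum>i\<le>n. (if i = 0 then 1 else - p i) * u (n - i)) = u n - (\<Sum>i=1..n. p i * u (n - i))"
    proof -
      have "{..n} = insert 0 {1..n}" by auto
      then show ?thesis by (simp add: sum_negf)
    qed
    also have "(\<Sum>i=1..n. p i * u (n - i)) = (\<Sum>k<n. p (n - k) * u k)"
      by (rule sum.reindex_bij_witness[of _ "\<lambda>k. n - k" "\<lambda>k. n - k"]) (use False in auto)
    finally have "(\<Sum>i\<le>n. (if i = 0 then 1 else - p i) * u (n - i)) = 0"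
      using False by (simp add: u_rec)
    then have "complex_of_real (\<Sum>i\<le>n. (if i = 0 then 1 else - p i) * u (n - i)) = 0" by simp
    then show ?thesis using False by (simp only: of_real_sum of_real_mult if_False)
  qed (simp add: u_0)
  ultimately have "(\<lambda>n. (if n = 0 then 1 else 0) * z ^ n) sums ((1 - pgf z) * U z)" by simp
  moreover have "(\<lambda>n. (if n = 0 then 1 else 0) * z ^ n) sums 1"
    using powser_sums_if[of 0 z] by simp
  ultimately have "(1 - pgf z) * U z = 1" using sums_unique2 by blast
  then have "U z = 1 / (1 - pgf z)"
    by (metis mult_eq_0_iff nonzero_mult_div_cancel_left zero_neq_one)
  then show ?thesis using U[OF z] by simp
qed

text \<open>The series \<open>V = (1 - z) powr (1 - \<beta>) / (1 - p)\<close> is less singular at \<open>1\<close> than \<open>1 / (1 - p)\<close>,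
  and its coefficients decay at the rate of the error. In
  \<open>scale / (1 - p) = (1 - z) powr (- \<beta>) - E V\<close>, where the coefficients \<open>tail_error\<close> of \<open>E\<close> are
  summable, convolution with them does not lose this rate.\<close>

theorem renewal_asymptotics:
  "\<exists>C\<ge>0. \<forall>n\<ge>1. \<bar>u n - sin (pi * \<beta>) / (pi * c) * real n powr (\<beta> - 1)\<bar> \<le> C * real n powr - \<kappa>"
proof -
  have \<kappa>: "0 < \<kappa>" "\<kappa> < \<beta>" "\<kappa> < 1" "\<kappa> \<le> 2 - 2 * \<beta>" using beta by auto
  define v where "v n = (\<Sum>i\<le>n. of_real (negbin (\<beta> - 1) i) * of_real (u (n - i)) :: complex)" for n
  define V where "V z = (1 - z) powr of_real (- (\<beta> - 1)) * (1 / (1 - pgf z))" for z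
  have V: "(\<lambda>n. v n * z ^ n) sums V z" if "norm z < 1" for z
    unfolding v_def V_def by (rule power_series_mult[OF negbin_sums u_sums that])
  have "symbol \<beta> (- (\<beta> - 1) + - \<beta>) V"
    unfolding V_def using beta by (intro symbol_mult symbol_powr renewal_symbol) auto
  then have "symbol \<beta> (\<kappa> - 1) V" by (rule symbol_weaken) (use \<kappa> in auto)
  then obtain CV where CV: "0 \<le> CV" "symbol_with CV \<beta> (\<kappa> - 1) V" unfolding symbol_def by blast
  obtain L where L: "0 \<le> L" "\<And>C F f n. (\<And>z. norm z < 1 \<Longrightarrow> (\<lambda>k. f k * z ^ k) sums F z) \<Longrightarrow>
      symbol_with C \<beta> (\<kappa> - 1) F \<Longrightarrow> 1 \<le> n \<Longrightarrow> norm (f n) \<le> L * C * real n powr - \<kappa>"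
    using power_series_coefficient_bound[OF \<kappa>(1,2)] by blast
  have v: "norm (v n) \<le> L * CV * real n powr - \<kappa>" if "1 \<le> n" for n
    using L(2)[OF V CV(2) that] .
  have identity: "of_real (scale * u n) = of_real (negbin \<beta> n) - (\<Sum>i\<le>n. of_real (tail_error i) * v (n - i))" for n
  proof (rule power_series_unique)
    fix z :: complex assume z: "norm z < 1"
    have "z \<noteq> 1" using z by auto
    then have "pgf z \<noteq> 1" using z by (intro pgf_neq_1) auto
    have "(\<lambda>n. of_real scale * (of_real (u n) * z ^ n)) sums (of_real scale * (1 / (1 - pgf z)))"
      using u_sums[OF z] by (rule sums_mult)
    then show "(\<lambda>k. of_real (scale * u k) * z ^ k) sums (of_real scale * (1 / (1 - pgf z)))"
      by (simp add: mult.assoc)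
    have "(\<lambda>n. (\<Sum>i\<le>n. of_real (tail_error i) * v (n - i)) * z ^ n) sums (tail_error_gf z * V z)"
    proof (rule power_series_mult[OF _ V z])
      show "(\<lambda>k. of_real (tail_error k) * z ^ k) sums tail_error_gf z" if "norm z < 1" for z
        unfolding tail_error_gf_def using that by (intro summable_sums tail_error_gf_summable) auto
    qed
    from sums_diff[OF negbin_sums[OF z, of \<beta>] this]
    have "(\<lambda>k. (of_real (negbin \<beta> k) - (\<Sum>i\<le>k. of_real (tail_error i) * v (k - i))) * z ^ k) sums
        ((1 - z) powr of_real (- \<beta>) - tail_error_gf z * V z)"
      by (simp add: left_diff_distrib)
    also have "(1 - z) powr of_real (- \<beta>) - tail_error_gf z * V z = of_real scale * (1 / (1 - pgf z))"
    proof -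
      have nz: "1 - z \<noteq> 0" using z by auto
      have 1: "(1 - z) powr of_real (- (\<beta> - 1)) = (1 - z) powr of_real (- \<beta>) * (1 - z)"
        using nz powr_add[of "1 - z" "of_real (- \<beta>)" 1] by (simp add: algebra_simps)
      have "(1 - z) powr of_real \<beta> * (1 - z) powr of_real (- \<beta>) = 1"
        using nz powr_add[of "1 - z" "of_real \<beta>" "of_real (- \<beta>)"] by simp
      then have "(1 - z) powr of_real (- \<beta>) * (1 - pgf z)
          = of_real scale + (1 - z) powr of_real (- \<beta>) * (1 - z) * tail_error_gf z"
        unfolding one_minus_pgf_eq[OF z] by (simp add: algebra_simps)
      then show ?thesis unfolding V_def 1 using \<open>pgf z \<noteq> 1\<close> by (simp add: field_simps)
    qed
    finally show "(\<lambda>k. (of_real (negbin \<beta> k) - (\<Sum>i\<le>k. of_real (tail_error i) * v (k - i))) * z ^ k) sums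
        (of_real scale * (1 / (1 - pgf z)))" .
  qed
  obtain Ce where Ce: "0 \<le> Ce" "\<And>n. 1 \<le> n \<Longrightarrow> \<bar>tail_error n\<bar> \<le> Ce * real n powr - (2 * \<beta>)"
    using tail_error_bound by blast
  obtain Cc where Cc: "0 \<le> Cc" "\<And>n. 1 \<le> n \<Longrightarrow>
      (\<Sum>j=1..<n. real j powr - (2 * \<beta>) * real (n - j) powr - \<kappa>) \<le> Cc * real n powr - \<kappa>"
    using power_convolution[of "2 * \<beta>" \<kappa> \<kappa>] beta \<kappa> by auto
  define C1 where "C1 = \<bar>tail_error 0\<bar> * (L * CV) + Ce * norm (v 0) + Ce * (L * CV) * Cc"
  have conv: "norm (\<Sum>i\<le>n. of_real (tail_error i) * v (n - i)) \<le> C1 * real n powr - \<kappa>" if n: "1 \<le> n" for n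
  proof -
    have "{..n} = insert 0 (insert n {1..<n})" using n by auto
    then have "(\<Sum>i\<le>n. of_real (tail_error i) * v (n - i)) = of_real (tail_error 0) * v n
        + (of_real (tail_error n) * v 0 + (\<Sum>i=1..<n. of_real (tail_error i) * v (n - i)))"
      using n by simp
    also have "norm \<dots> \<le> norm (of_real (tail_error 0) * v n) + (norm (of_real (tail_error n) * v 0)
        + norm (\<Sum>i=1..<n. of_real (tail_error i) * v (n - i)))"
      by (meson add_left_mono norm_triangle_ineq order_trans)
    finally have *: "norm (\<Sum>i\<le>n. of_real (tail_error i) * v (n - i)) \<le> norm (of_real (tail_error 0) * v n)
        + (norm (of_real (tail_error n) * v 0) + norm (\<Sum>i=1..<n. of_real (tail_error i) * v (n - i)))" .
    have a: "norm (of_real (tail_error 0) * v n) \<le> \<bar>tail_error 0\<bar> * (L * CV * real n powr - \<kappa>)"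
      using v[OF n] by (simp add: norm_mult mult_left_mono)
    have "real n powr - (2 * \<beta>) \<le> real n powr - \<kappa>" using n \<kappa> beta by (intro powr_mono) auto
    then have "\<bar>tail_error n\<bar> \<le> Ce * real n powr - \<kappa>"
      using Ce(2)[OF n] Ce(1) by (meson mult_left_mono order_trans)
    then have b: "norm (of_real (tail_error n) * v 0) \<le> (Ce * real n powr - \<kappa>) * norm (v 0)"
      by (simp add: norm_mult mult_right_mono)
    have "norm (\<Sum>i=1..<n. of_real (tail_error i) * v (n - i))
        \<le> (\<Sum>i=1..<n. (Ce * real i powr - (2 * \<beta>)) * (L * CV * real (n - i) powr - \<kappa>))"
    proof (rule sum_norm_le)
      fix i assume "i \<in> {1..<n}"
      then show "norm (of_real (tail_error i) * v (n - i)) \<le> (Ce * real i powr - (2 * \<beta>)) * (L * CV * real (n - i) powr - \<kappa>)"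
        unfolding norm_mult using Ce v[of "n - i"] by (intro mult_mono) auto
    qed
    also have "\<dots> = Ce * (L * CV) * (\<Sum>i=1..<n. real i powr - (2 * \<beta>) * real (n - i) powr - \<kappa>)"
      unfolding sum_distrib_left by (intro sum.cong) auto
    also have "\<dots> \<le> Ce * (L * CV) * (Cc * real n powr - \<kappa>)"
      using Cc(2)[OF n] Ce(1) L(1) CV(1) by (intro mult_left_mono mult_nonneg_nonneg)
    finally have cc: "norm (\<Sum>i=1..<n. of_real (tail_error i) * v (n - i)) \<le> Ce * (L * CV) * (Cc * real n powr - \<kappa>)" .
    have "C1 * real n powr - \<kappa> = \<bar>tail_error 0\<bar> * (L * CV * real n powr - \<kappa>)
       + (Ce * real n powr - \<kappa>) * norm (v 0) + Ce * (L * CV) * (Cc * real n powr - \<kappa>)"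
      by (simp add: C1_def algebra_simps)
    then show ?thesis using * a b cc by linarith
  qed
  have G: "0 < Gamma \<beta>" using beta by (intro Gamma_real_pos) auto
  define C where "C = (C1 + 1 / Gamma \<beta>) / scale"
  have C1: "0 \<le> C1" unfolding C1_def using Ce(1) L(1) CV(1) Cc(1) by (intro add_nonneg_nonneg mult_nonneg_nonneg) auto
  have C: "0 \<le> C" unfolding C_def using C1 G scale_pos by (intro divide_nonneg_pos add_nonneg_nonneg) auto
  show ?thesis
  proof (intro exI[of _ C] conjI allI impI C)
    fix n :: nat assume n: "1 \<le> n"
    have const: "sin (pi * \<beta>) / (pi * c) = 1 / (scale * Gamma \<beta>)"
      using Gamma_reflection_real[of \<beta>] beta G by (simp add: scale_def field_simps)
    have "real n powr (\<beta> - 2) \<le> real n powr - \<kappa>" using n \<kappa> beta by (intro powr_mono) auto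
    then have "1 / Gamma \<beta> * real n powr (\<beta> - 2) \<le> 1 / Gamma \<beta> * real n powr - \<kappa>"
      using G by (intro mult_left_mono) auto
    then have 1: "\<bar>negbin \<beta> n - real n powr (\<beta> - 1) / Gamma \<beta>\<bar> \<le> 1 / Gamma \<beta> * real n powr - \<kappa>"
      using negbin_asymptotic[of \<beta> n] beta n by simp
    have "norm (of_real (scale * u n) - of_real (negbin \<beta> n) :: complex) \<le> C1 * real n powr - \<kappa>"
      unfolding identity using conv[OF n] by simp
    then have 2: "\<bar>scale * u n - negbin \<beta> n\<bar> \<le> C1 * real n powr - \<kappa>"
      by (simp only: of_real_diff[symmetric] norm_of_real)
    have "scale * \<bar>u n - sin (pi * \<beta>) / (pi * c) * real n powr (\<beta> - 1)\<bar>
        = \<bar>scale * (u n - sin (pi * \<beta>) / (pi * c) * real n powr (\<beta> - 1))\<bar>"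
      using scale_pos by (simp add: abs_mult)
    also have "scale * (u n - sin (pi * \<beta>) / (pi * c) * real n powr (\<beta> - 1))
        = scale * u n - real n powr (\<beta> - 1) / Gamma \<beta>"
      unfolding const using scale_pos by (simp add: right_diff_distrib)
    also have "\<bar>scale * u n - real n powr (\<beta> - 1) / Gamma \<beta>\<bar> \<le> C1 * real n powr - \<kappa> + 1 / Gamma \<beta> * real n powr - \<kappa>"
      using 1 2 by linarith
    also have "\<dots> = scale * (C * real n powr - \<kappa>)"
      using scale_pos by (simp add: C_def distrib_right)
    finally show "\<bar>u n - sin (pi * \<beta>) / (pi * c) * real n powr (\<beta> - 1)\<bar> \<le> C * real n powr - \<kappa>"
      using scale_pos by simp
  qed
qed

end


section \<open>Complexification\<close>

lemma cscale_apply: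
  "blinfun_apply (cscale z) p = (Re z *\<^sub>R fst p - Im z *\<^sub>R snd p, Im z *\<^sub>R fst p + Re z *\<^sub>R snd p)"
  by transfer simp

lemma complexify_apply: "blinfun_apply (complexify T) p = (T (fst p), T (snd p))"
  by transfer simp

lemma cscale_add: "cscale (z + w) = cscale z + cscale w"
  by (rule blinfun_eqI) (simp add: cscale_apply blinfun.add_left algebra_simps)

lemma cscale_diff: "cscale (z - w) = cscale z - cscale w"
  by (rule blinfun_eqI) (simp add: cscale_apply blinfun.diff_left algebra_simps)

lemma cscale_mult: "cscale (z * w) = cscale z o\<^sub>L cscale w"
  by (rule blinfun_eqI) (simp add: cscale_apply algebra_simps)

lemma cscale_1: "cscale 1 = id_blinfun"
  by (rule blinfun_eqI) (simp add: cscale_apply)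

lemma cscale_0: "cscale 0 = 0"
  by (rule blinfun_eqI) (simp add: cscale_apply zero_prod_def)

lemma cscale_scaleR: "cscale (r *\<^sub>R z) = r *\<^sub>R cscale z"
  by (rule blinfun_eqI) (simp add: cscale_apply blinfun.scaleR_left algebra_simps)

lemma norm_component_le: "norm (fst p) \<le> norm p" "norm (snd p) \<le> norm p"
  by (metis norm_fst_le prod.collapse) (metis norm_snd_le prod.collapse)

lemma norm_cscale_le: "norm (cscale z) \<le> 4 * norm z"
proof (rule norm_blinfun_bound)
  fix p :: "'a \<times> 'a"
  have 1: "norm (s *\<^sub>R x) \<le> norm z * norm p" if "\<bar>s\<bar> \<le> norm z" "norm x \<le> norm p" for s and x :: 'a
    using that by (simp add: mult_mono)
  have "norm (blinfun_apply (cscale z) p)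
      \<le> norm (Re z *\<^sub>R fst p - Im z *\<^sub>R snd p) + norm (Im z *\<^sub>R fst p + Re z *\<^sub>R snd p)"
    unfolding cscale_apply by (rule norm_Pair_le)
  also have "\<dots> \<le> (norm (Re z *\<^sub>R fst p) + norm (Im z *\<^sub>R snd p)) + (norm (Im z *\<^sub>R fst p) + norm (Re z *\<^sub>R snd p))"
    by (intro add_mono norm_triangle_ineq norm_triangle_ineq4)
  also have "\<dots> \<le> (norm z * norm p + norm z * norm p) + (norm z * norm p + norm z * norm p)"
    by (intro add_mono 1 abs_Re_le_cmod abs_Im_le_cmod norm_component_le)
  finally show "norm (blinfun_apply (cscale z) p) \<le> 4 * norm z * norm p" by simp
qed simp

lemma bounded_linear_cscale: "bounded_linear cscale"
  by (rule bounded_linear_intro[where K = 4])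
    (simp_all add: cscale_add cscale_scaleR, metis norm_cscale_le mult.commute)

lemma norm_complexify_le: "norm (complexify T) \<le> 2 * norm T"
proof (rule norm_blinfun_bound)
  fix p :: "'a \<times> 'a"
  have "norm (blinfun_apply (complexify T) p) \<le> norm (T (fst p)) + norm (T (snd p))"
    unfolding complexify_apply by (rule norm_Pair_le)
  also have "\<dots> \<le> norm T * norm p + norm T * norm p"
    by (intro add_mono order_trans[OF norm_blinfun] mult_left_mono norm_component_le) auto
  finally show "norm (blinfun_apply (complexify T) p) \<le> 2 * norm T * norm p" by (simp add: mult.commute)
qed simp

lemma complexify_cscale: "complexify T o\<^sub>L cscale z = cscale z o\<^sub>L complexify T"
  by (rule blinfun_eqI)
    (simp add: complexify_apply cscale_apply blinfun.add_right blinfun.diff_right blinfun.scaleR_right)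

lift_definition complex_functional :: "('b::real_normed_vector \<Rightarrow>\<^sub>L real) \<Rightarrow> ('b \<times> 'b) \<Rightarrow>\<^sub>L complex" is
  "\<lambda>l p. of_real (l (fst p)) + \<i> * of_real (l (snd p))"
  by (intro bounded_linear_add bounded_linear_const_mult bounded_linear_compose[OF bounded_linear_of_real]
      bounded_linear_compose[OF _ bounded_linear_fst] bounded_linear_compose[OF _ bounded_linear_snd])

lemma complex_functional_apply:
  "blinfun_apply (complex_functional l) p = of_real (l (fst p)) + \<i> * of_real (l (snd p))"
  by transfer simp

lemma complex_functional_cscale:
  "blinfun_apply (complex_functional l) (blinfun_apply (cscale z) p) = z * complex_functional l p"
  by (simp add: complex_functional_apply cscale_apply complex_eq_iff blinfun.add_right blinfun.diff_right
      blinfun.scaleR_right algebra_simps)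

lemma norm_complex_functional_le: "norm (complex_functional l) \<le> 2 * norm l"
proof (rule norm_blinfun_bound)
  fix p :: "'a \<times> 'a"
  have "norm (blinfun_apply (complex_functional l) p) \<le> norm (l (fst p)) + norm (l (snd p))"
    unfolding complex_functional_apply by (rule order_trans[OF norm_triangle_ineq]) (simp add: norm_mult)
  also have "\<dots> \<le> norm l * norm p + norm l * norm p"
    by (intro add_mono order_trans[OF norm_blinfun] mult_left_mono norm_component_le) auto
  finally show "norm (blinfun_apply (complex_functional l) p) \<le> 2 * norm l * norm p" by (simp add: mult.commute)
qed simp

text \<open>The operator \<open>e \<otimes> l\<close>.\<close>

lift_definition rank_one ::
    "('b::real_normed_vector \<times> 'b) \<Rightarrow> (('b \<times> 'b) \<Rightarrow>\<^sub>L complex) \<Rightarrow> ('b \<times> 'b) \<Rightarrow>\<^sub>L ('b \<times> 'b)" is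
  "\<lambda>e l x. blinfun_apply (cscale (l x)) e"
  by (rule bounded_linear_compose[OF bounded_linear_compose[OF blinfun.bounded_linear_left bounded_linear_cscale]])

lemma rank_one_apply: "blinfun_apply (rank_one e l) x = blinfun_apply (cscale (l x)) e"
  by transfer simp


section \<open>Inverses and reduced resolvents\<close>

lemma blinfun_compose_id [simp]: "A o\<^sub>L id_blinfun = A" "id_blinfun o\<^sub>L A = A"
  by (auto intro: blinfun_eqI)

lemma blinfun_compose_assoc: "(A o\<^sub>L B) o\<^sub>L C = A o\<^sub>L (B o\<^sub>L C)"
  by (rule blinfun_eqI) simp

lemma inverse_of_unique:
  assumes "inverse_of S T" "inverse_of S' T"
  shows "S = S'"
proof -
  have "S = S o\<^sub>L (T o\<^sub>L S')" using assms by (simp add: inverse_of_def)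
  also have "\<dots> = (S o\<^sub>L T) o\<^sub>L S'" by (simp add: blinfun_compose_assoc)
  finally show ?thesis using assms by (simp add: inverse_of_def)
qed

lemma inverse_of_resolvent: "\<kappa> \<notin> spectrum T \<Longrightarrow> inverse_of (resolvent T \<kappa>) (cscale \<kappa> - T)"
proof -
  assume "\<kappa> \<notin> spectrum T"
  then obtain S where S: "inverse_of S (cscale \<kappa> - T)" unfolding spectrum_def by blast
  then have "resolvent T \<kappa> = S" unfolding resolvent_def using inverse_of_unique by (intro the_equality)
  with S show ?thesis by simp
qed

lemma blinfun_compose_diff_left: "(A - B) o\<^sub>L C = (A o\<^sub>L C) - (B o\<^sub>L C)"
  by (rule bounded_bilinear.diff_left[OF bounded_bilinear_blinfun_compose])

lemma blinfun_compose_diff_right: "A o\<^sub>L (B - C) = (A o\<^sub>L B) - (A o\<^sub>L C)"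
  by (rule bounded_bilinear.diff_right[OF bounded_bilinear_blinfun_compose])

lemma blinfun_compose_add_left: "(A + B) o\<^sub>L C = (A o\<^sub>L C) + (B o\<^sub>L C)"
  by (rule bounded_bilinear.add_left[OF bounded_bilinear_blinfun_compose])

lemma blinfun_compose_add_right: "A o\<^sub>L (B + C) = (A o\<^sub>L B) + (A o\<^sub>L C)"
  by (rule bounded_bilinear.add_right[OF bounded_bilinear_blinfun_compose])

lemmas blinfun_compose_distribs = blinfun_compose_diff_left blinfun_compose_diff_right
  blinfun_compose_add_left blinfun_compose_add_right

lemma inverse_of_diff:
  assumes "inverse_of S A" "inverse_of S' A'"
  shows "S - S' = (S o\<^sub>L (A' - A)) o\<^sub>L S'"
proof -
  have "(S o\<^sub>L (A' - A)) o\<^sub>L S' = (S o\<^sub>L (A' o\<^sub>L S')) - ((S o\<^sub>L A) o\<^sub>L S')"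
    by (simp add: blinfun_compose_distribs blinfun_compose_assoc)
  then show ?thesis using assms by (simp add: inverse_of_def)
qed

lemma inverse_of_commute:
  assumes "inverse_of S A" "A o\<^sub>L B = B o\<^sub>L A"
  shows "S o\<^sub>L B = B o\<^sub>L S"
proof -
  have "S o\<^sub>L B = (S o\<^sub>L B) o\<^sub>L (A o\<^sub>L S)" using assms by (simp add: inverse_of_def)
  also have "\<dots> = (S o\<^sub>L (B o\<^sub>L A)) o\<^sub>L S" by (simp add: blinfun_compose_assoc)
  also have "\<dots> = (S o\<^sub>L (A o\<^sub>L B)) o\<^sub>L S" by (simp only: assms(2))
  also have "\<dots> = (S o\<^sub>L A) o\<^sub>L (B o\<^sub>L S)" by (simp add: blinfun_compose_assoc)
  finally show ?thesis using assms by (simp add: inverse_of_def)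
qed

text \<open>If \<open>A\<close> moves by at most \<open>1 / (2 \<parallel>S\<parallel>)\<close>, the norm of its inverse at most doubles, because
  \<open>S' - S = S' (A - A') S\<close>; then the same identity bounds \<open>S' - S\<close>.\<close>

lemma continuous_on_inverse_of:
  fixes A S :: "'k::metric_space \<Rightarrow> ('c::real_normed_vector \<Rightarrow>\<^sub>L 'c)"
  assumes A: "continuous_on K A" and S: "\<And>k. k \<in> K \<Longrightarrow> inverse_of (S k) (A k)"
  shows "continuous_on K S"
  unfolding continuous_on_def
proof
  fix k assume k: "k \<in> K"
  let ?m = "norm (S k)"
  have lim: "((\<lambda>x. norm (A k - A x)) \<longlongrightarrow> 0) (at k within K)"
  proof -
    have "(A \<longlongrightarrow> A k) (at k within K)" using A k unfolding continuous_on_def by blast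
    from tendsto_norm[OF tendsto_diff[OF tendsto_const[of "A k"] this]] show ?thesis by simp
  qed
  have near: "norm (S x - S k) \<le> 2 * ?m * ?m * norm (A k - A x)"
    if x: "x \<in> K" and small: "norm (A k - A x) < 1 / (2 * (?m + 1))" for x
  proof -
    have eq: "S x - S k = (S x o\<^sub>L (A k - A x)) o\<^sub>L S k" using inverse_of_diff S x k by blast
    have le: "norm (S x - S k) \<le> norm (S x) * norm (A k - A x) * ?m"
      unfolding eq by (meson mult_right_mono norm_blinfun_compose norm_ge_zero order_trans)
    have "norm (A k - A x) * ?m \<le> 1 / (2 * (?m + 1)) * (?m + 1)"
      using small by (intro mult_mono) (auto simp: add_nonneg_nonneg)
    also have "\<dots> = 1 / 2"
    proof -
      have "?m + 1 \<noteq> 0" using norm_ge_zero[of "S k"] by linarith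
      then show ?thesis by simp
    qed
    finally have "norm (S x) * (norm (A k - A x) * ?m) \<le> norm (S x) * (1 / 2)"
      by (intro mult_left_mono) auto
    then have "norm (S x) \<le> 2 * ?m"
      using le norm_triangle_ineq2[of "S x" "S k"] by (simp add: mult.assoc)
    then have "norm (S x) * (norm (A k - A x) * ?m) \<le> 2 * ?m * (norm (A k - A x) * ?m)"
      by (intro mult_right_mono) auto
    then show ?thesis using le by (simp add: mult_ac)
  qed
  have "eventually (\<lambda>x. x \<in> K) (at k within K)" by (simp add: eventually_at_filter)
  moreover have "eventually (\<lambda>x. norm (A k - A x) < 1 / (2 * (?m + 1))) (at k within K)"
    using lim by (rule order_tendstoD) (simp add: add_nonneg_pos)
  ultimately have "eventually (\<lambda>x. norm (S x - S k) \<le> 2 * ?m * ?m * norm (A k - A x)) (at k within K)"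
    by eventually_elim (rule near)
  then have "((\<lambda>x. S x - S k) \<longlongrightarrow> 0) (at k within K)"
    by (rule Lim_null_comparison) (use tendsto_mult_left[OF lim, of "2 * ?m * ?m"] in simp)
  then show "(S \<longlongrightarrow> S k) (at k within K)" by (rule Lim_null[THEN iffD2])
qed


lemma circle_mean_linear:
  fixes f :: "real \<Rightarrow> 'x::banach" and h :: "'x \<Rightarrow> 'y::banach"
  assumes "bounded_linear h" "continuous_on {0..2 * pi} f"
  shows "h ((1 / (2 * pi)) *\<^sub>R integral {0..2 * pi} f) = (1 / (2 * pi)) *\<^sub>R integral {0..2 * pi} (\<lambda>\<theta>. h (f \<theta>))"
  using integral_linear[OF integrable_continuous_real[OF assms(2)] assms(1)]
    linear_cmul[OF bounded_linear.linear[OF assms(1)]] by (simp add: o_def)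

lemma circle_mean_const: "(1 / (2 * pi)) *\<^sub>R integral {0..2 * pi} (\<lambda>\<theta>. x) = (x::'x::banach)"
  by simp

text \<open>The operator \<open>S\<close> is the constant term of the Laurent expansion of the resolvent at \<open>1\<close>,
  \<open>(2\<pi>\<i>)\<^sup>-\<^sup>1 \<integral> (\<zeta> - 1)\<^sup>-\<^sup>1 (\<zeta> - L)\<^sup>-\<^sup>1 d\<zeta>\<close>, and integrating
  \<open>(1 - L) (\<zeta> - L)\<^sup>-\<^sup>1 = 1 - (\<zeta> - 1) (\<zeta> - L)\<^sup>-\<^sup>1\<close> against \<open>(\<zeta> - 1)\<^sup>-\<^sup>1 d\<zeta>\<close> gives \<open>(1 - L) S = 1 - P\<close>. The
  Riesz projection fixes \<open>e\<close> and preserves \<open>l\<close>, which identifies it as \<open>e \<otimes> l\<close> once its range is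
  known to be one-dimensional.\<close>

theorem reduced_resolvent_exists:
  fixes L :: "('b::banach \<times> 'b) \<Rightarrow>\<^sub>L ('b \<times> 'b)" and l :: "('b \<times> 'b) \<Rightarrow>\<^sub>L complex"
  assumes lin: "\<And>z. L o\<^sub>L cscale z = cscale z o\<^sub>L L"
    and simple: "simple_isolated_eigenvalue L 1"
    and e: "blinfun_apply L e = e"
    and l: "\<And>x. l (L x) = l x" "\<And>z x. l (cscale z x) = z * l x" "l e = 1"
  shows "\<exists>S. S o\<^sub>L (id_blinfun - L) = id_blinfun - rank_one e l \<and>
             (id_blinfun - L) o\<^sub>L S = id_blinfun - rank_one e l"
proof -
  obtain r v where r: "0 < r" "cball 1 r \<inter> spectrum L = {1}"
    and v: "range (blinfun_apply (riesz_projection L 1 r)) = range (\<lambda>z. blinfun_apply (cscale z) v)"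
    using simple unfolding simple_isolated_eigenvalue_def by blast
  define \<rho> where "\<rho> \<theta> = of_real r * cis \<theta>" for \<theta>
  have \<rho>: "\<rho> \<theta> \<noteq> 0" "norm (\<rho> \<theta>) = r" for \<theta> using r by (auto simp: \<rho>_def norm_mult)
  define X where "X \<theta> = resolvent L (1 + \<rho> \<theta>)" for \<theta>
  have X: "inverse_of (X \<theta>) (cscale (1 + \<rho> \<theta>) - L)" for \<theta>
  proof -
    have "1 + \<rho> \<theta> \<in> cball 1 r" using \<rho> by (simp add: dist_norm)
    moreover have "1 + \<rho> \<theta> \<noteq> 1" using \<rho>(1)[of \<theta>] by simp
    ultimately have "1 + \<rho> \<theta> \<notin> spectrum L" using r(2) by blast
    then show ?thesis unfolding X_def by (rule inverse_of_resolvent)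
  qed
  have shift: "cscale (1 + \<rho> \<theta>) - L = (id_blinfun - L) + cscale (\<rho> \<theta>)" for \<theta>
    by (simp add: cscale_add cscale_1)
  have cont\<rho>: "continuous_on K (\<lambda>\<theta>. cscale (\<rho> \<theta>))" for K
    unfolding \<rho>_def by (intro bounded_linear.continuous_on[OF bounded_linear_cscale] continuous_intros)
  have contX: "continuous_on K X" for K
  proof (rule continuous_on_inverse_of)
    show "continuous_on K (\<lambda>\<theta>. cscale (1 + \<rho> \<theta>) - L)"
      unfolding shift by (intro continuous_intros cont\<rho>)
  qed (use X in auto)
  have cont\<rho>X: "continuous_on K (\<lambda>\<theta>. cscale (\<rho> \<theta>) o\<^sub>L X \<theta>)" for K
    by (intro bounded_bilinear.continuous_on[OF bounded_bilinear_blinfun_compose] cont\<rho> contX)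
  define I where "I f = (1 / (2 * pi)) *\<^sub>R integral {0..2 * pi} f" for f :: "real \<Rightarrow> ('b \<times> 'b) \<Rightarrow>\<^sub>L ('b \<times> 'b)"
  define P where "P = riesz_projection L 1 r"
  have P: "P = I (\<lambda>\<theta>. cscale (\<rho> \<theta>) o\<^sub>L X \<theta>)"
    by (simp add: P_def riesz_projection_def I_def \<rho>_def X_def)
  have Pe: "P e = e"
  proof -
    have "blinfun_apply (cscale (\<rho> \<theta>) o\<^sub>L X \<theta>) e = e" for \<theta>
    proof -
      have "blinfun_apply (cscale (1 + \<rho> \<theta>) - L) e = blinfun_apply (cscale (\<rho> \<theta>)) e"
        unfolding shift using e by (simp add: blinfun.add_left blinfun.diff_left)
      then have "X \<theta> (blinfun_apply (cscale (\<rho> \<theta>)) e) = e"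
        using X[of \<theta>] unfolding inverse_of_def by (metis blinfun_apply_blinfun_compose blinfun_apply_id_blinfun id_apply)
      moreover have "X \<theta> o\<^sub>L cscale (\<rho> \<theta>) = cscale (\<rho> \<theta>) o\<^sub>L X \<theta>"
      proof (rule inverse_of_commute[OF X])
        show "(cscale (1 + \<rho> \<theta>) - L) o\<^sub>L cscale (\<rho> \<theta>) = cscale (\<rho> \<theta>) o\<^sub>L (cscale (1 + \<rho> \<theta>) - L)"
          by (simp add: blinfun_compose_distribs lin cscale_mult[symmetric] mult.commute)
      qed
      ultimately show ?thesis by (metis blinfun_apply_blinfun_compose)
    qed
    then have "P e = (1 / (2 * pi)) *\<^sub>R integral {0..2 * pi} (\<lambda>\<theta>. e)"
      unfolding P I_def by (subst circle_mean_linear[where h = "\<lambda>A. blinfun_apply A e", OF blinfun.bounded_linear_left cont\<rho>X]) simp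
    then show ?thesis by (simp only: circle_mean_const)
  qed
  have lP: "l (P x) = l x" for x
  proof -
    have *: "l (blinfun_apply (cscale (\<rho> \<theta>) o\<^sub>L X \<theta>) x) = l x" for \<theta>
    proof -
      have "x = blinfun_apply (cscale (1 + \<rho> \<theta>) - L) (X \<theta> x)"
        using X[of \<theta>] unfolding inverse_of_def by (metis blinfun_apply_blinfun_compose blinfun_apply_id_blinfun id_apply)
      then have "l x = l (blinfun_apply (cscale (1 + \<rho> \<theta>) - L) (X \<theta> x))" by simp
      also have "\<dots> = \<rho> \<theta> * l (X \<theta> x)"
        by (simp add: blinfun.diff_left blinfun.diff_right l algebra_simps)
      finally show ?thesis by (simp add: l)
    qed
    have "bounded_linear (\<lambda>A. l (blinfun_apply A x))"
      by (rule bounded_linear_compose[OF blinfun.bounded_linear_right blinfun.bounded_linear_left])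
    then have "l (P x) = (1 / (2 * pi)) *\<^sub>R integral {0..2 * pi} (\<lambda>\<theta>. l x)"
      unfolding P I_def by (subst circle_mean_linear[where h = "\<lambda>A. l (blinfun_apply A x)", OF _ cont\<rho>X]) (simp_all only: *)
    then show ?thesis by (simp only: circle_mean_const)
  qed
  have P_eq: "P = rank_one e l"
  proof (rule blinfun_eqI)
    fix x
    have "e \<in> range (blinfun_apply P)" using Pe by (metis rangeI)
    then obtain a where a: "e = blinfun_apply (cscale a) v" using v unfolding P_def by auto
    have "P x \<in> range (blinfun_apply P)" by blast
    then obtain b where b: "P x = blinfun_apply (cscale b) v" using v unfolding P_def by auto
    have "a * l v = 1" using a l by metis
    then have a0: "a \<noteq> 0" by auto
    have "blinfun_apply (cscale (b / a)) e = blinfun_apply (cscale (b / a * a)) v"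
      unfolding a cscale_mult by simp
    then have *: "P x = blinfun_apply (cscale (b / a)) e" using a0 b by simp
    then have "l x = b / a" using lP[of x] l by simp
    then show "P x = blinfun_apply (rank_one e l) x" using * by (simp add: rank_one_apply)
  qed
  have right: "(id_blinfun - L) o\<^sub>L X \<theta> = id_blinfun - (cscale (\<rho> \<theta>) o\<^sub>L X \<theta>)" for \<theta>
    using X[of \<theta>] unfolding inverse_of_def shift
    by (simp add: blinfun_compose_add_left eq_diff_eq)
  have left: "X \<theta> o\<^sub>L (id_blinfun - L) = id_blinfun - (cscale (\<rho> \<theta>) o\<^sub>L X \<theta>)" for \<theta>
  proof -
    have "X \<theta> o\<^sub>L (id_blinfun - L) = (id_blinfun - L) o\<^sub>L X \<theta>"
    proof (rule inverse_of_commute[OF X])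
      show "(cscale (1 + \<rho> \<theta>) - L) o\<^sub>L (id_blinfun - L) = (id_blinfun - L) o\<^sub>L (cscale (1 + \<rho> \<theta>) - L)"
        by (simp add: blinfun_compose_distribs lin)
    qed
    then show ?thesis using right by simp
  qed
  have int_eq: "(1 / (2 * pi)) *\<^sub>R integral {0..2 * pi} (\<lambda>\<theta>. id_blinfun - (cscale (\<rho> \<theta>) o\<^sub>L X \<theta>)) = id_blinfun - P"
  proof -
    have "integral {0..2 * pi} (\<lambda>\<theta>. id_blinfun - (cscale (\<rho> \<theta>) o\<^sub>L X \<theta>))
        = integral {0..2 * pi} (\<lambda>\<theta>. id_blinfun) - integral {0..2 * pi} (\<lambda>\<theta>. cscale (\<rho> \<theta>) o\<^sub>L X \<theta>)"
      by (intro Henstock_Kurzweil_Integration.integral_diff integrable_continuous_real cont\<rho>X continuous_on_const)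
    then show ?thesis unfolding P I_def scaleR_diff_right[symmetric] using circle_mean_const by (simp add: scaleR_diff_right)
  qed
  have "(id_blinfun - L) o\<^sub>L I X = id_blinfun - P"
    using circle_mean_linear[OF bounded_bilinear.bounded_linear_right[OF bounded_bilinear_blinfun_compose, of "id_blinfun - L"] contX]
    by (simp only: right int_eq I_def)
  moreover have "I X o\<^sub>L (id_blinfun - L) = id_blinfun - P"
    using circle_mean_linear[OF bounded_bilinear.bounded_linear_left[OF bounded_bilinear_blinfun_compose, of "id_blinfun - L"] contX]
    by (simp only: left int_eq I_def)
  ultimately show ?thesis unfolding P_eq by blast
qed


section \<open>Operator renewal theory\<close>

text \<open>The operators \<open>Rn n\<close> are dominated by \<open>p n\<close>, and their sum fixes the vector \<open>e\<close> and the
  functional \<open>l\<close>. In the application \<open>e\<close> is the function \<open>1\<close> and \<open>l\<close> is the integral.\<close>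

locale operator_renewal = regular_tail p q \<beta> c K
  for p q :: "nat \<Rightarrow> real" and \<beta> c K :: real +
  fixes Rn :: "nat \<Rightarrow> 'b::banach \<Rightarrow>\<^sub>L 'b" and C0 :: real and l :: "'b \<Rightarrow>\<^sub>L real" and e :: 'b
  assumes C0: "0 \<le> C0" and Rn_bound: "1 \<le> n \<Longrightarrow> norm (Rn n) \<le> C0 * p n"
    and l_Rn_e: "1 \<le> n \<Longrightarrow> l (Rn n e) = p n"
    and l_Rn_sums: "(\<lambda>n. l (Rn (Suc n) v)) sums l v"
    and Rn_e_sums: "(\<lambda>n. Rn (Suc n) e) sums e"
    and l_e: "l e = 1"
    and simple: "simple_isolated_eigenvalue (return_series Rn 1) 1"
    and nonresonant: "norm z \<le> 1 \<Longrightarrow> z \<noteq> 1 \<Longrightarrow> 1 \<notin> spectrum (return_series Rn z)"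
begin

abbreviation R :: "complex \<Rightarrow> ('b \<times> 'b) \<Rightarrow>\<^sub>L ('b \<times> 'b)" where "R \<equiv> return_series Rn"

definition Rterm :: "nat \<Rightarrow> complex \<Rightarrow> ('b \<times> 'b) \<Rightarrow>\<^sub>L ('b \<times> 'b)" where
  "Rterm n z = (if n = 0 then 0 else cscale (z ^ n) o\<^sub>L complexify (Rn n))"

lemma norm_compose_le: "norm A \<le> a \<Longrightarrow> norm B \<le> b \<Longrightarrow> norm (A o\<^sub>L B) \<le> a * b"
  by (meson mult_mono norm_blinfun_compose norm_ge_zero order_trans)

lemma norm_Rterm_diff:
  "norm (Rterm n z - Rterm n z') \<le> 8 * C0 * p n * norm (z ^ n - z' ^ n)"
proof (cases "n = 0")
  case False
  then have "Rterm n z - Rterm n z' = cscale (z ^ n - z' ^ n) o\<^sub>L complexify (Rn n)"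
    by (simp add: Rterm_def cscale_diff blinfun_compose_diff_left)
  also have "norm \<dots> \<le> (4 * norm (z ^ n - z' ^ n)) * (2 * (C0 * p n))"
    using Rn_bound[of n] False norm_complexify_le[of "Rn n"]
    by (intro norm_compose_le norm_cscale_le) auto
  finally show ?thesis by (simp add: mult_ac)
qed (simp add: Rterm_def p_0)

lemma norm_Rterm: "norm z \<le> 1 \<Longrightarrow> norm (Rterm n z) \<le> 8 * C0 * p n"
proof (cases "n = 0")
  case False
  assume z: "norm z \<le> 1"
  have "norm (Rterm n z - Rterm n 0) \<le> 8 * C0 * p n * norm (z ^ n - 0 ^ n)"
    by (rule norm_Rterm_diff)
  also have "8 * C0 * p n * norm (z ^ n - 0 ^ n) \<le> 8 * C0 * p n * 1"
  proof (rule mult_left_mono)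
    show "norm (z ^ n - 0 ^ n) \<le> 1" using False z by (simp add: zero_power norm_power power_le_one)
  qed (use C0 p_nonneg[of n] in simp)
  finally have "norm (Rterm n z - Rterm n 0) \<le> 8 * C0 * p n" by simp
  moreover have "Rterm n 0 = 0"
    using False by (simp add: Rterm_def zero_power cscale_0 blinfun_eqI)
  ultimately show ?thesis by simp
qed (simp add: Rterm_def p_0)

lemma Rterm_summable_norm:
  assumes z: "norm z \<le> 1"
  shows "summable (\<lambda>n. norm (Rterm n z))"
proof (rule summable_comparison_test'[where N = 0])
  show "summable (\<lambda>n. 8 * C0 * p n)" using p_summable by (rule summable_mult)
  show "norm (norm (Rterm n z)) \<le> 8 * C0 * p n" for n using norm_Rterm[OF z] by simp
qed

lemma Rterm_summable: "norm z \<le> 1 \<Longrightarrow> summable (\<lambda>n. Rterm n z)"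
  by (rule summable_norm_cancel[OF Rterm_summable_norm])

lemma R_eq: "norm z \<le> 1 \<Longrightarrow> R z = (\<Sum>n. Rterm n z)"
  using suminf_split_head[OF Rterm_summable, of z] by (simp add: return_series_def Rterm_def)

lemma R_sums: "norm z \<le> 1 \<Longrightarrow> (\<lambda>n. Rterm n z) sums R z"
  using summable_sums[OF Rterm_summable] R_eq by simp

lemma R_apply_sums: "norm z \<le> 1 \<Longrightarrow> (\<lambda>n. blinfun_apply (Rterm n z) x) sums blinfun_apply (R z) x"
  by (rule bounded_linear.sums[OF blinfun.bounded_linear_left R_sums])

lemma R_cscale:
  assumes "norm z \<le> 1"
  shows "R z o\<^sub>L cscale w = cscale w o\<^sub>L R z"
proof -
  have "(\<lambda>n. Rterm n z o\<^sub>L cscale w) sums (R z o\<^sub>L cscale w)"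
    by (rule bounded_linear.sums[OF bounded_bilinear.bounded_linear_left[OF bounded_bilinear_blinfun_compose] R_sums[OF assms]])
  moreover have "(\<lambda>n. cscale w o\<^sub>L Rterm n z) sums (cscale w o\<^sub>L R z)"
    by (rule bounded_linear.sums[OF bounded_bilinear.bounded_linear_right[OF bounded_bilinear_blinfun_compose] R_sums[OF assms]])
  moreover have "(\<lambda>n. Rterm n z o\<^sub>L cscale w) = (\<lambda>n. cscale w o\<^sub>L Rterm n z)"
  proof
    fix n
    have "cscale (z ^ n) o\<^sub>L (complexify (Rn n) o\<^sub>L cscale w) = (cscale (z ^ n) o\<^sub>L cscale w) o\<^sub>L complexify (Rn n)"
      unfolding complexify_cscale by (simp add: blinfun_compose_assoc)
    also have "cscale (z ^ n) o\<^sub>L cscale w = cscale w o\<^sub>L cscale (z ^ n)"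
      by (simp add: mult.commute flip: cscale_mult)
    finally show "Rterm n z o\<^sub>L cscale w = cscale w o\<^sub>L Rterm n z"
      by (cases "n = 0") (simp_all add: Rterm_def blinfun_compose_assoc)
  qed
  ultimately show ?thesis using sums_unique2 by simp
qed

abbreviation ehat :: "'b \<times> 'b" where "ehat \<equiv> (e, 0)"

abbreviation lc :: "('b \<times> 'b) \<Rightarrow>\<^sub>L complex" where "lc \<equiv> complex_functional l"

lemma lc_ehat: "lc ehat = 1"
  by (simp add: complex_functional_apply l_e)

lemma ehat_nonzero: "ehat \<noteq> 0"
  using l_e by (auto simp: zero_prod_def)

lemma R_1_ehat: "R 1 ehat = ehat"
proof -
  have "(\<lambda>n. blinfun_apply (Rterm (Suc n) 1) ehat) sums blinfun_apply (R 1) ehat"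
    using R_apply_sums[of 1 ehat] sums_Suc_iff[of "\<lambda>n. blinfun_apply (Rterm n 1) ehat"]
    by (simp add: Rterm_def)
  moreover have "(\<lambda>n. (Rn (Suc n) e, 0)) sums (e, 0 :: 'b)"
    by (rule bounded_linear.sums[OF bounded_linear_Pair[OF bounded_linear_ident bounded_linear_zero] Rn_e_sums])
  moreover have "blinfun_apply (Rterm (Suc n) 1) ehat = (Rn (Suc n) e, 0)" for n
    by (simp add: Rterm_def complexify_apply cscale_1)
  ultimately show ?thesis using sums_unique2 by simp
qed

lemma lc_R_1: "lc (R 1 x) = lc x"
proof -
  have "(\<lambda>n. lc (blinfun_apply (Rterm (Suc n) 1) x)) sums lc (blinfun_apply (R 1) x)"
    using bounded_linear.sums[OF blinfun.bounded_linear_right R_apply_sums[of 1 x], of lc]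
      sums_Suc_iff[of "\<lambda>n. lc (blinfun_apply (Rterm n 1) x)"]
    by (simp add: Rterm_def)
  moreover have "(\<lambda>n. of_real (l (Rn (Suc n) (fst x))) + \<i> * of_real (l (Rn (Suc n) (snd x))))
      sums (of_real (l (fst x)) + \<i> * of_real (l (snd x)))"
    by (intro sums_add sums_mult sums_of_real l_Rn_sums)
  moreover have "lc (blinfun_apply (Rterm (Suc n) 1) x)
      = of_real (l (Rn (Suc n) (fst x))) + \<i> * of_real (l (Rn (Suc n) (snd x)))" for n
    by (simp add: Rterm_def complexify_apply cscale_1 complex_functional_apply)
  ultimately show ?thesis using sums_unique2 by (simp add: complex_functional_apply)
qed

lemma lc_R_ehat: "norm z \<le> 1 \<Longrightarrow> lc (R z ehat) = pgf z"
proof -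
  assume z: "norm z \<le> 1"
  have "(\<lambda>n. lc (blinfun_apply (Rterm n z) ehat)) sums lc (blinfun_apply (R z) ehat)"
    by (rule bounded_linear.sums[OF blinfun.bounded_linear_right R_apply_sums[OF z]])
  moreover have "lc (blinfun_apply (Rterm n z) ehat) = of_real (p n) * z ^ n" for n
  proof (cases "n = 0")
    case False
    then have "lc (blinfun_apply (Rterm n z) ehat) = z ^ n * lc (complexify (Rn n) ehat)"
      by (simp add: Rterm_def complex_functional_cscale)
    also have "lc (complexify (Rn n) ehat) = of_real (p n)"
      using False l_Rn_e[of n] by (simp add: complexify_apply complex_functional_apply)
    finally show ?thesis by (simp add: mult.commute)
  qed (simp add: Rterm_def p_0)
  ultimately show ?thesis using pgf_sums[OF z] sums_unique2 by simp
qed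

text \<open>If \<open>pgf\<close> took the value \<open>1\<close> at another point \<open>z\<close>, \<open>z ^ n = 1\<close> would hold for all \<open>n\<close> with
  \<open>p n > 0\<close>, hence \<open>R z = R 1\<close>, and \<open>1\<close> would be an eigenvalue of \<open>R z\<close>.\<close>

lemma aperiodic:
  assumes z: "norm z \<le> 1" "z \<noteq> 1"
  shows "pgf z \<noteq> 1"
proof
  assume "pgf z = 1"
  then have "(\<lambda>n. of_real (p n) * z ^ n) sums 1" using pgf_sums[OF z(1)] by simp
  from sums_Re[OF this] have "(\<lambda>n. p n * Re (z ^ n)) sums 1" by simp
  from sums_diff[OF p_sums this] have *: "(\<lambda>n. p n * (1 - Re (z ^ n))) sums 0"
    by (simp add: algebra_simps)
  have Re_le: "Re (z ^ n) \<le> 1" for n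
    using z complex_Re_le_cmod[of "z ^ n"] power_le_one[of "norm z" n] by (simp add: norm_power)
  have zero: "p n * (1 - Re (z ^ n)) = 0" for n
  proof -
    have "\<forall>n. p n * (1 - Re (z ^ n)) = 0"
      using * suminf_eq_zero_iff[of "\<lambda>n. p n * (1 - Re (z ^ n))"] Re_le p_nonneg
      by (simp add: sums_iff)
    then show ?thesis by blast
  qed
  have "Rterm n z = Rterm n 1" for n
  proof (cases "n = 0 \<or> p n = 0")
    case True
    then have "norm (Rterm n z - Rterm n 1) \<le> 0" using norm_Rterm_diff[of n z 1] p_0 by auto
    then show ?thesis by simp
  next
    case False
    then have "Re (z ^ n) = 1" using zero[of n] by simp
    moreover have "norm (z ^ n) \<le> 1" using z by (simp add: norm_power power_le_one)
    ultimately have "z ^ n = 1"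
      using cmod_power2[of "z ^ n"] by (auto simp: complex_eq_iff power2_eq_square)
        (smt (verit) mult_le_one norm_ge_zero not_real_square_gt_zero)
    then show ?thesis by (simp add: Rterm_def)
  qed
  then have "R z = R 1" using z R_eq[of z] R_eq[of 1] by simp
  moreover have "1 \<in> spectrum (R 1)"
  proof -
    have False if "inverse_of S (cscale 1 - R 1)" for S
    proof -
      have "blinfun_apply (S o\<^sub>L (cscale 1 - R 1)) ehat = 0"
        by (simp add: blinfun.diff_left cscale_1 R_1_ehat)
      moreover have "blinfun_apply (S o\<^sub>L (cscale 1 - R 1)) ehat = ehat"
        using that unfolding inverse_of_def by (metis blinfun_apply_id_blinfun id_apply)
      ultimately show False using ehat_nonzero by simp
    qed
    then show ?thesis unfolding spectrum_def by blast
  qed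
  ultimately show False using nonresonant[OF z] by simp
qed

end

sublocale operator_renewal \<subseteq> aperiodic_regular_tail
  by unfold_locales (rule aperiodic)

context operator_renewal
begin

definition D :: "complex \<Rightarrow> ('b \<times> 'b) \<Rightarrow>\<^sub>L ('b \<times> 'b)" where "D z = R 1 - R z"

definition T :: "complex \<Rightarrow> ('b \<times> 'b) \<Rightarrow>\<^sub>L ('b \<times> 'b)" where "T z = resolvent (R z) 1"

abbreviation P :: "('b \<times> 'b) \<Rightarrow>\<^sub>L ('b \<times> 'b)" where "P \<equiv> rank_one ehat lc"

lemma inverse_of_T: "norm z \<le> 1 \<Longrightarrow> z \<noteq> 1 \<Longrightarrow> inverse_of (T z) (id_blinfun - R z)"
  using inverse_of_resolvent[OF nonresonant] by (simp add: T_def cscale_1)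

lemma R_holder: "\<exists>C\<ge>0. \<forall>z z'. norm z \<le> 1 \<longrightarrow> norm z' \<le> 1 \<longrightarrow> norm (R z - R z') \<le> C * norm (z - z') powr \<beta>"
proof -
  have "\<exists>C\<ge>0. \<forall>z z'. norm z \<le> 1 \<longrightarrow> norm z' \<le> 1 \<longrightarrow>
     norm ((\<Sum>n. Rterm n z) - (\<Sum>n. Rterm n z')) \<le> C * norm (z - z') powr \<beta>"
    using C0 by (intro series_holder[where L = "8 * C0"] Rterm_summable norm_Rterm_diff) auto
  then show ?thesis by (auto simp: R_eq)
qed

lemma D_symbol: "symbol \<beta> \<beta> D"
proof -
  obtain C where C: "\<And>z z'. norm z \<le> 1 \<Longrightarrow> norm z' \<le> 1 \<Longrightarrow> norm (R z - R z') \<le> C * norm (z - z') powr \<beta>"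
    using R_holder by blast
  show ?thesis
    by (rule holder_imp_symbol[where C = C])
      (use C in \<open>auto simp: D_def norm_minus_commute\<close>)
qed

lemma T_bounded_away:
  assumes "0 < \<delta>"
  shows "\<exists>m>0. \<forall>z. norm z \<le> 1 \<longrightarrow> \<delta> \<le> norm (1 - z) \<longrightarrow> norm (T z) \<le> m"
proof -
  define A where "A = cball 0 1 - ball (1::complex) \<delta>"
  have "compact A" unfolding A_def by (intro compact_diff) auto
  obtain C where C: "\<And>z z'. norm z \<le> 1 \<Longrightarrow> norm z' \<le> 1 \<Longrightarrow> norm (R z - R z') \<le> C * norm (z - z') powr \<beta>"
    using R_holder by blast
  have contR: "continuous_on A R"
    by (rule continuous_on_subset[OF holder_imp_continuous_on[of \<beta> R C]])
      (use beta C in \<open>auto simp: A_def\<close>)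
  have "continuous_on A T"
  proof (rule continuous_on_inverse_of)
    show "continuous_on A (\<lambda>z. id_blinfun - R z)" by (intro continuous_intros contR)
    show "inverse_of (T z) (id_blinfun - R z)" if "z \<in> A" for z
      using that assms by (intro inverse_of_T) (auto simp: A_def)
  qed
  then have "bounded (T ` A)"
    using \<open>compact A\<close> by (intro compact_imp_bounded compact_continuous_image)
  then obtain m where m: "0 < m" "\<And>z. z \<in> A \<Longrightarrow> norm (T z) \<le> m" unfolding bounded_pos by blast
  show ?thesis
  proof (intro exI[of _ m] conjI allI impI m)
    fix z :: complex assume "norm z \<le> 1" "\<delta> \<le> norm (1 - z)"
    then show "z \<in> A" by (simp add: A_def dist_norm)
  qed
qed

lemma lc_D: "norm z \<le> 1 \<Longrightarrow> lc ((id_blinfun - R z) x) = lc (D z x)"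
  by (simp add: D_def blinfun.diff_left blinfun.diff_right lc_R_1)

lemma lc_D_ehat: "norm z \<le> 1 \<Longrightarrow> lc (D z ehat) = 1 - pgf z"
  by (simp add: D_def blinfun.diff_left blinfun.diff_right lc_R_1 lc_R_ehat lc_ehat)

lemma D_cscale: "norm z \<le> 1 \<Longrightarrow> D z (cscale w x) = cscale w (D z x)"
  using R_cscale[of z w] R_cscale[of 1 w]
  by (simp add: D_def blinfun.diff_left blinfun.diff_right)
    (metis blinfun_apply_blinfun_compose)

text \<open>The resolvent in the decomposition into the line through \<open>ehat\<close> and the kernel of \<open>lc\<close>.
  The reduced resolvent \<open>S\<close> controls the components in the kernel, and applying the invariant
  functional \<open>lc\<close> to \<open>(1 - R z) T z = 1\<close> the remaining one.\<close>

lemma T_decomposition: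
  assumes S: "S o\<^sub>L (id_blinfun - R 1) = id_blinfun - P" "(id_blinfun - R 1) o\<^sub>L S = id_blinfun - P"
    and z: "norm z \<le> 1" "z \<noteq> 1"
  shows "T z - (P o\<^sub>L T z) = S - (S o\<^sub>L (D z o\<^sub>L T z))" (is ?left)
    and "T z - (T z o\<^sub>L P) = S - (T z o\<^sub>L (D z o\<^sub>L S))" (is ?right)
    and "(1 - pgf z) * lc (T z x) = lc x - lc (D z ((T z - (P o\<^sub>L T z)) x))" (is ?scalar)
proof -
  have T: "T z o\<^sub>L (id_blinfun - R z) = id_blinfun" "(id_blinfun - R z) o\<^sub>L T z = id_blinfun"
    using inverse_of_T[OF z] by (auto simp: inverse_of_def)
  have split: "id_blinfun - R z = (id_blinfun - R 1) + D z" by (simp add: D_def)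
  have "S o\<^sub>L ((id_blinfun - R z) o\<^sub>L T z) = ((S o\<^sub>L (id_blinfun - R 1)) + (S o\<^sub>L D z)) o\<^sub>L T z"
    unfolding split by (simp add: blinfun_compose_distribs blinfun_compose_assoc)
  then have "S = T z - (P o\<^sub>L T z) + (S o\<^sub>L (D z o\<^sub>L T z))"
    unfolding S T by (simp add: blinfun_compose_distribs blinfun_compose_assoc)
  then show ?left by (simp add: algebra_simps)
  have "(T z o\<^sub>L (id_blinfun - R z)) o\<^sub>L S = T z o\<^sub>L (((id_blinfun - R 1) o\<^sub>L S) + (D z o\<^sub>L S))"
    unfolding split by (simp add: blinfun_compose_distribs blinfun_compose_assoc)
  then have "S = T z - (T z o\<^sub>L P) + (T z o\<^sub>L (D z o\<^sub>L S))"
    unfolding S T by (simp add: blinfun_compose_distribs)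
  then show ?right by (simp add: algebra_simps)
  have "lc x = lc (((id_blinfun - R z) o\<^sub>L T z) x)" unfolding T by simp
  also have "\<dots> = lc (D z (T z x))" using lc_D[OF z(1)] by simp
  also have "T z x = (T z - (P o\<^sub>L T z)) x + blinfun_apply (cscale (lc (T z x))) ehat"
    by (simp add: blinfun.diff_left rank_one_apply)
  also have "lc (D z ((T z - (P o\<^sub>L T z)) x + blinfun_apply (cscale (lc (T z x))) ehat))
      = lc (D z ((T z - (P o\<^sub>L T z)) x)) + lc (T z x) * (1 - pgf z)"
    by (simp only: blinfun.add_right D_cscale[OF z(1)] complex_functional_cscale lc_D_ehat[OF z(1)])
  finally show ?scalar by (simp add: algebra_simps)
qed

text \<open>The decomposition bounds the component of \<open>T\<close> in the kernel of \<open>lc\<close> by \<open>1 + \<bar>D\<bar> \<bar>T\<bar>\<close>, and the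
  other component by \<open>(1 + \<bar>D\<bar> + \<bar>D\<bar>\<^sup>2 \<bar>T\<bar>) / \<bar>1 - p\<bar>\<close>, up to constants. With \<open>d = \<bar>1 - z\<bar> powr \<beta>\<close>, an upper
  bound for \<open>\<bar>D\<bar>\<close> and a lower bound for \<open>\<bar>1 - p\<bar>\<close>, this amounts to \<open>\<bar>T\<bar> \<le> C (1 + 1 / d + d \<bar>T\<bar>)\<close>, in
  which the last term is absorbed by the left-hand side where \<open>d\<close> is small.\<close>

lemma T_bound: "\<exists>C. \<forall>z. norm z < 1 \<longrightarrow> norm (T z) \<le> C * norm (1 - z) powr - \<beta>"
proof -
  obtain S where S: "S o\<^sub>L (id_blinfun - R 1) = id_blinfun - P" "(id_blinfun - R 1) o\<^sub>L S = id_blinfun - P"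
    using reduced_resolvent_exists[OF R_cscale simple R_1_ehat lc_R_1 complex_functional_cscale lc_ehat] by auto
  obtain c0 where c0: "0 < c0" "\<And>z. norm z < 1 \<Longrightarrow> c0 * norm (1 - z) powr \<beta> \<le> norm (1 - pgf z)"
    using one_minus_pgf_lower by blast
  obtain CD where CD: "0 \<le> CD" "symbol_with CD \<beta> \<beta> D" using D_symbol unfolding symbol_def by blast
  define s where "s = norm S"
  define M where "M = 4 * norm ehat * norm lc / c0"
  have M: "0 \<le> M" unfolding M_def using c0 by auto
  have s: "0 \<le> s" by (simp add: s_def)
  have self: "norm (T z) \<le> (s + M * CD * s) + M / d + (s * CD + M * CD * s * CD) * d * norm (T z)"
    if z: "norm z < 1" and d: "d = norm (1 - z) powr \<beta>" for z d
  proof (rule norm_blinfun_bound)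
    have dpos: "0 < d" using disc_distance_pos[OF z] by (simp add: d)
    have z1: "norm z \<le> 1" "z \<noteq> 1" using z by auto
    have D: "norm (D z) \<le> CD * d" using symbol_withD(1)[OF CD(2) z] by (simp add: d)
    let ?t = "norm (T z)"
    show "0 \<le> (s + M * CD * s) + M / d + (s * CD + M * CD * s * CD) * d * ?t"
      using M s CD dpos by (intro add_nonneg_nonneg mult_nonneg_nonneg divide_nonneg_pos) auto
    fix x
    have QT: "norm (T z - (P o\<^sub>L T z)) \<le> s + s * (CD * d * ?t)"
      unfolding T_decomposition(1)[OF S z1] s_def
      by (rule order_trans[OF norm_triangle_ineq4]) (intro add_mono order_refl norm_compose_le D)
    have QTx: "norm ((T z - (P o\<^sub>L T z)) x) \<le> (s + s * (CD * d * ?t)) * norm x"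
      using QT by (meson mult_right_mono norm_blinfun norm_ge_zero order_trans)
    have "norm (lc (D z ((T z - (P o\<^sub>L T z)) x))) \<le> norm lc * (norm (D z) * norm ((T z - (P o\<^sub>L T z)) x))"
      by (meson mult_left_mono norm_blinfun norm_ge_zero order_trans)
    also have "\<dots> \<le> norm lc * (CD * d * ((s + s * (CD * d * ?t)) * norm x))"
      using D QTx CD dpos by (intro mult_left_mono mult_mono) auto
    finally have lcD: "norm (lc (D z ((T z - (P o\<^sub>L T z)) x))) \<le> norm lc * (CD * d * ((s + s * (CD * d * ?t)) * norm x))" .
    have "c0 * d * norm (lc (T z x)) \<le> norm (1 - pgf z) * norm (lc (T z x))"
      using c0(2)[OF z] by (intro mult_right_mono) (auto simp: d)
    also have "\<dots> = norm (lc x - lc (D z ((T z - (P o\<^sub>L T z)) x)))"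
      unfolding norm_mult[symmetric] T_decomposition(3)[OF S z1] ..
    also have "\<dots> \<le> norm lc * norm x + norm lc * (CD * d * ((s + s * (CD * d * ?t)) * norm x))"
      by (rule order_trans[OF norm_triangle_ineq4]) (intro add_mono norm_blinfun lcD)
    finally have *: "c0 * d * norm (lc (T z x)) \<le> norm lc * norm x * (1 + CD * d * (s + s * (CD * d * ?t)))"
      by (simp add: algebra_simps)
    have "norm (P (T z x)) \<le> 4 * norm (lc (T z x)) * norm ehat"
      unfolding rank_one_apply by (meson mult_right_mono norm_blinfun norm_cscale_le norm_ge_zero order_trans)
    also have "\<dots> = (4 * norm ehat / (c0 * d)) * (c0 * d * norm (lc (T z x)))"
      using c0 dpos by simp
    also have "\<dots> \<le> (4 * norm ehat / (c0 * d)) * (norm lc * norm x * (1 + CD * d * (s + s * (CD * d * ?t))))"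
      using * c0 dpos by (intro mult_left_mono) auto
    also have "\<dots> = (M / d + M * CD * s + M * CD * s * CD * d * ?t) * norm x"
      using c0 dpos by (simp add: M_def field_simps)
    finally have PT: "norm (P (T z x)) \<le> (M / d + M * CD * s + M * CD * s * CD * d * ?t) * norm x" .
    have "T z x = (T z - (P o\<^sub>L T z)) x + P (T z x)" by (simp add: blinfun.diff_left)
    then have "norm (T z x) \<le> norm ((T z - (P o\<^sub>L T z)) x) + norm (P (T z x))"
      by (metis norm_triangle_ineq)
    also have "\<dots> \<le> (s + s * (CD * d * ?t)) * norm x + (M / d + M * CD * s + M * CD * s * CD * d * ?t) * norm x"
      using QTx PT by (rule add_mono)
    finally show "norm (T z x) \<le> ((s + M * CD * s) + M / d + (s * CD + M * CD * s * CD) * d * ?t) * norm x"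
      by (simp add: algebra_simps)
  qed
  define G where "G = 2 * (s * CD + M * CD * s * CD) + 1"
  have G: "0 < G" unfolding G_def using M s CD by (intro add_nonneg_pos mult_nonneg_nonneg add_nonneg_nonneg) auto
  define \<delta> where "\<delta> = (1 / G) powr (1 / \<beta>)"
  have \<delta>: "0 < \<delta>" "\<delta> powr \<beta> = 1 / G" unfolding \<delta>_def using G beta by (auto simp: powr_powr)
  obtain m where m: "0 < m" "\<And>z. norm z \<le> 1 \<Longrightarrow> \<delta> \<le> norm (1 - z) \<Longrightarrow> norm (T z) \<le> m"
    using T_bounded_away[OF \<delta>(1)] by blast
  show ?thesis
  proof (intro exI[of _ "max (4 * (s + M * CD * s) + 2 * M) (2 * m)"] allI impI)
    fix z :: complex assume z: "norm z < 1"
    define d where "d = norm (1 - z) powr \<beta>"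
    have dpos: "0 < d" using disc_distance_pos[OF z] by (simp add: d_def)
    have "d \<le> 2 powr \<beta>" unfolding d_def using disc_distance_le2[OF z] beta by (intro powr_mono2) auto
    also have "\<dots> \<le> 2 powr 1" using beta by (intro powr_mono) auto
    finally have d2: "d \<le> 2" by simp
    have "norm (T z) \<le> max (4 * (s + M * CD * s) + 2 * M) (2 * m) / d"
    proof (cases "norm (1 - z) < \<delta>")
      case True
      have "d \<le> 1 / G" unfolding d_def \<delta>(2)[symmetric] using True beta by (intro powr_mono2) auto
      then have "G * d \<le> 1" using G by (simp add: field_simps)
      then have "2 * ((s * CD + M * CD * s * CD) * d) \<le> 1"
        using dpos by (simp add: G_def algebra_simps)
      then have "(s * CD + M * CD * s * CD) * d * norm (T z) \<le> 1 / 2 * norm (T z)"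
        by (intro mult_right_mono) auto
      then have "norm (T z) \<le> (s + M * CD * s) + M / d + 1 / 2 * norm (T z)"
        by (rule order_trans[OF self[OF z d_def] add_left_mono])
      moreover have "t \<le> 2 * x" if "t \<le> x + 1 / 2 * t" for t x :: real using that by linarith
      ultimately have "norm (T z) \<le> 2 * ((s + M * CD * s) + M / d)" by blast
      also have "\<dots> = 2 * (s + M * CD * s) + 2 * (M / d)" by (rule distrib_left)
      finally have "norm (T z) \<le> 2 * (s + M * CD * s) + 2 * (M / d)" .
      also have "\<dots> \<le> 2 * (s + M * CD * s) * (2 / d) + 2 * (M / d)"
        using d2 dpos s M CD mult_left_mono[of 1 "2 / d" "2 * (s + M * CD * s)"] by simp
      also have "\<dots> = (4 * (s + M * CD * s) + 2 * M) / d" using dpos by (simp add: field_simps)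
      also have "\<dots> \<le> max (4 * (s + M * CD * s) + 2 * M) (2 * m) / d"
        using dpos by (intro divide_right_mono) auto
      finally show ?thesis .
    next
      case False
      then have "norm (T z) \<le> m * 1" using m(2)[of z] z by auto
      also have "\<dots> \<le> m * (2 / d)" using m(1) d2 dpos by (intro mult_left_mono) auto
      also have "\<dots> = 2 * m / d" by simp
      also have "\<dots> \<le> max (4 * (s + M * CD * s) + 2 * M) (2 * m) / d"
        using dpos by (intro divide_right_mono) auto
      finally show ?thesis .
    qed
    then show "norm (T z) \<le> max (4 * (s + M * CD * s) + 2 * M) (2 * m) * norm (1 - z) powr - \<beta>"
      by (simp add: d_def powr_minus_divide)
  qed
qed

lemma T_symbol: "symbol \<beta> (- \<beta>) T"
proof -
  obtain C where C: "\<And>z. norm z < 1 \<Longrightarrow> norm (T z) \<le> C * norm (1 - z) powr - \<beta>"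
    using T_bound by blast
  show ?thesis
  proof (rule symbol_resolvent[OF bounded_bilinear_blinfun_compose bounded_bilinear_blinfun_compose D_symbol])
    fix z z' :: complex assume z: "norm z < 1" "norm z' < 1"
    then have "T z - T z' = (T z o\<^sub>L ((id_blinfun - R z') - (id_blinfun - R z))) o\<^sub>L T z'"
      by (intro inverse_of_diff inverse_of_T) auto
    then show "T z - T z' = (T z o\<^sub>L (D z' - D z)) o\<^sub>L T z'" by (simp add: D_def)
  qed (use C in auto)
qed

text \<open>Up to a function of order \<open>0\<close> the resolvent is the scalar renewal function times the
  projection. By the decomposition, the components of \<open>T\<close> with a factor \<open>1 - P\<close> on either side have
  order \<open>0\<close>, since \<open>D\<close> has order \<open>\<beta>\<close> and \<open>T\<close> has order \<open>- \<beta>\<close>; and \<open>P T P\<close> is \<open>P\<close> times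
  \<open>(1 - lc (D (1 - P) T ehat)) / (1 - p)\<close>.\<close>

theorem T_singular_part: "symbol \<beta> 0 (\<lambda>z. T z - (cscale (1 / (1 - pgf z)) o\<^sub>L P))"
proof -
  obtain S where S: "S o\<^sub>L (id_blinfun - R 1) = id_blinfun - P" "(id_blinfun - R 1) o\<^sub>L S = id_blinfun - P"
    using reduced_resolvent_exists[OF R_cscale simple R_1_ehat lc_R_1 complex_functional_cscale lc_ehat] by auto
  note compose = symbol_bilinear[OF bounded_bilinear_blinfun_compose]
  define QT where "QT z = S - (S o\<^sub>L (D z o\<^sub>L T z))" for z
  define TQ where "TQ z = S - (T z o\<^sub>L (D z o\<^sub>L S))" for z
  have QT: "symbol \<beta> 0 QT"
    using symbol_diff[OF symbol_const, of \<beta> "\<lambda>z. S o\<^sub>L (D z o\<^sub>L T z)" S]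
      compose[OF symbol_const[of \<beta> S] compose[OF D_symbol T_symbol]]
    by (simp add: QT_def[abs_def])
  have TQ: "symbol \<beta> 0 TQ"
    using symbol_diff[OF symbol_const, of \<beta> "\<lambda>z. T z o\<^sub>L (D z o\<^sub>L S)" S]
      compose[OF T_symbol compose[OF D_symbol symbol_const[of \<beta> S]]]
    by (simp add: TQ_def[abs_def])
  define \<tau> where "\<tau> z = lc ((D z o\<^sub>L QT z) ehat) * (1 / (1 - pgf z))" for z
  have "bounded_linear (\<lambda>A. lc (blinfun_apply A ehat))"
    by (rule bounded_linear_compose[OF blinfun.bounded_linear_right blinfun.bounded_linear_left])
  from symbol_linear[OF this compose[OF D_symbol QT]]
  have "symbol \<beta> \<beta> (\<lambda>z. lc ((D z o\<^sub>L QT z) ehat))" by simp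
  from symbol_mult[OF this renewal_symbol] have \<tau>: "symbol \<beta> 0 \<tau>" by (simp add: \<tau>_def[abs_def])
  have "symbol \<beta> 0 (\<lambda>z. QT z + (P o\<^sub>L TQ z) - (cscale (\<tau> z) o\<^sub>L P))"
    using compose[OF symbol_const TQ, of P] compose[OF symbol_linear[OF bounded_linear_cscale \<tau>] symbol_const[of \<beta> P]]
    by (intro symbol_add symbol_diff QT) simp_all
  moreover have "QT z + (P o\<^sub>L TQ z) - (cscale (\<tau> z) o\<^sub>L P) = T z - (cscale (1 / (1 - pgf z)) o\<^sub>L P)"
    if z: "norm z < 1" for z
  proof -
    have z1: "norm z \<le> 1" "z \<noteq> 1" using z by auto
    have QT': "QT z = T z - (P o\<^sub>L T z)" and TQ': "TQ z = T z - (T z o\<^sub>L P)"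
      unfolding QT_def TQ_def T_decomposition(1,2)[OF S z1] by auto
    have "1 - pgf z \<noteq> 0" using pgf_neq_1[OF z1] by simp
    then have "lc (T z ehat) = 1 / (1 - pgf z) - \<tau> z"
      using T_decomposition(3)[OF S z1, of ehat] lc_ehat
      unfolding QT'[symmetric] \<tau>_def by (simp add: field_simps)
    then have PTP: "(P o\<^sub>L T z) o\<^sub>L P = (cscale (1 / (1 - pgf z)) o\<^sub>L P) - (cscale (\<tau> z) o\<^sub>L P)"
    proof (intro blinfun_eqI)
      fix x
      assume *: "lc (T z ehat) = 1 / (1 - pgf z) - \<tau> z"
      have "T z o\<^sub>L cscale w = cscale w o\<^sub>L T z" for w
        by (rule inverse_of_commute[OF inverse_of_T[OF z1]])
          (simp add: blinfun_compose_distribs R_cscale[OF z1(1)])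
      then have "T z (blinfun_apply (cscale (lc x)) ehat) = cscale (lc x) (T z ehat)"
        by (metis blinfun_apply_blinfun_compose)
      then have "blinfun_apply ((P o\<^sub>L T z) o\<^sub>L P) x = blinfun_apply (cscale (lc x * lc (T z ehat))) ehat"
        by (simp add: rank_one_apply complex_functional_cscale)
      also have "\<dots> = blinfun_apply (cscale (lc (T z ehat) * lc x)) ehat" by (simp add: mult.commute)
      also have "\<dots> = blinfun_apply ((cscale (1 / (1 - pgf z)) o\<^sub>L P) - (cscale (\<tau> z) o\<^sub>L P)) x"
        unfolding * left_diff_distrib cscale_diff cscale_mult blinfun.diff_left
        by (simp add: rank_one_apply)
      finally show "blinfun_apply ((P o\<^sub>L T z) o\<^sub>L P) x
          = blinfun_apply ((cscale (1 / (1 - pgf z)) o\<^sub>L P) - (cscale (\<tau> z) o\<^sub>L P)) x" .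
    qed
    have "P o\<^sub>L TQ z = (P o\<^sub>L T z) - ((P o\<^sub>L T z) o\<^sub>L P)"
      unfolding TQ' by (simp add: blinfun_compose_distribs blinfun_compose_assoc)
    then show ?thesis unfolding QT' PTP by simp
  qed
  ultimately show ?thesis by (rule symbol_cong[rotated])
qed

end


context operator_renewal
begin

text \<open>The generating function \<open>G\<close> of the functionals \<open>t n\<close> satisfies \<open>G = t 0 + G R\<close> by the renewal
  equation, so \<open>G = t 0 (1 - R)\<^sup>-\<^sup>1\<close>.\<close>

lemma renewal_generating_function:
  fixes t :: "nat \<Rightarrow> 'b \<Rightarrow>\<^sub>L real"
  assumes bound: "\<And>n. norm (t n) \<le> B"
    and renewal: "\<And>n v. 1 \<le> n \<Longrightarrow> t n v = (\<Sum>k=1..n. t (n - k) (Rn k v))"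
    and z: "norm z < 1"
  shows "(\<lambda>n. complex_functional (t n) x * z ^ n) sums complex_functional (t 0) (T z x)"
proof -
  define tc where "tc n = complex_functional (t n)" for n
  have B: "0 \<le> B" using bound[of 0] norm_ge_zero[of "t 0"] by linarith
  have tc_le: "norm (tc n x) \<le> 2 * B * norm x" for n x
  proof -
    have "norm (tc n) \<le> 2 * B" unfolding tc_def
      using norm_complex_functional_le[of "t n"] bound[of n] by linarith
    then show ?thesis by (meson mult_right_mono norm_blinfun norm_ge_zero order_trans)
  qed
  have geo: "summable (\<lambda>n. norm z ^ n)" using z by simp
  have abs_summ: "summable (\<lambda>n. norm (tc n x * z ^ n))" for x
  proof (rule summable_comparison_test'[where N = 0])
    show "summable (\<lambda>n. 2 * B * norm x * norm z ^ n)" using geo by (rule summable_mult)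
    show "norm (norm (tc n x * z ^ n)) \<le> 2 * B * norm x * norm z ^ n" for n
      using tc_le[of n x] by (simp add: norm_mult norm_power mult_right_mono)
  qed
  define G where "G x = (\<Sum>n. tc n x * z ^ n)" for x
  have G: "(\<lambda>n. tc n x * z ^ n) sums G x" for x
    unfolding G_def by (rule summable_sums[OF summable_norm_cancel[OF abs_summ]])
  have partial_le: "norm (\<Sum>n<m. tc n x * z ^ n) \<le> 2 * B / (1 - norm z) * norm x" for m x
  proof -
    have "norm (\<Sum>n<m. tc n x * z ^ n) \<le> (\<Sum>n<m. 2 * B * norm x * norm z ^ n)"
      using tc_le by (intro sum_norm_le) (simp add: norm_mult norm_power mult_right_mono)
    also have "\<dots> = 2 * B * norm x * (\<Sum>n<m. norm z ^ n)" by (simp add: sum_distrib_left)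
    also have "\<dots> \<le> 2 * B * norm x * (\<Sum>n. norm z ^ n)"
      using B geo by (intro mult_left_mono sum_le_suminf) auto
    also have "\<dots> = 2 * B / (1 - norm z) * norm x" using z by (simp add: suminf_geometric)
    finally show ?thesis .
  qed
  have G_le: "norm (G x) \<le> norm x * (2 * B / (1 - norm z))" for x
    using G[of x] unfolding sums_def
    by (intro LIMSEQ_le_const2[OF tendsto_norm, of "\<lambda>m. \<Sum>n<m. tc n x * z ^ n"])
      (use partial_le in \<open>auto simp: mult.commute\<close>)
  have G_linear: "bounded_linear G"
  proof (rule bounded_linear_intro[OF _ _ G_le])
    show "G (x + y) = G x + G y" for x y
      using sums_unique2[OF G[of "x + y"]] sums_add[OF G[of x] G[of y]]
      by (simp add: blinfun.add_right distrib_right)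
    show "G (r *\<^sub>R x) = r *\<^sub>R G x" for r x
      using sums_unique2[OF G[of "r *\<^sub>R x"]] bounded_linear.sums[OF bounded_linear_scaleR_right G[of x], of r]
      by (simp add: blinfun.scaleR_right)
  qed
  have z1: "norm z \<le> 1" "z \<noteq> 1" using z by auto
  have key: "G y = tc 0 y + G (R z y)" for y
  proof -
    define A where "A k = (if k = 0 then 0 else blinfun_apply (complexify (Rn k)) y)" for k
    have Rterm: "blinfun_apply (Rterm k z) y = blinfun_apply (cscale (z ^ k)) (A k)" for k
      by (simp add: Rterm_def A_def)
    have tc_cscale: "tc n (blinfun_apply (cscale w) y) = w * tc n y" for n w y
      unfolding tc_def by (rule complex_functional_cscale)
    have G_cscale: "G (blinfun_apply (cscale w) y) = w * G y" for w y
      using sums_unique2[OF G[of "blinfun_apply (cscale w) y"]] sums_mult[OF G[of y], of w]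
      by (simp add: tc_cscale mult.assoc)
    have A_le: "norm (A k) \<le> 2 * C0 * norm y * p k" for k
    proof (cases "k = 0")
      case False
      have "norm (complexify (Rn k)) \<le> 2 * (C0 * p k)"
        using norm_complexify_le[of "Rn k"] Rn_bound[of k] False by simp
      then have "norm (blinfun_apply (complexify (Rn k)) y) \<le> 2 * (C0 * p k) * norm y"
        by (meson mult_right_mono norm_blinfun norm_ge_zero order_trans)
      then show ?thesis using False by (simp add: A_def mult_ac)
    qed (simp add: A_def p_0)
    \<comment> \<open>The renewal equation, multiplied by \<open>z ^ n\<close> and summed over \<open>n \<le> N\<close>, is a sum over the first
      return time \<open>k\<close>; the limit \<open>N \<longlonglongrightarrow> \<infinity>\<close> is taken in each term, under a summable bound.\<close>
    define a where "a k N = (if k \<le> N then z ^ k * (\<Sum>m<Suc N - k. tc m (A k) * z ^ m) else 0)" for k N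
    have a_sum: "(\<Sum>k. a k N) = (\<Sum>n<Suc N. tc n y * z ^ n) - tc 0 y" for N
    proof -
      have "(\<Sum>k. a k N) = (\<Sum>k\<le>N. a k N)" by (rule suminf_finite) (auto simp: a_def)
      also have "\<dots> = (\<Sum>k\<le>N. \<Sum>m\<le>N - k. tc m (A k) * z ^ (k + m))"
        unfolding a_def by (intro sum.cong refl)
          (auto simp: sum_distrib_left power_add mult_ac Suc_diff_le lessThan_Suc_atMost)
      also have "\<dots> = (\<Sum>(k, m)\<in>(SIGMA k:{..N}. {..N - k}). tc m (A k) * z ^ (k + m))"
        by (rule sum.Sigma) auto
      also have "\<dots> = (\<Sum>(n, k)\<in>(SIGMA n:{..N}. {..n}). tc (n - k) (A k) * z ^ n)"
        by (rule sum.reindex_bij_witness[of _ "\<lambda>(n, k). (k, n - k)" "\<lambda>(k, m). (k + m, k)"]) auto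
      also have "\<dots> = (\<Sum>n\<le>N. \<Sum>k\<le>n. tc (n - k) (A k) * z ^ n)"
        by (rule sum.Sigma[symmetric]) auto
      also have "\<dots> = (\<Sum>n\<le>N. (if n = 0 then 0 else tc n y * z ^ n))"
      proof (rule sum.cong[OF refl])
        fix n
        show "(\<Sum>k\<le>n. tc (n - k) (A k) * z ^ n) = (if n = 0 then 0 else tc n y * z ^ n)"
        proof (cases "n = 0")
          case False
          have "{..n} = insert 0 {1..n}" by auto
          then have "(\<Sum>k\<le>n. tc (n - k) (A k)) = (\<Sum>k=1..n. tc (n - k) (A k))"
            by (simp add: A_def)
          also have "\<dots> = (\<Sum>k=1..n. of_real (t (n - k) (Rn k (fst y))) + \<i> * of_real (t (n - k) (Rn k (snd y))))"
            by (rule sum.cong) (auto simp: A_def tc_def complex_functional_apply complexify_apply)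
          also have "\<dots> = of_real (\<Sum>k=1..n. t (n - k) (Rn k (fst y))) + \<i> * of_real (\<Sum>k=1..n. t (n - k) (Rn k (snd y)))"
            by (simp add: sum.distrib sum_distrib_left)
          also have "\<dots> = of_real (t n (fst y)) + \<i> * of_real (t n (snd y))"
            using False renewal[of n "fst y"] renewal[of n "snd y"] by simp
          also have "\<dots> = tc n y" by (simp add: tc_def complex_functional_apply)
          finally show ?thesis using False by (simp add: sum_distrib_right[symmetric])
        qed (simp add: A_def)
      qed
      also have "\<dots> = (\<Sum>n<Suc N. tc n y * z ^ n) - tc 0 y"
      proof -
        have "{..N} = insert 0 {1..N}" "{..<Suc N} = insert 0 {1..N}" by auto
        then show ?thesis by simp
      qed
      finally show ?thesis .
    qed
    have "(\<lambda>N. \<Sum>k. a k N) \<longlonglongrightarrow> (\<Sum>k. z ^ k * G (A k))"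
    proof -
      have M: "summable (\<lambda>k. 2 * B / (1 - norm z) * (2 * C0 * norm y) * p k)"
        using p_summable by (rule summable_mult)
      have "eventually (\<lambda>(k, N). norm (a k N) \<le> 2 * B / (1 - norm z) * (2 * C0 * norm y) * p k)
         (sequentially \<times>\<^sub>F sequentially)"
      proof (rule always_eventually, clarify)
        fix k N
        have nonneg: "0 \<le> 2 * B / (1 - norm z)" using B z by (intro divide_nonneg_nonneg) auto
        show "norm (a k N) \<le> 2 * B / (1 - norm z) * (2 * C0 * norm y) * p k"
        proof (cases "k \<le> N")
          case True
          have "norm (a k N) = norm z ^ k * norm (\<Sum>m<Suc N - k. tc m (A k) * z ^ m)"
            using True by (simp add: a_def norm_mult norm_power)
          also have "\<dots> \<le> 1 * (2 * B / (1 - norm z) * norm (A k))"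
            using z1 by (intro mult_mono power_le_one partial_le) auto
          also have "\<dots> \<le> 1 * (2 * B / (1 - norm z) * (2 * C0 * norm y * p k))"
            using nonneg A_le by (intro mult_left_mono) auto
          finally show ?thesis by (simp add: mult.assoc)
        next
          case False
          have "0 \<le> 2 * B / (1 - norm z) * (2 * C0 * norm y) * p k"
            using nonneg C0 p_nonneg[of k] by (intro mult_nonneg_nonneg) auto
          then show ?thesis using False by (simp only: a_def if_False norm_zero)
        qed
      qed
      moreover have "(\<lambda>N. a k N) \<longlonglongrightarrow> z ^ k * G (A k)" for k
      proof -
        have "(\<lambda>N. \<Sum>m<N. tc m (A k) * z ^ m) \<longlonglongrightarrow> G (A k)" using G unfolding sums_def .
        moreover have "filterlim (\<lambda>N. Suc N - k) at_top sequentially"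
          by (rule filterlim_at_top_mono[OF filterlim_minus_const_nat_at_top[of k]]) (rule always_eventually, simp add: diff_le_mono)
        ultimately have "(\<lambda>N. \<Sum>m<Suc N - k. tc m (A k) * z ^ m) \<longlonglongrightarrow> G (A k)"
          by (rule filterlim_compose)
        then have "(\<lambda>N. z ^ k * (\<Sum>m<Suc N - k. tc m (A k) * z ^ m)) \<longlonglongrightarrow> z ^ k * G (A k)"
          by (intro tendsto_intros)
        then show ?thesis
          by (rule Lim_transform_eventually)
            (auto simp: eventually_sequentially a_def intro!: exI[of _ k])
      qed
      ultimately show ?thesis using tannerys_theorem[OF _ _ M, of a] by simp
    qed
    moreover have "(\<lambda>N. \<Sum>k. a k N) \<longlonglongrightarrow> G y - tc 0 y"
      unfolding a_sum using G[of y, unfolded sums_def] by (intro tendsto_intros LIMSEQ_Suc)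
    ultimately have "G y - tc 0 y = (\<Sum>k. z ^ k * G (A k))" using LIMSEQ_unique by blast
    also have "\<dots> = G (R z y)"
      using bounded_linear.sums[OF G_linear R_apply_sums[OF z1(1), of y]]
      by (simp add: Rterm G_cscale sums_iff)
    finally show ?thesis by (simp add: algebra_simps)
  qed
  have "G (T z x) = tc 0 (T z x) + G (R z (T z x))" by (rule key)
  moreover have "T z x = x + R z (T z x)"
  proof -
    have "blinfun_apply ((id_blinfun - R z) o\<^sub>L T z) x = x"
      using inverse_of_T[OF z1] by (simp add: inverse_of_def)
    then show ?thesis by (simp add: blinfun.diff_left algebra_simps)
  qed
  then have "G (T z x) = G x + G (R z (T z x))"
    by (metis bounded_linear.linear[OF G_linear] linear_add)
  ultimately have "G x = tc 0 (T z x)" by simp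
  then show ?thesis using G[of x] by (simp add: tc_def)
qed

definition renewal_solution :: "(nat \<Rightarrow> 'b \<Rightarrow>\<^sub>L real) \<Rightarrow> bool" where
  "renewal_solution t \<longleftrightarrow> (\<exists>B. \<forall>n. norm (t n) \<le> B) \<and>
     (\<forall>n v. 1 \<le> n \<longrightarrow> blinfun_apply (t n) v = (\<Sum>k=1..n. t (n - k) (Rn k v)))"

text \<open>The generating function of \<open>t n v - u n * l v * t 0 e\<close> is a functional of
  \<open>T - P / (1 - p)\<close>, which has order \<open>0\<close>, hence also the lower order \<open>\<kappa> - 1\<close> to which the coefficient
  bound applies.\<close>

theorem operator_renewal_coefficients:
  "\<exists>C\<ge>0. \<forall>t v n. renewal_solution t \<longrightarrow> 1 \<le> n \<longrightarrow>
     \<bar>blinfun_apply (t n) v - u n * l v * t 0 e\<bar> \<le> C * norm (t 0) * norm v * real n powr - \<kappa>"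
proof -
  have \<kappa>: "0 < \<kappa>" "\<kappa> < \<beta>" "\<kappa> \<le> 1" using beta by auto
  define A where "A z = T z - (cscale (1 / (1 - pgf z)) o\<^sub>L P)" for z
  have "symbol \<beta> (\<kappa> - 1) A"
    unfolding A_def by (rule symbol_weaken[OF T_singular_part]) (use \<kappa> in auto)
  then obtain CA where CA: "0 \<le> CA" "symbol_with CA \<beta> (\<kappa> - 1) A" unfolding symbol_def by blast
  obtain L where L: "0 \<le> L" "\<And>C F f n. (\<And>z. norm z < 1 \<Longrightarrow> (\<lambda>k. f k * z ^ k) sums F z) \<Longrightarrow>
      symbol_with C \<beta> (\<kappa> - 1) F \<Longrightarrow> 1 \<le> n \<Longrightarrow> norm (f n) \<le> L * C * real n powr - \<kappa>"
    using power_series_coefficient_bound[OF \<kappa>(1,2)] by blast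
  show ?thesis
  proof (intro exI[of _ "L * (2 * CA)"] conjI allI impI)
    fix t :: "nat \<Rightarrow> 'b \<Rightarrow>\<^sub>L real" and v :: 'b and n :: nat
    assume "renewal_solution t" and n: "1 \<le> n"
    then obtain B where bound: "\<And>n. norm (t n) \<le> B"
      and renewal: "\<And>n v. 1 \<le> n \<Longrightarrow> blinfun_apply (t n) v = (\<Sum>k=1..n. t (n - k) (Rn k v))"
      unfolding renewal_solution_def by blast
    define x where "x = (v, 0 :: 'b)"
    define tc where "tc = complex_functional (t 0)"
    have tcx: "complex_functional (t n) x = of_real (t n v)" for n
      by (simp add: complex_functional_apply x_def)
    have lcx: "lc x = of_real (l v)" by (simp add: complex_functional_apply x_def)
    have tce: "tc ehat = of_real (t 0 e)" by (simp add: tc_def complex_functional_apply)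
    have "norm (of_real (t n v - u n * l v * t 0 e) :: complex) \<le> L * (CA * (2 * norm (t 0) * norm v)) * real n powr - \<kappa>"
    proof (rule L(2)[OF _ _ n])
      fix z :: complex assume z: "norm z < 1"
      have "(\<lambda>k. of_real (t k v) * z ^ k) sums tc (T z x)"
        using renewal_generating_function[OF bound renewal z, of x] by (simp add: tcx tc_def)
      moreover have "(\<lambda>k. of_real (l v * t 0 e) * (of_real (u k) * z ^ k)) sums (of_real (l v * t 0 e) * (1 / (1 - pgf z)))"
        using u_sums[OF z] by (rule sums_mult)
      ultimately have "(\<lambda>k. of_real (t k v) * z ^ k - of_real (l v * t 0 e) * (of_real (u k) * z ^ k))
          sums (tc (T z x) - of_real (l v * t 0 e) * (1 / (1 - pgf z)))"
        by (rule sums_diff)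
      moreover have "of_real (t k v) * z ^ k - of_real (l v * t 0 e) * (of_real (u k) * z ^ k)
          = of_real (t k v - u k * l v * t 0 e) * z ^ k" for k
        by (simp add: algebra_simps)
      moreover have "tc (T z x) - of_real (l v * t 0 e) * (1 / (1 - pgf z)) = tc (A z x)"
        by (simp add: A_def blinfun.diff_left blinfun.diff_right rank_one_apply tc_def
            complex_functional_cscale lcx tce[unfolded tc_def])
      ultimately show "(\<lambda>k. of_real (t k v - u k * l v * t 0 e) * z ^ k) sums tc (A z x)" by simp
    next
      have le: "norm (tc (blinfun_apply X x)) \<le> norm X * (2 * norm (t 0) * norm v)" for X
      proof -
        have "norm (tc (blinfun_apply X x)) \<le> norm tc * (norm X * norm x)"
          by (meson mult_left_mono norm_blinfun norm_ge_zero order_trans)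
        also have "\<dots> \<le> (2 * norm (t 0)) * (norm X * norm x)"
          unfolding tc_def by (intro mult_right_mono norm_complex_functional_le) auto
        also have "norm x = norm v" by (simp add: x_def)
        finally show ?thesis by (simp add: mult_ac)
      qed
      show "symbol_with (CA * (2 * norm (t 0) * norm v)) \<beta> (\<kappa> - 1) (\<lambda>z. tc (A z x))"
      proof (rule symbol_withI)
        fix z :: complex assume z: "norm z < 1"
        have "norm (tc (A z x)) \<le> norm (A z) * (2 * norm (t 0) * norm v)" by (rule le)
        also have "\<dots> \<le> CA * norm (1 - z) powr (\<kappa> - 1) * (2 * norm (t 0) * norm v)"
          by (rule mult_right_mono[OF symbol_withD(1)[OF CA(2) z]]) auto
        finally show "norm (tc (A z x)) \<le> CA * (2 * norm (t 0) * norm v) * norm (1 - z) powr (\<kappa> - 1)"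
          by (simp only: mult_ac)
      next
        fix z z' :: complex
        assume z: "norm z < 1" "norm z' < 1" "norm (1 - z) \<le> 9 * norm (1 - z')"
          "norm (1 - z') \<le> 9 * norm (1 - z)"
        have "norm (tc (A z x) - tc (A z' x)) = norm (tc ((A z - A z') x))"
          by (simp add: blinfun.diff_left blinfun.diff_right)
        also have "\<dots> \<le> norm (A z - A z') * (2 * norm (t 0) * norm v)" by (rule le)
        also have "\<dots> \<le> CA * norm (z - z') powr \<beta> * norm (1 - z) powr (\<kappa> - 1 - \<beta>) * (2 * norm (t 0) * norm v)"
          by (rule mult_right_mono[OF symbol_withD(2)[OF CA(2) z]]) auto
        finally show "norm (tc (A z x) - tc (A z' x))
           \<le> CA * (2 * norm (t 0) * norm v) * norm (z - z') powr \<beta> * norm (1 - z) powr (\<kappa> - 1 - \<beta>)"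
          by (simp only: mult_ac)
      qed
    qed
    then show "\<bar>t n v - u n * l v * t 0 e\<bar> \<le> L * (2 * CA) * norm (t 0) * norm v * real n powr - \<kappa>"
      unfolding norm_of_real by (simp only: mult_ac)
  qed (use L CA in auto)
qed

end


section \<open>First returns\<close>

lemma less_return_time_iff: "enat n < return_time f Y y \<longleftrightarrow> (\<forall>k. 1 \<le> k \<and> k \<le> n \<longrightarrow> (f ^^ k) y \<notin> Y)"
proof -
  have "enat n < return_time f Y y \<longleftrightarrow> enat (Suc n) \<le> return_time f Y y" by (simp add: Suc_ile_eq)
  also have "\<dots> \<longleftrightarrow> (\<forall>k. 1 \<le> k \<and> (f ^^ k) y \<in> Y \<longrightarrow> Suc n \<le> k)"
    unfolding return_time_def le_INF_iff by auto
  also have "\<dots> \<longleftrightarrow> (\<forall>k. 1 \<le> k \<and> k \<le> n \<longrightarrow> (f ^^ k) y \<notin> Y)" by (auto simp: not_le[symmetric])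
  finally show ?thesis .
qed

lemma return_time_eq_iff:
  "return_time f Y y = enat n \<longleftrightarrow> 1 \<le> n \<and> (f ^^ n) y \<in> Y \<and> (\<forall>k. 1 \<le> k \<and> k < n \<longrightarrow> (f ^^ k) y \<notin> Y)"
proof (cases n)
  case 0
  have "enat 0 < return_time f Y y" by (simp add: less_return_time_iff)
  then show ?thesis using 0 by auto
next
  case (Suc m)
  have "return_time f Y y = enat n \<longleftrightarrow> enat m < return_time f Y y \<and> \<not> enat n < return_time f Y y"
    using Suc by (cases "return_time f Y y") auto
  also have "\<dots> \<longleftrightarrow> 1 \<le> n \<and> (f ^^ n) y \<in> Y \<and> (\<forall>k. 1 \<le> k \<and> k < n \<longrightarrow> (f ^^ k) y \<notin> Y)"
    unfolding less_return_time_iff Suc by (auto simp: less_Suc_eq_le le_Suc_eq)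
  finally show ?thesis .
qed

lemma last_visit_eq_iff:
  assumes "y \<in> Y"
  shows "last_visit f Y n y = j \<longleftrightarrow> j \<le> n \<and> (f ^^ j) y \<in> Y \<and> enat (n - j) < return_time f Y ((f ^^ j) y)"
proof -
  have fin: "finite {j. j \<le> n \<and> (f ^^ j) y \<in> Y}" "{j. j \<le> n \<and> (f ^^ j) y \<in> Y} \<noteq> {}"
    using assms by (auto intro: exI[of _ 0])
  have "last_visit f Y n y = j \<longleftrightarrow> j \<le> n \<and> (f ^^ j) y \<in> Y \<and> (\<forall>i. j < i \<and> i \<le> n \<longrightarrow> (f ^^ i) y \<notin> Y)"
    unfolding last_visit_def using fin by (subst Max_eq_iff) (auto simp: not_le[symmetric])
  also have "\<dots> \<longleftrightarrow> j \<le> n \<and> (f ^^ j) y \<in> Y \<and> enat (n - j) < return_time f Y ((f ^^ j) y)"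
  proof (intro conj_cong refl)
    assume "j \<le> n"
    have "(\<forall>i. j < i \<and> i \<le> n \<longrightarrow> (f ^^ i) y \<notin> Y) \<longleftrightarrow> (\<forall>k. 1 \<le> k \<and> k \<le> n - j \<longrightarrow> (f ^^ (k + j)) y \<notin> Y)"
    proof (intro iffI allI impI)
      fix i assume *: "\<forall>k. 1 \<le> k \<and> k \<le> n - j \<longrightarrow> (f ^^ (k + j)) y \<notin> Y" "j < i \<and> i \<le> n"
      then have "(f ^^ ((i - j) + j)) y \<notin> Y" by (intro *(1)[rule_format]) auto
      then show "(f ^^ i) y \<notin> Y" using * by simp
    qed (use \<open>j \<le> n\<close> in auto)
    then show "(\<forall>i. j < i \<and> i \<le> n \<longrightarrow> (f ^^ i) y \<notin> Y) \<longleftrightarrow> enat (n - j) < return_time f Y ((f ^^ j) y)"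
      unfolding less_return_time_iff by (simp add: funpow_add)
  qed
  finally show ?thesis .
qed

locale first_return =
  fixes M :: "'a measure" and f :: "'a \<Rightarrow> 'a" and Y :: "'a set"
  assumes preserving: "measure_preserving_map M f"
    and Y: "Y \<in> sets M" "emeasure M Y = 1"
begin

abbreviation \<phi> :: "'a \<Rightarrow> enat" where "\<phi> \<equiv> return_time f Y"

abbreviation N :: "'a measure" where "N \<equiv> restrict_space M Y"

definition return_prob :: "nat \<Rightarrow> real" where "return_prob n = measure M {y \<in> Y. \<phi> y = enat n}"

definition return_tail :: "nat \<Rightarrow> real" where "return_tail n = measure M {y \<in> Y. \<phi> y > enat n}"

lemma f_measurable [measurable]: "f \<in> M \<rightarrow>\<^sub>M M"
  using preserving by (simp add: measure_preserving_map_def)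

lemma f_emeasure: "A \<in> sets M \<Longrightarrow> emeasure M (f -` A \<inter> space M) = emeasure M A"
  using preserving by (simp add: measure_preserving_map_def)

lemma Y_space: "Y \<subseteq> space M"
  using Y sets.sets_into_space by blast

lemma space_N: "space N = Y"
  using Y_space by (auto simp: space_restrict_space)

lemma sets_N: "A \<in> sets N \<longleftrightarrow> A \<in> sets M \<and> A \<subseteq> Y"
  using Y by (subst sets_restrict_space_iff) auto

lemma measure_N: "A \<subseteq> Y \<Longrightarrow> measure N A = measure M A"
  using Y by (intro measure_restrict_space) auto

lemma emeasure_N: "A \<subseteq> Y \<Longrightarrow> emeasure N A = emeasure M A"
  using Y by (intro emeasure_restrict_space) auto

lemma prob_space_N: "prob_space N"
  by (rule prob_spaceI) (simp add: space_N emeasure_N Y)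

lemma emeasure_finite: "A \<subseteq> Y \<Longrightarrow> emeasure M A \<noteq> \<infinity>"
  using emeasure_mono[of A Y M] Y by (auto simp: top_unique)

lemma pow_measurable [measurable]: "(f ^^ n) \<in> M \<rightarrow>\<^sub>M M"
  by (induction n) auto

lemma pow_measurable_N [measurable]: "(f ^^ n) \<in> N \<rightarrow>\<^sub>M M"
  by (rule measurable_restrict_space1[OF pow_measurable])

lemma Y_measurable [measurable]: "Y \<in> sets M" by (rule Y)

lemma pow_vimage_sets: "A \<in> sets M \<Longrightarrow> {y \<in> Y. (f ^^ n) y \<in> A} \<in> sets M"
proof -
  assume A: "A \<in> sets M"
  have "{y \<in> Y. (f ^^ n) y \<in> A} = Y \<inter> ((f ^^ n) -` A \<inter> space M)" using Y_space by auto
  then show ?thesis using A by (auto intro!: sets.Int measurable_sets[OF pow_measurable])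
qed

lemma tail_sets [measurable]: "{y \<in> Y. \<phi> y > enat n} \<in> sets M"
proof -
  have "{y \<in> Y. \<phi> y > enat n} = Y - (\<Union>k\<in>{1..n}. {y \<in> Y. (f ^^ k) y \<in> Y})"
    by (auto simp: less_return_time_iff)
  then show ?thesis using pow_vimage_sets[OF Y(1)] Y by auto
qed

lemma return_sets [measurable]: "{y \<in> Y. \<phi> y = enat n} \<in> sets M"
proof (cases n)
  case 0
  then have "{y \<in> Y. \<phi> y = enat n} = {}" by (auto simp: return_time_eq_iff)
  then show ?thesis by (simp only: sets.empty_sets)
next
  case (Suc m)
  have "{y \<in> Y. \<phi> y = enat n} = {y \<in> Y. \<phi> y > enat m} - {y \<in> Y. \<phi> y > enat n}"
    unfolding Suc by (auto simp: return_time_eq_iff less_return_time_iff le_Suc_eq less_Suc_eq_le)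
  then show ?thesis using tail_sets by auto
qed

lemma return_prob_0: "return_prob 0 = 0"
proof -
  have "{y \<in> Y. \<phi> y = enat 0} = {}" by (auto simp: return_time_eq_iff)
  then show ?thesis unfolding return_prob_def by (simp only: measure_empty)
qed

lemma return_tail_eq: "return_tail n = 1 - (\<Sum>k\<le>n. return_prob k)"
proof (induction n)
  case 0
  have "{y \<in> Y. \<phi> y > enat 0} = Y" by (auto simp: less_return_time_iff)
  then have "return_tail 0 = 1" using Y by (simp add: return_tail_def measure_def)
  then show ?case by (simp add: return_prob_0)
next
  case (Suc n)
  have eq: "{y \<in> Y. \<phi> y > enat n} = {y \<in> Y. \<phi> y = enat (Suc n)} \<union> {y \<in> Y. \<phi> y > enat (Suc n)}"
    by (auto simp: return_time_eq_iff less_return_time_iff le_Suc_eq less_Suc_eq_le)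
  have "return_tail n = return_prob (Suc n) + return_tail (Suc n)"
    unfolding return_tail_def return_prob_def eq
    by (rule measure_Union) (use emeasure_finite in auto)
  then show ?case using Suc by simp
qed

definition return_into :: "nat \<Rightarrow> 'a set \<Rightarrow> 'a set" where
  "return_into k A = {y \<in> Y. \<phi> y = enat k \<and> (f ^^ k) y \<in> A}"

lemma return_into_sets: "A \<in> sets M \<Longrightarrow> return_into k A \<in> sets M"
proof -
  assume "A \<in> sets M"
  moreover have "return_into k A = {y \<in> Y. \<phi> y = enat k} \<inter> {y \<in> Y. (f ^^ k) y \<in> A}"
    by (auto simp: return_into_def)
  ultimately show ?thesis using sets.Int[OF return_sets pow_vimage_sets] by simp
qed

text \<open>The measure of \<open>A \<subseteq> Y\<close> is pulled back under \<open>f\<close> step by step; at each step the part of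
  the preimage in \<open>Y\<close> is made of points whose first return is to \<open>A\<close>, and the part outside \<open>Y\<close> is
  pulled back further.\<close>

lemma emeasure_first_return_decomposition:
  assumes A: "A \<in> sets M" "A \<subseteq> Y"
  shows "emeasure M A = (\<Sum>k=1..n. emeasure M (return_into k A))
     + emeasure M {x \<in> space M. (f ^^ n) x \<in> A \<and> (\<forall>k<n. (f ^^ k) x \<notin> Y)}"
proof (induction n)
  case 0
  have "{x \<in> space M. x \<in> A} = A" using A Y_space by auto
  then show ?case by simp
next
  case (Suc n)
  define E where "E n = {x \<in> space M. (f ^^ n) x \<in> A \<and> (\<forall>k<n. (f ^^ k) x \<notin> Y)}" for n
  have E_sets: "E n \<in> sets M" for n
  proof -
    have "E n = ((f ^^ n) -` A \<inter> space M) - (\<Union>k\<in>{..<n}. (f ^^ k) -` Y \<inter> space M)"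
      by (auto simp: E_def)
    then show ?thesis using A Y by (auto intro!: sets.Diff sets.finite_UN measurable_sets[OF pow_measurable])
  qed
  have pull: "f -` E n \<inter> space M = return_into (Suc n) A \<union> E (Suc n)"
  proof (rule set_eqI)
    fix x
    have shift: "(f ^^ k) (f x) = (f ^^ Suc k) x" for k by (simp add: funpow_swap1)
    have all: "(\<forall>k<n. (f ^^ Suc k) x \<notin> Y) \<longleftrightarrow> (\<forall>k. 1 \<le> k \<and> k < Suc n \<longrightarrow> (f ^^ k) x \<notin> Y)"
      by (metis One_nat_def Suc_le_D Suc_le_eq Suc_mono not_less_eq zero_less_Suc)
    have all': "(\<forall>k<Suc n. (f ^^ k) x \<notin> Y) \<longleftrightarrow> x \<notin> Y \<and> (\<forall>k. 1 \<le> k \<and> k < Suc n \<longrightarrow> (f ^^ k) x \<notin> Y)"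
      by (metis One_nat_def Suc_le_eq funpow_0 gr0I zero_less_Suc)
    have fx: "x \<in> space M \<Longrightarrow> f x \<in> space M" using measurable_space[OF f_measurable] .
    show "x \<in> f -` E n \<inter> space M \<longleftrightarrow> x \<in> return_into (Suc n) A \<union> E (Suc n)"
      unfolding E_def return_into_def return_time_eq_iff mem_Collect_eq vimage_eq Int_iff Un_iff shift all all'
      using Y_space A fx by auto
  qed
  have "emeasure M (E n) = emeasure M (return_into (Suc n) A \<union> E (Suc n))"
    unfolding pull[symmetric] by (rule f_emeasure[OF E_sets, symmetric])
  also have "\<dots> = emeasure M (return_into (Suc n) A) + emeasure M (E (Suc n))"
  proof (rule plus_emeasure[symmetric])
    show "return_into (Suc n) A \<inter> E (Suc n) = {}" by (force simp: E_def return_into_def)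
  qed (rule return_into_sets[OF A(1)] E_sets)+
  finally show ?case using Suc by (simp add: E_def[symmetric] add.assoc del: funpow.simps)
qed

lemma sum_return_into_le:
  assumes A: "A \<in> sets M" "A \<subseteq> Y"
  shows "(\<Sum>k=1..n. measure M (return_into k A)) \<le> measure M A"
proof -
  have "emeasure M (return_into k A) = ennreal (measure M (return_into k A))" for k
    using emeasure_finite[of "return_into k A"]
    by (intro emeasure_eq_ennreal_measure) (auto simp: return_into_def)
  then have "ennreal (\<Sum>k=1..n. measure M (return_into k A)) = (\<Sum>k=1..n. emeasure M (return_into k A))"
    by (simp add: sum_ennreal)
  also have "\<dots> \<le> emeasure M A"
    by (subst emeasure_first_return_decomposition[OF A, of n]) simp
  also have "\<dots> = ennreal (measure M A)" using A emeasure_finite by (intro emeasure_eq_ennreal_measure) auto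
  finally show ?thesis by simp
qed

text \<open>The inequality for \<open>A\<close> and for \<open>Y - A\<close> is an equality in the limit, as almost every point
  returns.\<close>

lemma return_map_preserving:
  assumes A: "A \<in> sets M" "A \<subseteq> Y" and lim: "return_tail \<longlonglongrightarrow> 0"
  shows "(\<lambda>n. measure M (return_into (Suc n) A)) sums measure M A"
proof -
  have le: "\<bar>(\<Sum>k<n. measure M (return_into (Suc k) A)) - measure M A\<bar> \<le> return_tail n" for n
  proof -
    have shift: "(\<Sum>k<n. measure M (return_into (Suc k) A)) = (\<Sum>k=1..n. measure M (return_into k A))" for A
      by (rule sum.reindex_bij_witness[of _ "\<lambda>k. k - 1" Suc]) auto
    have "(\<Sum>k=1..n. measure M (return_into k A)) + (\<Sum>k=1..n. measure M (return_into k (Y - A)))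
        = (\<Sum>k=1..n. return_prob k)"
      unfolding sum.distrib[symmetric]
    proof (rule sum.cong[OF refl])
      fix k assume k: "k \<in> {1..n}"
      have "{y \<in> Y. \<phi> y = enat k} = return_into k A \<union> return_into k (Y - A)"
        by (auto simp: return_into_def return_time_eq_iff)
      then have "return_prob k = measure M (return_into k A \<union> return_into k (Y - A))" by (simp add: return_prob_def)
      also have "\<dots> = measure M (return_into k A) + measure M (return_into k (Y - A))"
        using A Y by (intro measure_Union return_into_sets emeasure_finite) (auto simp: return_into_def)
      finally show "measure M (return_into k A) + measure M (return_into k (Y - A)) = return_prob k" by simp
    qed
    moreover have "(\<Sum>k\<le>n. return_prob k) = (\<Sum>k=1..n. return_prob k)"
    proof -
      have "{..n} = insert 0 {1..n}" by auto
      then show ?thesis by (simp add: return_prob_0)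
    qed
    moreover have "measure M A + measure M (Y - A) = 1"
    proof -
      have "measure M (A \<union> (Y - A)) = measure M A + measure M (Y - A)"
        using A Y by (intro measure_Union emeasure_finite) auto
      moreover have "A \<union> (Y - A) = Y" using A by auto
      ultimately show ?thesis using Y by (simp add: measure_def)
    qed
    moreover have "(\<Sum>k=1..n. measure M (return_into k (Y - A))) \<le> measure M (Y - A)"
      using A Y by (intro sum_return_into_le) auto
    ultimately show ?thesis
      using sum_return_into_le[OF A, of n] return_tail_eq[of n] unfolding shift by simp
  qed
  have "(\<lambda>n. (\<Sum>k<n. measure M (return_into (Suc k) A)) - measure M A) \<longlonglongrightarrow> 0"
    using lim by (rule Lim_null_comparison[rotated]) (use le in \<open>auto intro: always_eventually\<close>)
  then show ?thesis unfolding sums_def by (rule Lim_null[THEN iffD2])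
qed

end


section \<open>The return operators on the Banach space\<close>

locale return_operators = first_return M f Y
  for M :: "'a measure" and f :: "'a \<Rightarrow> 'a" and Y :: "'a set" +
  fixes R :: "('a \<Rightarrow> real) \<Rightarrow> ('a \<Rightarrow> real)" and J :: "'b::banach \<Rightarrow> 'a \<Rightarrow> real"
    and Rn :: "nat \<Rightarrow> 'b \<Rightarrow>\<^sub>L 'b" and C0 :: real
  assumes transfer: "transfer_operator N (return_map f Y) R"
    and space: "banach_function_space N J"
    and Rn_eq: "1 \<le> n \<Longrightarrow>
          AE y in N. J (blinfun_apply (Rn n) v) y = R (\<lambda>x. indicator {x. \<phi> x = enat n} x * J v x) y"
    and C0: "0 < C0" and Rn_norm: "1 \<le> n \<Longrightarrow> norm (Rn n) \<le> C0 * return_prob n"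
    and tail_lim: "return_tail \<longlonglongrightarrow> 0"
begin

sublocale N: prob_space N by (rule prob_space_N)

lemma J_measurable [measurable]: "J v \<in> borel_measurable N"
  and J_add: "AE y in N. J (u + v) y = J u y + J v y"
  and J_scaleR: "AE y in N. J (r *\<^sub>R v) y = r * J v y"
  and J_eq_0: "AE y in N. J v y = 0 \<Longrightarrow> v = 0"
  and J_bound: "AE y in N. \<bar>J v y\<bar> \<le> norm v"
  and J_one: "\<exists>e. AE y in N. J e y = 1"
  using space by (auto simp: banach_function_space_def)

definition test_function :: "('a \<Rightarrow> real) \<Rightarrow> bool" where
  "test_function w \<longleftrightarrow> w \<in> borel_measurable N \<and> (\<exists>K. \<forall>y\<in>Y. \<bar>w y\<bar> \<le> K)"

lemma test_function_const: "test_function (\<lambda>_. c)"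
  by (auto simp: test_function_def)

lemma test_function_indicator: "A \<in> sets M \<Longrightarrow> A \<subseteq> Y \<Longrightarrow> test_function (indicator A)"
  unfolding test_function_def by (auto intro!: exI[of _ 1] borel_measurable_indicator simp: sets_N split: split_indicator)

lemma test_function_mult:
  assumes "test_function w" "test_function w'"
  shows "test_function (\<lambda>y. w y * w' y)"
proof -
  obtain K K' where K: "\<And>y. y \<in> Y \<Longrightarrow> \<bar>w y\<bar> \<le> K" "\<And>y. y \<in> Y \<Longrightarrow> \<bar>w' y\<bar> \<le> K'"
    using assms unfolding test_function_def by blast
  have "\<bar>w y * w' y\<bar> \<le> K * K'" if "y \<in> Y" for y
    unfolding abs_mult using K[OF that] by (intro mult_mono) auto
  then show ?thesis using assms unfolding test_function_def by auto
qed

lemma integrable_J_times: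
  assumes "test_function w"
  shows "integrable N (\<lambda>y. J v y * w y)"
proof -
  obtain K where K: "\<And>y. y \<in> Y \<Longrightarrow> \<bar>w y\<bar> \<le> K" using assms unfolding test_function_def by blast
  have w [measurable]: "w \<in> borel_measurable N" using assms by (simp add: test_function_def)
  show ?thesis
  proof (rule N.integrable_const_bound)
    show "AE y in N. norm (J v y * w y) \<le> norm v * K"
      using J_bound[of v] AE_space
    proof eventually_elim
      case (elim y)
      then show ?case unfolding real_norm_def abs_mult using K[of y] by (intro mult_mono) (auto simp: space_N)
    qed
  qed measurable
qed

lemma integrable_J: "integrable N (J v)"
  using integrable_J_times[OF test_function_const[of 1], of v] by simp

lemma integrable_test_function: "test_function w \<Longrightarrow> integrable N w"
proof -
  assume w: "test_function w"
  then obtain K where K: "\<And>y. y \<in> Y \<Longrightarrow> \<bar>w y\<bar> \<le> K" unfolding test_function_def by blast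
  show ?thesis
    by (rule N.integrable_const_bound[where B = K]) (use w K in \<open>auto simp: test_function_def space_N\<close>)
qed

text \<open>The elements of the Banach space enter the estimates only through their integrals against
  bounded functions, which do not depend on the representatives that \<open>J\<close> selects.\<close>

definition pairing :: "('a \<Rightarrow> real) \<Rightarrow> 'b \<Rightarrow>\<^sub>L real" where
  "pairing w = Blinfun (\<lambda>v. LINT y|N. J v y * w y)"

lemma pairing_bounded:
  assumes w: "test_function w"
  shows "\<bar>LINT y|N. J v y * w y\<bar> \<le> norm v * (LINT y|N. \<bar>w y\<bar>)"
proof -
  have "\<bar>LINT y|N. J v y * w y\<bar> \<le> (LINT y|N. \<bar>J v y * w y\<bar>)"
    by (rule integral_abs_bound)
  also have "\<dots> \<le> (LINT y|N. norm v * \<bar>w y\<bar>)"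
  proof (rule integral_mono_AE)
    show "AE y in N. \<bar>J v y * w y\<bar> \<le> norm v * \<bar>w y\<bar>"
      using J_bound[of v] by eventually_elim (simp add: abs_mult mult_right_mono)
  qed (use integrable_J_times[OF w] integrable_test_function[OF w] in auto)
  finally show ?thesis by simp
qed

lemma bounded_linear_pairing:
  assumes w: "test_function w"
  shows "bounded_linear (\<lambda>v. LINT y|N. J v y * w y)"
proof (rule bounded_linear_intro)
  have [measurable]: "w \<in> borel_measurable N" using w by (simp add: test_function_def)
  show "(LINT y|N. J (u + v) y * w y) = (LINT y|N. J u y * w y) + (LINT y|N. J v y * w y)" for u v
  proof -
    have "(LINT y|N. J (u + v) y * w y) = (LINT y|N. J u y * w y + J v y * w y)"
      by (rule integral_cong_AE) (use J_add[of u v] in \<open>auto simp: distrib_right\<close>)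
    then show ?thesis using integrable_J_times[OF w] by simp
  qed
  show "(LINT y|N. J (r *\<^sub>R v) y * w y) = r *\<^sub>R (LINT y|N. J v y * w y)" for r v
  proof -
    have "(LINT y|N. J (r *\<^sub>R v) y * w y) = (LINT y|N. r * (J v y * w y))"
      by (rule integral_cong_AE) (use J_scaleR[of r v] in \<open>auto simp: mult.assoc\<close>)
    then show ?thesis by simp
  qed
  show "norm (LINT y|N. J v y * w y) \<le> norm v * (LINT y|N. \<bar>w y\<bar>)" for v
    using pairing_bounded[OF w] by simp
qed

lemma pairing_apply: "test_function w \<Longrightarrow> pairing w v = (LINT y|N. J v y * w y)"
  unfolding pairing_def by (simp add: bounded_linear_Blinfun_apply[OF bounded_linear_pairing])

lemma norm_pairing_le: "test_function w \<Longrightarrow> norm (pairing w) \<le> (LINT y|N. \<bar>w y\<bar>)"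
proof (rule norm_blinfun_bound)
  fix v assume w: "test_function w"
  show "norm (pairing w v) \<le> (LINT y|N. \<bar>w y\<bar>) * norm v"
    using pairing_bounded[OF w, of v] unfolding pairing_apply[OF w] real_norm_def by (subst mult.commute)
qed simp

lemma pairing_cong: "(\<And>y. y \<in> Y \<Longrightarrow> w y = w' y) \<Longrightarrow> pairing w = pairing w'"
  unfolding pairing_def by (intro arg_cong[where f = Blinfun] ext Bochner_Integration.integral_cong) (auto simp: space_N)

definition visit :: "nat \<Rightarrow> ('a \<Rightarrow> real) \<Rightarrow> 'a \<Rightarrow> real" where
  "visit n w y = indicator Y ((f ^^ n) y) * w ((f ^^ n) y)"

lemma visit_bound: "(\<And>y. y \<in> Y \<Longrightarrow> \<bar>w y\<bar> \<le> K) \<Longrightarrow> 0 \<le> K \<Longrightarrow> \<bar>visit n w y\<bar> \<le> K"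
  by (auto simp: visit_def split: split_indicator)

lemma test_function_visit:
  assumes "test_function w"
  shows "test_function (visit n w)"
proof -
  obtain K where K: "\<And>y. y \<in> Y \<Longrightarrow> \<bar>w y\<bar> \<le> K" using assms unfolding test_function_def by blast
  have "(\<lambda>x. indicator Y x *\<^sub>R w x) \<in> borel_measurable M"
    using assms Y by (subst borel_measurable_restrict_space_iff[symmetric]) (auto simp: test_function_def)
  then have "(\<lambda>y. indicator Y ((f ^^ n) y) *\<^sub>R w ((f ^^ n) y)) \<in> borel_measurable N"
    by (rule measurable_compose[OF pow_measurable_N])
  moreover have "\<bar>visit n w y\<bar> \<le> max 0 K" for y
    using K by (intro visit_bound) (auto simp: le_max_iff_disj)
  ultimately show ?thesis unfolding test_function_def visit_def[abs_def] by auto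
qed

lemma visit_0: "y \<in> Y \<Longrightarrow> visit 0 w y = w y"
  by (simp add: visit_def)

abbreviation returns_at :: "nat \<Rightarrow> 'a \<Rightarrow> real" where
  "returns_at n \<equiv> indicator {y \<in> Y. \<phi> y = enat n}"

lemma test_function_returns_at: "test_function (returns_at n)"
  by (rule test_function_indicator[OF return_sets]) auto

text \<open>The duality between the transfer operator and the return map, which is \<open>f ^^ n\<close> on the points
  with return time \<open>n\<close>.\<close>

lemma pairing_Rn:
  assumes n: "1 \<le> n" and w: "test_function w"
  shows "pairing w (Rn n v) = pairing (\<lambda>y. returns_at n y * visit n w y) v"
proof -
  let ?v = "\<lambda>x. indicator {x. \<phi> x = enat n} x * J v x"
  have w' [measurable]: "w \<in> borel_measurable N" and bd: "\<exists>K. \<forall>y\<in>space N. \<bar>w y\<bar> \<le> K"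
    using w by (auto simp: test_function_def space_N)
  have "integrable N (\<lambda>y. J v y * returns_at n y)"
    by (rule integrable_J_times[OF test_function_returns_at])
  moreover have "integrable N ?v \<longleftrightarrow> integrable N (\<lambda>y. J v y * returns_at n y)"
    by (intro Bochner_Integration.integrable_cong) (auto simp: space_N split: split_indicator)
  ultimately have v: "integrable N ?v" by simp
  have "pairing w (Rn n v) = (LINT y|N. J (Rn n v) y * w y)" by (rule pairing_apply[OF w])
  also have "\<dots> = (LINT y|N. R ?v y * w y)"
  proof (rule integral_cong_AE)
    have [measurable]: "R ?v \<in> borel_measurable N"
      using transfer v unfolding transfer_operator_def by (auto intro: borel_measurable_integrable)
    show "(\<lambda>y. R ?v y * w y) \<in> borel_measurable N" by measurable
    show "AE y in N. J (Rn n v) y * w y = R ?v y * w y"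
      using Rn_eq[OF n, of v] by eventually_elim simp
  qed measurable
  also have "\<dots> = (LINT y|N. ?v y * w (return_map f Y y))"
    using transfer v w' bd unfolding transfer_operator_def by blast
  also have "\<dots> = (LINT y|N. J v y * (returns_at n y * visit n w y))"
  proof (rule Bochner_Integration.integral_cong[OF refl])
    fix y assume "y \<in> space N"
    then have y: "y \<in> Y" by (simp add: space_N)
    show "?v y * w (return_map f Y y) = J v y * (returns_at n y * visit n w y)"
    proof (cases "\<phi> y = enat n")
      case True
      then have "(f ^^ n) y \<in> Y" by (simp add: return_time_eq_iff)
      then show ?thesis using True y by (simp add: return_map_def visit_def)
    qed (simp add: indicator_def)
  qed
  also have "\<dots> = pairing (\<lambda>y. returns_at n y * visit n w y) v"
    by (intro pairing_apply[symmetric] test_function_mult test_function_returns_at test_function_visit w)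
  finally show ?thesis .
qed

text \<open>A visit at time \<open>n \<ge> 1\<close> is a first return at some time \<open>k \<le> n\<close> followed by a visit
  \<open>n - k\<close> steps later.\<close>

lemma visit_decomposition:
  assumes y: "y \<in> Y" and n: "1 \<le> n"
  shows "visit n w y = (\<Sum>k=1..n. returns_at k y * visit k (visit (n - k) w) y)"
proof -
  have shift: "visit k (visit (n - k) w) y = indicator Y ((f ^^ k) y) * visit n w y" if "k \<le> n" for k
  proof -
    have "(f ^^ (n - k)) ((f ^^ k) y) = (f ^^ n) y"
      using that by (metis comp_apply funpow_add le_add_diff_inverse2)
    then show ?thesis by (simp add: visit_def)
  qed
  have "(\<Sum>k=1..n. returns_at k y * visit k (visit (n - k) w) y) = (\<Sum>k=1..n. returns_at k y * visit n w y)"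
  proof (rule sum.cong[OF refl])
    fix k assume "k \<in> {1..n}"
    then show "returns_at k y * visit k (visit (n - k) w) y = returns_at k y * visit n w y"
      by (auto simp: shift return_time_eq_iff split: split_indicator)
  qed
  also have "\<dots> = visit n w y"
  proof (cases "(f ^^ n) y \<in> Y")
    case True
    then have "\<not> enat n < \<phi> y" using n by (auto simp: less_return_time_iff)
    then obtain j where j: "\<phi> y = enat j" "j \<le> n" by (cases "\<phi> y") auto
    then have "1 \<le> j" by (simp add: return_time_eq_iff)
    have "(\<Sum>k=1..n. returns_at k y * visit n w y) = (\<Sum>k=1..n. if k = j then visit n w y else 0)"
      using y j by (intro sum.cong) (auto simp: indicator_def)
    then show ?thesis using j \<open>1 \<le> j\<close> by simp
  qed (simp add: visit_def)
  finally show ?thesis by simp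
qed

text \<open>The pairings along the orbit satisfy the renewal equation. This takes the place of the
  operators \<open>v \<mapsto> 1\<^sub>Y L\<^sup>n (1\<^sub>Y v)\<close>, \<open>L\<close> the transfer operator of \<open>f\<close>, whose boundedness in the Banach
  space is not known beforehand: as functionals they are bounded by the supremum of \<open>w\<close>.\<close>

lemma pairing_visit_renewal:
  assumes w: "test_function w" and n: "1 \<le> n"
  shows "pairing (visit n w) v = (\<Sum>k=1..n. pairing (visit (n - k) w) (Rn k v))"
proof -
  have tf: "test_function (\<lambda>y. returns_at k y * visit k (visit (n - k) w) y)" for k
    by (intro test_function_mult test_function_returns_at test_function_visit w)
  have "pairing (visit n w) v = (LINT y|N. (\<Sum>k=1..n. J v y * (returns_at k y * visit k (visit (n - k) w) y)))"
    unfolding pairing_apply[OF test_function_visit[OF w]]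
  proof (rule Bochner_Integration.integral_cong[OF refl])
    fix y assume "y \<in> space N"
    then have "visit n w y = (\<Sum>k=1..n. returns_at k y * visit k (visit (n - k) w) y)"
      using n by (intro visit_decomposition) (auto simp: space_N)
    then show "J v y * visit n w y = (\<Sum>k=1..n. J v y * (returns_at k y * visit k (visit (n - k) w) y))"
      by (simp only: sum_distrib_left)
  qed
  also have "\<dots> = (\<Sum>k=1..n. LINT y|N. J v y * (returns_at k y * visit k (visit (n - k) w) y))"
    by (intro Bochner_Integration.integral_sum integrable_J_times tf)
  also have "\<dots> = (\<Sum>k=1..n. pairing (visit (n - k) w) (Rn k v))"
    by (intro sum.cong) (auto simp: pairing_Rn[OF _ test_function_visit[OF w]] pairing_apply[OF tf])
  finally show ?thesis .
qed

lemma integral_indicator_N: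
  assumes "A \<in> sets M" "A \<subseteq> Y"
  shows "(LINT y|N. indicator A y) = measure M A"
proof -
  have "A \<inter> space N = A" using assms by (auto simp: space_N)
  then show ?thesis using assms by (simp add: measure_N)
qed

lemma integral_returns_at: "(LINT y|N. returns_at n y) = return_prob n"
  unfolding return_prob_def by (rule integral_indicator_N[OF return_sets]) auto

definition e :: 'b where "e = (SOME e. AE y in N. J e y = 1)"

lemma J_e: "AE y in N. J e y = 1"
  unfolding e_def using J_one by (rule someI_ex)

lemma pairing_e: "test_function w \<Longrightarrow> pairing w e = (LINT y|N. w y)"
proof -
  assume w: "test_function w"
  then have [measurable]: "w \<in> borel_measurable N" by (simp add: test_function_def)
  show ?thesis unfolding pairing_apply[OF w]
    by (rule integral_cong_AE) (use J_e in auto)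
qed

abbreviation l :: "'b \<Rightarrow>\<^sub>L real" where "l \<equiv> pairing (\<lambda>_. 1)"

lemma l_e: "l e = 1"
  using N.prob_space by (simp add: pairing_e[OF test_function_const])

lemma l_Rn: "1 \<le> n \<Longrightarrow> l (Rn n v) = pairing (returns_at n) v"
proof -
  assume n: "1 \<le> n"
  have "pairing (\<lambda>y. returns_at n y * visit n (\<lambda>_. 1) y) = pairing (returns_at n)"
    by (rule pairing_cong) (auto simp: visit_def return_time_eq_iff split: split_indicator)
  then show ?thesis using pairing_Rn[OF n test_function_const[of 1], of v] by simp
qed

lemma l_Rn_e: "1 \<le> n \<Longrightarrow> l (Rn n e) = return_prob n"
  by (simp only: l_Rn pairing_e[OF test_function_returns_at] integral_returns_at)

lemma indicator_tail_eq:
  assumes "y \<in> Y"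
  shows "1 - (\<Sum>k<n. returns_at (Suc k) y) = indicator {y \<in> Y. \<phi> y > enat n} y"
proof (induction n)
  case 0
  then show ?case using assms by (auto simp: less_return_time_iff split: split_indicator)
next
  case (Suc n)
  have "{y \<in> Y. \<phi> y > enat n} = {y \<in> Y. \<phi> y = enat (Suc n)} \<union> {y \<in> Y. \<phi> y > enat (Suc n)}"
    by (auto simp: return_time_eq_iff less_return_time_iff le_Suc_eq less_Suc_eq_le)
  moreover have "{y \<in> Y. \<phi> y = enat (Suc n)} \<inter> {y \<in> Y. \<phi> y > enat (Suc n)} = {}" by auto
  ultimately have "indicator {y \<in> Y. \<phi> y > enat n} y
      = (returns_at (Suc n) y + indicator {y \<in> Y. \<phi> y > enat (Suc n)} y :: real)"
    by (simp only: indicator_add)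
  then show ?case using Suc by simp
qed

lemma test_function_tail: "test_function (indicator {y \<in> Y. \<phi> y > enat n})"
  by (rule test_function_indicator[OF tail_sets]) auto

lemma integral_tail: "(LINT y|N. indicator {y \<in> Y. \<phi> y > enat n} y) = return_tail n"
  unfolding return_tail_def by (rule integral_indicator_N[OF tail_sets]) auto

text \<open>The integral over the points that have not returned up to time \<open>n\<close> is at most
  \<open>return_tail n\<close> times the norm.\<close>

lemma l_Rn_sums: "(\<lambda>n. l (Rn (Suc n) v)) sums l v"
proof -
  have eq: "l v - (\<Sum>k<n. l (Rn (Suc k) v)) = pairing (indicator {y \<in> Y. \<phi> y > enat n}) v" for n
  proof -
    have "l v - (\<Sum>k<n. l (Rn (Suc k) v)) = (LINT y|N. J v y) - (\<Sum>k<n. LINT y|N. J v y * returns_at (Suc k) y)"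
      using l_Rn[of "Suc _" v] pairing_apply[OF test_function_const[of 1], of v]
      by (simp only: pairing_apply[OF test_function_returns_at] mult_1_right One_nat_def Suc_le_mono le0)
    also have "\<dots> = (LINT y|N. J v y - (\<Sum>k<n. J v y * returns_at (Suc k) y))"
    proof -
      have int: "integrable N (\<lambda>y. J v y * returns_at (Suc k) y)" for k
        by (rule integrable_J_times[OF test_function_returns_at])
      have "(\<Sum>k<n. LINT y|N. J v y * returns_at (Suc k) y) = (LINT y|N. (\<Sum>k<n. J v y * returns_at (Suc k) y))"
        by (rule Bochner_Integration.integral_sum[OF int, symmetric])
      then show ?thesis
        by (simp only: Bochner_Integration.integral_diff[OF integrable_J Bochner_Integration.integrable_sum[OF int]])
    qed
    also have "\<dots> = (LINT y|N. J v y * indicator {y \<in> Y. \<phi> y > enat n} y)"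
      by (rule Bochner_Integration.integral_cong)
        (simp_all add: indicator_tail_eq[symmetric] space_N right_diff_distrib sum_distrib_left)
    finally show ?thesis by (simp add: pairing_apply[OF test_function_tail])
  qed
  have bound: "\<bar>l v - (\<Sum>k<n. l (Rn (Suc k) v))\<bar> \<le> norm v * return_tail n" for n
    unfolding eq pairing_apply[OF test_function_tail]
    using pairing_bounded[OF test_function_tail[of n], of v] integral_tail[of n] by simp
  have "eventually (\<lambda>n. norm ((\<Sum>k<n. l (Rn (Suc k) v)) - l v) \<le> norm v * return_tail n) sequentially"
    using bound unfolding real_norm_def by (intro always_eventually allI) (subst abs_minus_commute)
  moreover have "(\<lambda>n. norm v * return_tail n) \<longlonglongrightarrow> 0"
    using tendsto_mult[OF tendsto_const tail_lim, of "norm v"] by simp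
  ultimately have "(\<lambda>n. (\<Sum>k<n. l (Rn (Suc k) v)) - l v) \<longlonglongrightarrow> 0"
    by (rule Lim_null_comparison)
  then show ?thesis unfolding sums_def by (rule Lim_null[THEN iffD2])
qed

text \<open>\<open>R 1 = 1\<close>, tested against the indicators of measurable sets: this is the invariance of the
  measure under the return map.\<close>

lemma Rn_e_sums:
  assumes summ: "summable return_prob"
  shows "(\<lambda>n. Rn (Suc n) e) sums e"
proof -
  have "summable (\<lambda>n. Rn (Suc n) e)"
  proof (rule summable_comparison_test'[where N = 0])
    show "summable (\<lambda>n. (C0 * norm e) * return_prob (Suc n))"
      using summ by (intro summable_mult) (simp add: summable_Suc_iff)
    show "norm (Rn (Suc n) e) \<le> C0 * norm e * return_prob (Suc n)" for n
    proof -
      have "norm (Rn (Suc n) e) \<le> norm (Rn (Suc n)) * norm e" by (rule norm_blinfun)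
      also have "\<dots> \<le> (C0 * return_prob (Suc n)) * norm e"
        by (intro mult_right_mono Rn_norm) auto
      finally show ?thesis by (simp add: mult_ac)
    qed
  qed
  then obtain x where x: "(\<lambda>n. Rn (Suc n) e) sums x" using summable_def by blast
  have "AE y in N. J (x - e) y = 0"
  proof (rule N.density_zero[OF integrable_J])
    fix A assume "A \<in> sets N"
    then have A: "A \<in> sets M" "A \<subseteq> Y" by (auto simp: sets_N)
    note tf = test_function_indicator[OF A]
    have "(\<lambda>n. pairing (indicator A) (Rn (Suc n) e)) sums pairing (indicator A) x"
      by (rule bounded_linear.sums[OF blinfun.bounded_linear_right x])
    moreover have "pairing (indicator A) (Rn (Suc n) e) = measure M (return_into (Suc n) A)" for n
    proof -
      have "pairing (indicator A) (Rn (Suc n) e)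
          = (LINT y|N. returns_at (Suc n) y * visit (Suc n) (indicator A) y)"
        using pairing_Rn[OF _ tf, of "Suc n" e]
        by (simp add: pairing_e test_function_mult test_function_returns_at test_function_visit tf)
      also have "\<dots> = (LINT y|N. indicator (return_into (Suc n) A) y)"
        by (rule Bochner_Integration.integral_cong)
          (auto simp: visit_def return_into_def space_N return_time_eq_iff split: split_indicator)
      also have "\<dots> = measure M (return_into (Suc n) A)"
        by (rule integral_indicator_N[OF return_into_sets[OF A(1)]]) (auto simp: return_into_def)
      finally show ?thesis .
    qed
    ultimately have "(\<lambda>n. measure M (return_into (Suc n) A)) sums pairing (indicator A) x" by simp
    then have "pairing (indicator A) x = measure M A"
      using return_map_preserving[OF A tail_lim] sums_unique2 by blast
    also have "\<dots> = pairing (indicator A) e"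
      by (simp only: pairing_e[OF tf] integral_indicator_N[OF A])
    finally have "pairing (indicator A) (x - e) = 0" by (simp add: blinfun.diff_right)
    then show "set_lebesgue_integral N A (J (x - e)) = 0"
      by (simp add: pairing_apply[OF tf] set_lebesgue_integral_def mult.commute)
  qed
  then have "x = e" using J_eq_0 by fastforce
  with x show ?thesis by simp
qed

end


section \<open>The arcsine density as a limit of convolution sums\<close>

definition arcsine_kernel :: "real \<Rightarrow> real \<Rightarrow> real" where
  "arcsine_kernel \<beta> u = u powr (\<beta> - 1) * (1 - u) powr - \<beta>"

text \<open>For \<open>j \<le> n\<close> this is \<open>arcsine_kernel \<beta> (j / n) / n\<close>, a term of a Riemann sum of mesh \<open>1 / n\<close>.\<close>

definition arcsine_weight :: "real \<Rightarrow> nat \<Rightarrow> nat \<Rightarrow> real" where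
  "arcsine_weight \<beta> n j = real j powr (\<beta> - 1) * real (n - j) powr - \<beta>"

lemma arcsine_kernel_set_integrable:
  assumes "0 < \<beta>" "\<beta> < 1"
  shows "set_integrable lborel {0..1} (arcsine_kernel \<beta>)"
  using integrable_Beta[of \<beta> "1 - \<beta>"] assms by (simp add: arcsine_kernel_def[abs_def])

lemma arcsine_kernel_integrable:
  assumes "0 < \<beta>" "\<beta> < 1" "0 \<le> a" "b \<le> 1"
  shows "arcsine_kernel \<beta> integrable_on {a..b}"
proof (rule integrable_on_subinterval)
  show "arcsine_kernel \<beta> integrable_on {0..1}"
    by (rule set_borel_integral_eq_integral(1)[OF arcsine_kernel_set_integrable]) (use assms in auto)
qed (use assms in auto)

lemma arcsine_kernel_lborel_integral:
  assumes "0 < \<beta>" "\<beta> < 1" "0 \<le> t" "t \<le> 1"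
  shows "(LINT u:{0..t}|lborel. 1 / u powr (1 - \<beta>) * (1 / (1 - u) powr \<beta>)) = integral {0..t} (arcsine_kernel \<beta>)"
proof -
  have "set_integrable lborel {0..t} (arcsine_kernel \<beta>)"
    by (rule set_integrable_subset[OF arcsine_kernel_set_integrable]) (use assms in auto)
  then have "(LINT u:{0..t}|lborel. arcsine_kernel \<beta> u) = integral {0..t} (arcsine_kernel \<beta>)"
    by (rule set_borel_integral_eq_integral(2))
  moreover have "1 / u powr (1 - \<beta>) * (1 / (1 - u) powr \<beta>) = arcsine_kernel \<beta> u" for u
    using powr_minus_divide[of u "1 - \<beta>"] powr_minus_divide[of "1 - u" \<beta>] by (simp add: arcsine_kernel_def)
  ultimately show ?thesis by simp
qed

lemma arcsine_kernel_nonneg: "0 \<le> arcsine_kernel \<beta> u"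
  by (simp add: arcsine_kernel_def)

lemma arcsine_weight_nonneg: "0 \<le> arcsine_weight \<beta> n j"
  by (simp add: arcsine_weight_def)

lemma arcsine_weight_le:
  assumes \<beta>: "1 / 2 < \<beta>" "\<beta> < 1" and n: "1 \<le> n" "j \<le> n"
  shows "arcsine_weight \<beta> n j \<le> 2 * real n powr (\<beta> - 1)"
proof (cases "j = 0 \<or> j = n")
  case False
  have half: "real k powr - s \<le> 2 * real n powr - s" if "n \<le> 2 * k" "0 \<le> s" "s \<le> 1" for k s
  proof -
    have "real k powr - s \<le> (real n / 2) powr - s" using that n by (intro powr_mono2') auto
    also have "\<dots> = 2 powr s * real n powr - s"
      by (simp add: powr_divide powr_minus field_simps)
    also have "\<dots> \<le> 2 powr 1 * real n powr - s" using that by (intro mult_right_mono powr_mono) auto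
    finally show ?thesis by simp
  qed
  have le1: "real k powr - s \<le> 1" if "1 \<le> k" "0 \<le> s" for k :: nat and s
    using powr_mono[of "- s" 0 "real k"] that by simp
  show ?thesis
  proof (cases "n \<le> 2 * j")
    case True
    have "real j powr - (1 - \<beta>) * real (n - j) powr - \<beta> \<le> (2 * real n powr - (1 - \<beta>)) * 1"
      using True False n \<beta> by (intro mult_mono half le1) auto
    then show ?thesis by (simp add: arcsine_weight_def)
  next
    case 2: False
    have "real j powr - (1 - \<beta>) * real (n - j) powr - \<beta> \<le> 1 * (2 * real n powr - \<beta>)"
      using 2 False n \<beta> by (intro mult_mono half le1) auto
    also have "real n powr - \<beta> \<le> real n powr (\<beta> - 1)" using n \<beta> by (intro powr_mono) auto
    finally show ?thesis by (simp add: arcsine_weight_def)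
  qed
qed (auto simp: arcsine_weight_def)

lemma powr_difference_le:
  assumes "0 < s" "s \<le> 1" "1 \<le> k"
  shows "real k powr - s - (real k + 1) powr - s \<le> real k powr - (1 + s)"
proof -
  obtain \<xi> where \<xi>: "real k < \<xi>" "(real k + 1) powr - s - real k powr - s = - s * \<xi> powr (- s - 1)"
    using powr_mean_value[of "real k" "- s"] assms by auto
  have "s * \<xi> powr (- s - 1) \<le> 1 * real k powr (- s - 1)"
    using \<xi> assms by (intro mult_mono powr_mono2') auto
  moreover have exponent: "- (1 + s) = - s - 1" by simp
  ultimately show ?thesis unfolding exponent using \<xi> by linarith
qed

text \<open>On a mesh interval away from the end points the integral of the kernel and the weight at its
  left end point lie between the same bounds; the sum of the gaps between these bounds is a
  convolution of powers.\<close>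

theorem arcsine_riemann_sum:
  assumes \<beta>: "1 / 2 < \<beta>" "\<beta> < 1"
  shows "\<exists>C\<ge>0. \<forall>n t. 1 \<le> n \<longrightarrow> 0 \<le> t \<longrightarrow> t \<le> 1 \<longrightarrow>
    \<bar>(\<Sum>j\<le>nat \<lfloor>real n * t\<rfloor>. arcsine_weight \<beta> n j) - integral {0..t} (arcsine_kernel \<beta>)\<bar> \<le> C * real n powr (\<beta> - 1)"
proof -
  let ?\<psi> = "arcsine_kernel \<beta>" and ?a = "arcsine_weight \<beta>"
  have integ: "?\<psi> integrable_on {x..y}" if "0 \<le> x" "y \<le> 1" for x y
    using \<beta> that by (intro arcsine_kernel_integrable) auto
  define Z where "Z = integral {0..1} ?\<psi>"
  obtain C1 where C1: "0 \<le> C1" "\<And>n. 1 \<le> n \<Longrightarrow>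
      (\<Sum>j=1..<n. real j powr - (1 - \<beta>) * real (n - j) powr - (1 + \<beta>)) \<le> C1 * real n powr - (1 - \<beta>)"
    using power_convolution[of "1 - \<beta>" "1 + \<beta>" "1 - \<beta>"] \<beta> by auto
  obtain C2 where C2: "0 \<le> C2" "\<And>n. 1 \<le> n \<Longrightarrow>
      (\<Sum>j=1..<n. real j powr - (2 - \<beta>) * real (n - j) powr - \<beta>) \<le> C2 * real n powr - (1 - \<beta>)"
    using power_convolution[of "2 - \<beta>" \<beta> "1 - \<beta>"] \<beta> by auto
  define C3 where "C3 = 2 / \<beta> + 2 / (1 - \<beta>) + 2 + 2 * C1 + C2"
  have "0 \<le> 2 / \<beta>" "0 \<le> 2 / (1 - \<beta>)" using \<beta> by auto
  then have C3: "0 \<le> C3" unfolding C3_def using C1(1) C2(1) by linarith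
  have main: "\<bar>(\<Sum>j\<le>nat \<lfloor>real n * t\<rfloor>. ?a n j) - integral {0..t} ?\<psi>\<bar> \<le> (2 * C3 + 4) * real n powr (\<beta> - 1)"
    if n: "2 \<le> n" and t: "0 \<le> t" "t \<le> 1" for n t
  proof -
    define I where "I j = integral {real j / n .. real (j + 1) / n} ?\<psi>" for j
    have npos: "0 < real n" using n by simp
    have I_nonneg: "0 \<le> I j" if "j < n" for j
      unfolding I_def using that n by (intro integral_nonneg integ arcsine_kernel_nonneg) auto
    have rescale: "(real j / n) powr (\<beta> - 1) * (real k / n) powr - \<beta> = real n * (real j powr (\<beta> - 1) * real k powr - \<beta>)" for j k
    proof -
      have "real n powr (\<beta> - 1) * real n powr - \<beta> = real n powr - 1"
        unfolding powr_add[symmetric] by simp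
      then have "1 / (real n powr (\<beta> - 1) * real n powr - \<beta>) = real n" using npos by (simp add: powr_minus_divide)
      moreover have "(real j / n) powr (\<beta> - 1) * (real k / n) powr - \<beta>
         = real j powr (\<beta> - 1) * real k powr - \<beta> * (1 / (real n powr (\<beta> - 1) * real n powr - \<beta>))"
        by (simp add: powr_divide)
      ultimately show ?thesis by simp
    qed
    have first: "I 0 \<le> 2 / \<beta> * real n powr (\<beta> - 1)"
    proof -
      have pw: "((\<lambda>u. 2 * u powr (\<beta> - 1)) has_integral 2 * ((1 / n) powr (\<beta> - 1 + 1) / (\<beta> - 1 + 1))) {0..1 / n}"
        using \<beta> by (intro has_integral_mult_right has_integral_powr_from_0) auto
      have ends: "real 0 / n = 0" "real (0 + 1) / n = 1 / n" by simp_all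
      have "I 0 \<le> integral {0..1 / n} (\<lambda>u. 2 * u powr (\<beta> - 1))"
        unfolding I_def ends
      proof (rule integral_le)
        fix u assume u: "u \<in> {0..1 / real n}"
        have "1 / real n \<le> 1 / 2" using n by (simp add: field_simps)
        then have "u \<le> 1 / 2" using u by auto
        then have "(1 - u) powr - \<beta> \<le> (1 / 2) powr - \<beta>" using \<beta> by (intro powr_mono2') auto
        also have "\<dots> = 2 powr \<beta>" by (simp add: powr_divide powr_minus_divide)
        also have "\<dots> \<le> 2 powr 1" using \<beta> by (intro powr_mono) auto
        finally have "(1 - u) powr - \<beta> \<le> 2" by simp
        then have "u powr (\<beta> - 1) * (1 - u) powr - \<beta> \<le> u powr (\<beta> - 1) * 2" by (intro mult_left_mono) auto
        then show "?\<psi> u \<le> 2 * u powr (\<beta> - 1)" by (simp add: arcsine_kernel_def mult.commute)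
      qed (use pw integ n in auto)
      also have "\<dots> = 2 * ((1 / n) powr (\<beta> - 1 + 1) / (\<beta> - 1 + 1))" using pw by (rule integral_unique)
      also have "\<dots> = 2 / \<beta> * real n powr - \<beta>" by (simp add: powr_divide powr_minus_divide)
      also have "\<dots> \<le> 2 / \<beta> * real n powr (\<beta> - 1)" using n \<beta> by (intro mult_left_mono powr_mono) auto
      finally show ?thesis .
    qed
    have last: "I (n - 1) \<le> 2 / (1 - \<beta>) * real n powr (\<beta> - 1)"
    proof -
      have ends: "real (n - 1) / n = 1 - 1 / n" "real (n - 1 + 1) / n = 1"
        using n by (auto simp: field_simps of_nat_diff)
      have "((\<lambda>u. (1 - u) powr - \<beta>) has_integral
          (- ((1 - 1) powr (1 - \<beta>)) / (1 - \<beta>)) - (- ((1 - (1 - 1 / n)) powr (1 - \<beta>)) / (1 - \<beta>))) {1 - 1 / n .. 1}"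
      proof (rule fundamental_theorem_of_calculus_interior)
        show "continuous_on {1 - 1 / real n..1} (\<lambda>u. - ((1 - u) powr (1 - \<beta>)) / (1 - \<beta>))"
          using \<beta> by (intro continuous_intros continuous_on_powr') auto
        fix u assume u: "u \<in> {1 - 1 / real n<..<1}"
        have "((\<lambda>u. - ((1 - u) powr (1 - \<beta>)) / (1 - \<beta>)) has_real_derivative (1 - u) powr (1 - \<beta> - 1)) (at u)"
          using u \<beta> by (auto intro!: derivative_eq_intros)
        then show "((\<lambda>u. - ((1 - u) powr (1 - \<beta>)) / (1 - \<beta>)) has_vector_derivative (1 - u) powr - \<beta>) (at u)"
          by (simp add: has_real_derivative_iff_has_vector_derivative)
      qed simp
      then have pw: "((\<lambda>u. 2 * (1 - u) powr - \<beta>) has_integral 2 * ((1 / n) powr (1 - \<beta>) / (1 - \<beta>))) {1 - 1 / n .. 1}"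
        by (intro has_integral_mult_right) simp
      have "I (n - 1) \<le> integral {1 - 1 / n .. 1} (\<lambda>u. 2 * (1 - u) powr - \<beta>)"
        unfolding I_def ends
      proof (rule integral_le)
        fix u assume u: "u \<in> {1 - 1 / real n .. 1}"
        have "1 / real n \<le> 1 / 2" using n by (simp add: field_simps)
        then have "1 / 2 \<le> u" using u by auto
        then have "u powr - (1 - \<beta>) \<le> (1 / 2) powr - (1 - \<beta>)" using \<beta> by (intro powr_mono2') auto
        also have "\<dots> = 2 powr (1 - \<beta>)" by (simp only: powr_divide powr_minus_divide) simp
        also have "\<dots> \<le> 2 powr 1" using \<beta> by (intro powr_mono) auto
        finally have "u powr (\<beta> - 1) \<le> 2" by simp
        then show "?\<psi> u \<le> 2 * (1 - u) powr - \<beta>"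
          unfolding arcsine_kernel_def by (intro mult_right_mono) auto
      qed (use pw integ n in auto)
      also have "\<dots> = 2 * ((1 / n) powr (1 - \<beta>) / (1 - \<beta>))" using pw by (rule integral_unique)
      also have "\<dots> = 2 / (1 - \<beta>) * real n powr - (1 - \<beta>)" by (simp only: powr_divide powr_minus_divide) simp
      finally show ?thesis by simp
    qed
    define lo where "lo j = real (j + 1) powr (\<beta> - 1) * real (n - j) powr - \<beta>" for j
    define up where "up j = real j powr (\<beta> - 1) * real (n - j - 1) powr - \<beta>" for j
    have middle: "\<bar>I j - ?a n j\<bar> \<le> up j - lo j" if j: "1 \<le> j" "j < n - 1" for j
    proof -
      have "lo j \<le> ?a n j" "?a n j \<le> up j"
        unfolding lo_def up_def arcsine_weight_def using j \<beta> by (intro mult_mono powr_mono2'; simp)+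
      moreover have "lo j \<le> I j \<and> I j \<le> up j"
      proof -
        have len: "real (j + 1) / n - real j / n = 1 / n" by (simp only: diff_divide_distrib[symmetric]) simp
        have le1: "real (j + 1) / n \<le> 1" using j n by (simp add: field_simps)
        have bounds: "real n * lo j \<le> ?\<psi> u \<and> ?\<psi> u \<le> real n * up j" if u: "u \<in> {real j / n .. real (j + 1) / n}" for u
        proof -
          have jn: "0 < real j / n" using j npos by simp
          have "1 - real (j + 1) / n = real (n - j - 1) / n" "1 - real j / n = real (n - j) / n"
            using j n by (auto simp: field_simps of_nat_diff)
          then have u1: "real (n - j - 1) / n \<le> 1 - u" "1 - u \<le> real (n - j) / n" using u by auto
          have k: "0 < real (n - j - 1) / n" using j npos by simp
          then have u1': "0 < 1 - u" using u1(1) by linarith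
          have mono: "x' powr (\<beta> - 1) * y' powr - \<beta> \<le> x powr (\<beta> - 1) * y powr - \<beta>"
            if "0 < x" "x \<le> x'" "0 < y" "y \<le> y'" for x x' y y' :: real
            using that \<beta> by (intro mult_mono powr_mono2') auto
          have ju: "real j / n \<le> u" "u \<le> real (j + 1) / n" using u by auto
          then have u0: "0 < u" using jn by linarith
          have "(real (j + 1) / n) powr (\<beta> - 1) * (real (n - j) / n) powr - \<beta> \<le> ?\<psi> u"
            unfolding arcsine_kernel_def by (rule mono[OF u0 ju(2) u1' u1(2)])
          moreover have "?\<psi> u \<le> (real j / n) powr (\<beta> - 1) * (real (n - j - 1) / n) powr - \<beta>"
            unfolding arcsine_kernel_def by (rule mono[OF jn ju(1) k u1(1)])
          ultimately show ?thesis unfolding rescale lo_def up_def by simp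
        qed
        have int: "?\<psi> integrable_on {real j / n .. real (j + 1) / n}" using le1 by (intro integ) auto
        have "integral {real j / n .. real (j + 1) / n} (\<lambda>_. real n * lo j) \<le> I j"
          unfolding I_def using bounds int by (intro integral_le) auto
        moreover have "I j \<le> integral {real j / n .. real (j + 1) / n} (\<lambda>_. real n * up j)"
          unfolding I_def using bounds int by (intro integral_le) auto
        moreover have "integral {real j / n .. real (j + 1) / n} (\<lambda>_. real n * x) = x" for x
          using npos len by (simp add: divide_right_mono)
        ultimately show ?thesis by (simp only:)
      qed
      ultimately show ?thesis by linarith
    qed
    have gaps: "(\<Sum>j=1..<n - 1. up j - lo j) \<le> (2 * C1 + C2) * real n powr (\<beta> - 1)"
    proof -
      have "(\<Sum>j=1..<n - 1. up j - lo j) \<le> (\<Sum>j=1..<n - 1. real j powr - (1 - \<beta>) * real (n - 1 - j) powr - (1 + \<beta>)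
            + real j powr - (2 - \<beta>) * real (n - j) powr - \<beta>)"
      proof (rule sum_mono)
        fix j assume "j \<in> {1..<n - 1}"
        then have j: "1 \<le> j" "j < n - 1" by auto
        have "up j - lo j = real j powr - (1 - \<beta>) * (real (n - 1 - j) powr - \<beta> - real (n - j) powr - \<beta>)
            + (real j powr - (1 - \<beta>) - (real j + 1) powr - (1 - \<beta>)) * real (n - j) powr - \<beta>"
          by (simp add: up_def lo_def algebra_simps)
        also have "\<dots> \<le> real j powr - (1 - \<beta>) * real (n - 1 - j) powr - (1 + \<beta>)
            + real j powr - (1 + (1 - \<beta>)) * real (n - j) powr - \<beta>"
        proof (intro add_mono mult_left_mono mult_right_mono)
          have "real (n - j) = real (n - 1 - j) + 1" using j by linarith
          then show "real (n - 1 - j) powr - \<beta> - real (n - j) powr - \<beta> \<le> real (n - 1 - j) powr - (1 + \<beta>)"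
            using powr_difference_le[of \<beta> "n - 1 - j"] \<beta> j by simp
          show "real j powr - (1 - \<beta>) - (real j + 1) powr - (1 - \<beta>) \<le> real j powr - (1 + (1 - \<beta>))"
            using \<beta> j by (intro powr_difference_le) auto
        qed auto
        also have "1 + (1 - \<beta>) = 2 - \<beta>" by simp
        finally show "up j - lo j \<le> real j powr - (1 - \<beta>) * real (n - 1 - j) powr - (1 + \<beta>)
            + real j powr - (2 - \<beta>) * real (n - j) powr - \<beta>" .
      qed
      also have "\<dots> = (\<Sum>j=1..<n - 1. real j powr - (1 - \<beta>) * real (n - 1 - j) powr - (1 + \<beta>))
            + (\<Sum>j=1..<n - 1. real j powr - (2 - \<beta>) * real (n - j) powr - \<beta>)" by (rule sum.distrib)
      finally have A: "(\<Sum>j=1..<n - 1. up j - lo j) \<le>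
          (\<Sum>j=1..<n - 1. real j powr - (1 - \<beta>) * real (n - 1 - j) powr - (1 + \<beta>))
            + (\<Sum>j=1..<n - 1. real j powr - (2 - \<beta>) * real (n - j) powr - \<beta>)" .
      have "(\<Sum>j=1..<n - 1. real j powr - (2 - \<beta>) * real (n - j) powr - \<beta>)
          \<le> (\<Sum>j=1..<n. real j powr - (2 - \<beta>) * real (n - j) powr - \<beta>)"
        by (intro sum_mono2) auto
      also have "\<dots> \<le> C2 * real n powr - (1 - \<beta>)" using n by (intro C2) auto
      finally have B: "(\<Sum>j=1..<n - 1. real j powr - (2 - \<beta>) * real (n - j) powr - \<beta>) \<le> C2 * real n powr - (1 - \<beta>)" .
      have D: "(\<Sum>j=1..<n - 1. real j powr - (1 - \<beta>) * real (n - 1 - j) powr - (1 + \<beta>)) \<le> C1 * real (n - 1) powr - (1 - \<beta>)"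
        using n by (intro C1) auto
      have "real (n - 1) powr - (1 - \<beta>) \<le> (real n / 2) powr - (1 - \<beta>)"
        using n \<beta> by (intro powr_mono2') (auto simp: of_nat_diff)
      also have "\<dots> = 2 powr (1 - \<beta>) * real n powr - (1 - \<beta>)"
        by (simp only: powr_divide powr_minus_divide) simp
      also have "\<dots> \<le> 2 powr 1 * real n powr - (1 - \<beta>)" using \<beta> by (intro mult_right_mono powr_mono) auto
      finally have "C1 * real (n - 1) powr - (1 - \<beta>) \<le> C1 * (2 * real n powr - (1 - \<beta>))"
        using C1(1) by (intro mult_left_mono) auto
      then show ?thesis using A B D by (simp add: algebra_simps)
    qed
    define E where "E = (\<Sum>j<n. \<bar>I j - ?a n j\<bar>)"
    have E: "E \<le> C3 * real n powr (\<beta> - 1)"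
    proof -
      have "{..<n} = insert 0 (insert (n - 1) {1..<n - 1})" using n by auto
      then have "E = \<bar>I 0 - ?a n 0\<bar> + (\<bar>I (n - 1) - ?a n (n - 1)\<bar> + (\<Sum>j=1..<n - 1. \<bar>I j - ?a n j\<bar>))"
        unfolding E_def using n by simp
      moreover have "\<bar>I 0 - ?a n 0\<bar> \<le> 2 / \<beta> * real n powr (\<beta> - 1)"
        using first I_nonneg[of 0] n by (simp add: arcsine_weight_def)
      moreover have "\<bar>I (n - 1) - ?a n (n - 1)\<bar> \<le> 2 / (1 - \<beta>) * real n powr (\<beta> - 1) + 2 * real n powr (\<beta> - 1)"
        using last I_nonneg[of "n - 1"] arcsine_weight_nonneg[of \<beta> n "n - 1"] arcsine_weight_le[OF \<beta>, of n "n - 1"] n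
        by simp
      moreover have "(\<Sum>j=1..<n - 1. \<bar>I j - ?a n j\<bar>) \<le> (\<Sum>j=1..<n - 1. up j - lo j)"
        using middle by (intro sum_mono) auto
      ultimately show ?thesis using gaps unfolding C3_def by (simp only: distrib_right)
    qed
    define m where "m = nat \<lfloor>real n * t\<rfloor>"
    have m: "real m \<le> real n * t" "real n * t < real m + 1" unfolding m_def using t by (auto simp: of_nat_nat)
    have "real n * t \<le> real n * 1" using t by (intro mult_left_mono) auto
    then have mn: "m \<le> n" using m(1) by linarith
    have grid: "integral {0..real k / n} ?\<psi> = (\<Sum>j<k. I j)" if "k \<le> n" for k
      using that
    proof (induction k)
      case (Suc k)
      have "integral {0..real k / n} ?\<psi> + I k = integral {0..real (Suc k) / n} ?\<psi>"
        unfolding I_def using Suc npos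
        by (subst Henstock_Kurzweil_Integration.integral_combine) (auto intro!: integ simp: field_simps)
      then show ?case using Suc by simp
    qed simp
    have mt: "real m / n \<le> t" using m(1) npos by (simp add: field_simps)
    have split: "integral {0..t} ?\<psi> = (\<Sum>j<m. I j) + integral {real m / n..t} ?\<psi>"
      using Henstock_Kurzweil_Integration.integral_combine[of 0 "real m / n" t ?\<psi>] mt t integ[of 0 t] grid[OF mn] by simp
    have rest: "0 \<le> integral {real m / n..t} ?\<psi> \<and> integral {real m / n..t} ?\<psi> \<le> ?a n m + E"
    proof (cases "m = n")
      case True
      then have "real m / n = 1" using npos by simp
      then have "real m / n = t" using mt t by simp
      then show ?thesis using arcsine_weight_nonneg[of \<beta> n m] by (simp add: E_def sum_nonneg)
    next
      case False
      then have mn': "m < n" using mn by simp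
      have "t \<le> real (m + 1) / n" using m(2) npos by (simp add: field_simps)
      moreover have le1: "real (m + 1) / n \<le> 1" using mn' npos by (simp add: field_simps)
      ultimately have "integral {real m / n..t} ?\<psi> \<le> I m"
        unfolding I_def using t by (intro integral_subset_le integ) (auto simp: arcsine_kernel_nonneg)
      moreover have "\<bar>I m - ?a n m\<bar> \<le> E" unfolding E_def using mn' by (intro member_le_sum) auto
      moreover have "0 \<le> integral {real m / n..t} ?\<psi>"
        using t by (intro integral_nonneg integ) (auto simp: arcsine_kernel_nonneg)
      ultimately show ?thesis by linarith
    qed
    have "\<bar>\<Sum>j<m. I j - ?a n j\<bar> \<le> (\<Sum>j<m. \<bar>I j - ?a n j\<bar>)" by (rule sum_abs)
    also have "\<dots> \<le> E" unfolding E_def using mn by (intro sum_mono2) auto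
    finally have 1: "\<bar>(\<Sum>j<m. I j) - (\<Sum>j<m. ?a n j)\<bar> \<le> E" by (simp add: sum_subtractf)
    have 2: "(\<Sum>j\<le>m. ?a n j) = (\<Sum>j<m. ?a n j) + ?a n m" by (simp add: lessThan_Suc_atMost[symmetric])
    have 3: "?a n m \<le> 2 * real n powr (\<beta> - 1)" using arcsine_weight_le[OF \<beta>, of n m] mn n by simp
    have "\<bar>(\<Sum>j\<le>m. ?a n j) - integral {0..t} ?\<psi>\<bar> \<le> 2 * E + 2 * ?a n m"
      unfolding split 2 using 1 rest arcsine_weight_nonneg[of \<beta> n m] by linarith
    also have "\<dots> \<le> (2 * C3 + 4) * real n powr (\<beta> - 1)" using E 3 by (simp add: algebra_simps)
    finally show ?thesis by (simp add: m_def)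
  qed
  \<comment> \<open>For \<open>n = 1\<close> both weights vanish, as \<open>0 powr x = 0\<close>.\<close>
  have one: "\<bar>(\<Sum>j\<le>nat \<lfloor>real 1 * t\<rfloor>. ?a 1 j) - integral {0..t} ?\<psi>\<bar> \<le> Z" if t: "0 \<le> t" "t \<le> 1" for t
  proof -
    have "nat \<lfloor>real 1 * t\<rfloor> \<le> 1" using t by (simp add: nat_le_iff floor_le_iff)
    then have "(\<Sum>j\<le>nat \<lfloor>real 1 * t\<rfloor>. ?a 1 j) = 0"
      by (intro sum.neutral) (auto simp: arcsine_weight_def le_Suc_eq)
    moreover have "integral {0..t} ?\<psi> \<le> Z" unfolding Z_def
      using t by (intro integral_subset_le integ) (auto simp: arcsine_kernel_nonneg)
    moreover have "0 \<le> integral {0..t} ?\<psi>"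
      using t by (intro integral_nonneg integ) (auto simp: arcsine_kernel_nonneg)
    ultimately show ?thesis by simp
  qed
  have "0 \<le> Z" using one[of 0] by linarith
  show ?thesis
  proof (intro exI[of _ "Z + (2 * C3 + 4)"] conjI allI impI)
    fix n :: nat and t :: real assume n: "1 \<le> n" and t: "0 \<le> t" "t \<le> 1"
    show "\<bar>(\<Sum>j\<le>nat \<lfloor>real n * t\<rfloor>. ?a n j) - integral {0..t} ?\<psi>\<bar> \<le> (Z + (2 * C3 + 4)) * real n powr (\<beta> - 1)"
    proof (cases "n = 1")
      case True
      then show ?thesis using one[OF t] C3 by simp
    next
      case False
      then have "\<bar>(\<Sum>j\<le>nat \<lfloor>real n * t\<rfloor>. ?a n j) - integral {0..t} ?\<psi>\<bar> \<le> (2 * C3 + 4) * real n powr (\<beta> - 1)"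
        using n t by (intro main) auto
      also have "\<dots> \<le> (Z + (2 * C3 + 4)) * real n powr (\<beta> - 1)"
        using \<open>0 \<le> Z\<close> by (intro mult_right_mono) auto
      finally show ?thesis .
    qed
  qed (use \<open>0 \<le> Z\<close> C3 in auto)
qed

context aperiodic_regular_tail
begin

abbreviation \<gamma> :: real where "\<gamma> \<equiv> min (1 - \<beta>) (\<beta> - 1 / 2)"

text \<open>In the application \<open>x j\<close> is the probability that the last visit up to time \<open>n\<close> is at
  time \<open>j\<close>, which is close to \<open>u j * q (n - j)\<close>. Replacing \<open>u j\<close> and \<open>q (n - j)\<close> by their asymptotics
  \<open>d / c * j powr (\<beta> - 1)\<close> and \<open>c * (n - j) powr - \<beta>\<close> costs convolutions of powers, of order
  \<open>n powr - \<gamma>\<close>: the errors \<open>j powr - \<kappa>\<close> against \<open>(n - j) powr - \<beta>\<close>, and \<open>j powr (\<beta> - 1)\<close> against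
  \<open>(n - j) powr (- 2 * \<beta>)\<close>. What remains is the Riemann sum of the arcsine density.\<close>

theorem last_visit_estimate:
  "\<exists>C\<ge>0. \<forall>B n x t. 1 \<le> B \<longrightarrow> 1 \<le> n \<longrightarrow> \<bar>x 0\<bar> \<le> B * q n \<longrightarrow>
     (\<forall>j\<in>{1..n}. \<bar>x j - u j * q (n - j)\<bar> \<le> B * real j powr - \<kappa> * q (n - j)) \<longrightarrow> 0 \<le> t \<longrightarrow> t \<le> 1 \<longrightarrow>
     \<bar>(\<Sum>j\<le>nat \<lfloor>real n * t\<rfloor>. x j) - sin (pi * \<beta>) / pi * integral {0..t} (arcsine_kernel \<beta>)\<bar>
       \<le> C * B * real n powr - \<gamma>"
proof -
  have \<kappa>: "0 < \<kappa>" "\<kappa> < 1" "\<kappa> \<le> \<beta>" "\<gamma> \<le> \<kappa>" "\<gamma> \<le> \<beta>" "\<gamma> \<le> 1 - \<beta>" "\<gamma> = \<kappa> + \<beta> - 1" using beta by (auto simp: min_def)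
  define d where "d = sin (pi * \<beta>) / pi"
  have "pi * \<beta> < pi * 1" using beta by (intro mult_strict_left_mono) auto
  then have d: "0 \<le> d" unfolding d_def using beta by (intro divide_nonneg_nonneg sin_ge_zero) auto
  obtain Cu where Cu: "0 \<le> Cu" "\<And>n. 1 \<le> n \<Longrightarrow> \<bar>u n - d / c * real n powr (\<beta> - 1)\<bar> \<le> Cu * real n powr - \<kappa>"
    using renewal_asymptotics by (auto simp: d_def)
  obtain C1 where C1: "0 \<le> C1" "\<And>n. 1 \<le> n \<Longrightarrow>
      (\<Sum>j=1..<n. real j powr - \<kappa> * real (n - j) powr - \<beta>) \<le> C1 * real n powr - \<gamma>"
    using power_convolution[of \<kappa> \<beta> \<gamma>] beta \<kappa> by auto
  obtain C2 where C2: "0 \<le> C2" "\<And>n. 1 \<le> n \<Longrightarrow>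
      (\<Sum>j=1..<n. real j powr - (1 - \<beta>) * real (n - j) powr - (2 * \<beta>)) \<le> C2 * real n powr - \<gamma>"
    using power_convolution[of "1 - \<beta>" "2 * \<beta>" \<gamma>] beta \<kappa>(4,5,6) by auto
  obtain C3 where C3: "0 \<le> C3" "\<And>n t. 1 \<le> n \<Longrightarrow> 0 \<le> t \<Longrightarrow> t \<le> 1 \<Longrightarrow>
     \<bar>(\<Sum>j\<le>nat \<lfloor>real n * t\<rfloor>. arcsine_weight \<beta> n j) - integral {0..t} (arcsine_kernel \<beta>)\<bar> \<le> C3 * real n powr (\<beta> - 1)"
    using arcsine_riemann_sum[OF beta] by blast
  let ?A = "c + K"
  have A: "0 \<le> ?A" using c_pos K_nonneg by simp
  define C where "C = ?A + (1 + Cu + d / c) + (1 + Cu) * ?A * C1 + d / c * K * C2 + d * C3"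
  have dc: "0 \<le> d / c" using d c_pos by simp
  have C: "0 \<le> C" unfolding C_def
    using A Cu(1) dc C1(1) C2(1) C3(1) K_nonneg d c_pos by (intro add_nonneg_nonneg mult_nonneg_nonneg) auto
  show ?thesis
  proof (intro exI[of _ C] conjI allI impI C)
    fix B :: real and n :: nat and x :: "nat \<Rightarrow> real" and t :: real
    assume B: "1 \<le> B" and n: "1 \<le> n" and x0: "\<bar>x 0\<bar> \<le> B * q n"
      and x: "\<forall>j\<in>{1..n}. \<bar>x j - u j * q (n - j)\<bar> \<le> B * real j powr - \<kappa> * q (n - j)"
      and t: "0 \<le> t" "t \<le> 1"
    define m where "m = nat \<lfloor>real n * t\<rfloor>"
    define G where "G = real n powr - \<gamma>"
    have powr_le: "real n powr - s \<le> G" if "\<gamma> \<le> s" for s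
      unfolding G_def using that n by (intro powr_mono) auto
    have G0: "0 \<le> G" by (simp add: G_def)
    define y where "y j = x j - d * arcsine_weight \<beta> n j" for j
    have y0: "\<bar>y 0\<bar> \<le> B * (?A * G)"
    proof -
      have "B * q n \<le> B * (?A * real n powr - \<beta>)" using q_upper[OF n] B by (intro mult_left_mono) auto
      also have "\<dots> \<le> B * (?A * G)" using powr_le[of \<beta>] A B \<kappa> by (intro mult_left_mono) auto
      finally show ?thesis using x0 by (simp add: y_def arcsine_weight_def)
    qed
    have yn: "\<bar>y n\<bar> \<le> B * ((1 + Cu + d / c) * G)"
    proof -
      have "\<bar>x n - u n\<bar> \<le> B * real n powr - \<kappa>" using x n q_0 by force
      moreover have "B * real n powr - \<kappa> \<le> B * G" using powr_le[of \<kappa>] B \<kappa> by (intro mult_left_mono) auto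
      moreover have "\<bar>a\<bar> \<le> y + z" if "\<bar>a - z\<bar> \<le> y" "0 \<le> z" for a y z :: real
        using that by linarith
      from this[OF Cu(2)[OF n] mult_nonneg_nonneg[OF dc powr_ge_zero[of "real n" "\<beta> - 1"]]]
      have "\<bar>u n\<bar> \<le> Cu * real n powr - \<kappa> + d / c * real n powr - (1 - \<beta>)"
        unfolding minus_diff_eq .
      moreover have "Cu * real n powr - \<kappa> \<le> Cu * G" using powr_le[of \<kappa>] Cu(1) \<kappa> by (intro mult_left_mono) auto
      moreover have "d / c * real n powr - (1 - \<beta>) \<le> d / c * G" using powr_le[of "1 - \<beta>"] dc by (intro mult_left_mono) auto
      moreover have "(Cu + d / c) * G \<le> B * ((Cu + d / c) * G)"
        using B Cu(1) dc G0 mult_right_mono[of 1 B "(Cu + d / c) * G"] by simp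
      moreover have "\<bar>y n\<bar> \<le> \<bar>x n - u n\<bar> + \<bar>u n\<bar>" by (simp add: y_def arcsine_weight_def)
      ultimately show ?thesis by (simp add: algebra_simps)
    qed
    have ymid: "\<bar>y j\<bar> \<le> B * ((1 + Cu) * ?A * (real j powr - \<kappa> * real (n - j) powr - \<beta>)
        + d / c * K * (real j powr - (1 - \<beta>) * real (n - j) powr - (2 * \<beta>)))" if j: "j \<in> {1..<n}" for j
    proof -
      have j1: "1 \<le> j" "1 \<le> n - j" using j by auto
      have q: "q (n - j) \<le> ?A * real (n - j) powr - \<beta>" by (rule q_upper[OF j1(2)])
      let ?D = "d / c * real j powr (\<beta> - 1)"
      have D: "0 \<le> ?D" using dc by (intro mult_nonneg_nonneg) auto
      have y_split: "y j = (x j - u j * q (n - j)) + ((u j - ?D) * q (n - j) + ?D * (q (n - j) - c * real (n - j) powr - \<beta>))"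
        using c_pos by (simp add: y_def arcsine_weight_def algebra_simps)
      have "\<bar>y j\<bar> \<le> \<bar>x j - u j * q (n - j)\<bar> + (\<bar>u j - ?D\<bar> * q (n - j) + ?D * \<bar>q (n - j) - c * real (n - j) powr - \<beta>\<bar>)"
      proof -
        have 2: "\<bar>?D * E\<bar> = ?D * \<bar>E\<bar>" for E
          by (rule trans[OF abs_mult]) (simp only: abs_of_nonneg[OF D])
        have 1: "\<bar>E * q (n - j)\<bar> = \<bar>E\<bar> * q (n - j)" for E
          by (rule trans[OF abs_mult]) (simp only: abs_of_nonneg[OF q_nonneg])
        have "\<bar>a1 + (a2 + a3)\<bar> \<le> \<bar>a1\<bar> + (\<bar>a2\<bar> + \<bar>a3\<bar>)" for a1 a2 a3 :: real by linarith
        from this[of "x j - u j * q (n - j)" "(u j - ?D) * q (n - j)" "?D * (q (n - j) - c * real (n - j) powr - \<beta>)"]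
        show ?thesis unfolding y_split 1 2 .
      qed
      also have "\<dots> \<le> B * real j powr - \<kappa> * q (n - j) + (Cu * real j powr - \<kappa> * q (n - j) + ?D * (K * real (n - j) powr - (2 * \<beta>)))"
      proof (rule add_mono[OF bspec[OF x] add_mono[OF mult_right_mono[OF Cu(2)[OF j1(1)] q_nonneg] mult_left_mono[OF _ D]]])
        show "\<bar>q (n - j) - c * real (n - j) powr - \<beta>\<bar> \<le> K * real (n - j) powr - (2 * \<beta>)"
          using tail[OF j1(2)] by (simp only: mult_minus_left)
      qed (use j in auto)
      also have "\<dots> = (B + Cu) * real j powr - \<kappa> * q (n - j) + d / c * K * (real j powr - (1 - \<beta>) * real (n - j) powr - (2 * \<beta>))"
        by (simp add: algebra_simps)
      also have "\<dots> \<le> B * ((1 + Cu) * ?A * (real j powr - \<kappa> * real (n - j) powr - \<beta>))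
          + B * (d / c * K * (real j powr - (1 - \<beta>) * real (n - j) powr - (2 * \<beta>)))"
      proof (rule add_mono)
        have "Cu * 1 \<le> Cu * B" using B Cu(1) by (intro mult_left_mono) auto
        then have "(B + Cu) * real j powr - \<kappa> * q (n - j) \<le> (B * (1 + Cu)) * real j powr - \<kappa> * (?A * real (n - j) powr - \<beta>)"
          using B Cu(1) q q_nonneg[of "n - j"] by (intro mult_mono mult_nonneg_nonneg) (auto simp: algebra_simps)
        then show "(B + Cu) * real j powr - \<kappa> * q (n - j) \<le> B * ((1 + Cu) * ?A * (real j powr - \<kappa> * real (n - j) powr - \<beta>))"
          by (simp only: mult_ac)
        have "0 \<le> d / c * K * (real j powr - (1 - \<beta>) * real (n - j) powr - (2 * \<beta>))"
          using dc K_nonneg by (intro mult_nonneg_nonneg) auto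
        then show "d / c * K * (real j powr - (1 - \<beta>) * real (n - j) powr - (2 * \<beta>))
            \<le> B * (d / c * K * (real j powr - (1 - \<beta>) * real (n - j) powr - (2 * \<beta>)))"
          using mult_right_mono[of 1 B] B by fastforce
      qed
      finally show ?thesis by (simp only: distrib_left)
    qed
    have mid: "(\<Sum>j=1..<n. \<bar>y j\<bar>) \<le> B * (((1 + Cu) * ?A * C1 + d / c * K * C2) * G)"
    proof -
      have "(\<Sum>j=1..<n. \<bar>y j\<bar>) \<le> (\<Sum>j=1..<n. B * ((1 + Cu) * ?A * (real j powr - \<kappa> * real (n - j) powr - \<beta>)
        + d / c * K * (real j powr - (1 - \<beta>) * real (n - j) powr - (2 * \<beta>))))"
        by (rule sum_mono[OF ymid])
      also have "\<dots> = B * ((1 + Cu) * ?A * (\<Sum>j=1..<n. real j powr - \<kappa> * real (n - j) powr - \<beta>)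
        + d / c * K * (\<Sum>j=1..<n. real j powr - (1 - \<beta>) * real (n - j) powr - (2 * \<beta>)))"
        by (simp only: sum_distrib_left[symmetric] sum.distrib)
      also have "\<dots> \<le> B * ((1 + Cu) * ?A * (C1 * G) + d / c * K * (C2 * G))"
        using B A Cu(1) dc K_nonneg C1(2)[OF n] C2(2)[OF n] unfolding G_def
        by (intro mult_left_mono add_mono mult_nonneg_nonneg) auto
      finally show ?thesis by (simp add: algebra_simps)
    qed
    have "real n * t \<le> real n * 1" using t by (intro mult_left_mono) auto
    then have mn: "m \<le> n" unfolding m_def using t by (simp add: nat_le_iff floor_le_iff)
    have "\<bar>\<Sum>j\<le>m. y j\<bar> \<le> (\<Sum>j\<le>m. \<bar>y j\<bar>)" by (rule sum_abs)
    also have "\<dots> \<le> (\<Sum>j\<le>n. \<bar>y j\<bar>)" using mn by (intro sum_mono2) auto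
    also have "\<dots> = \<bar>y 0\<bar> + (\<bar>y n\<bar> + (\<Sum>j=1..<n. \<bar>y j\<bar>))"
    proof -
      have "{..n} = insert 0 (insert n {1..<n})" using n by auto
      then show ?thesis using n by simp
    qed
    finally have 1: "\<bar>\<Sum>j\<le>m. y j\<bar> \<le> \<bar>y 0\<bar> + (\<bar>y n\<bar> + (\<Sum>j=1..<n. \<bar>y j\<bar>))" .
    have y_sum: "(\<Sum>j\<le>m. y j) = (\<Sum>j\<le>m. x j) - d * (\<Sum>j\<le>m. arcsine_weight \<beta> n j)"
      by (simp add: y_def sum_subtractf sum_distrib_left)
    have "d * \<bar>(\<Sum>j\<le>m. arcsine_weight \<beta> n j) - integral {0..t} (arcsine_kernel \<beta>)\<bar> \<le> d * (C3 * G)"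
    proof (rule mult_left_mono[OF _ d])
      have "C3 * real n powr (\<beta> - 1) \<le> C3 * G" using powr_le[of "1 - \<beta>"] C3(1) by (intro mult_left_mono) auto
      then show "\<bar>(\<Sum>j\<le>m. arcsine_weight \<beta> n j) - integral {0..t} (arcsine_kernel \<beta>)\<bar> \<le> C3 * G"
        using C3(2)[OF n t] unfolding m_def by linarith
    qed
    also have "\<dots> \<le> B * (d * C3 * G)"
      using mult_right_mono[of 1 B "d * (C3 * G)"] B d C3(1) G0 by (simp add: mult.assoc)
    finally have 2: "\<bar>d * (\<Sum>j\<le>m. arcsine_weight \<beta> n j) - d * integral {0..t} (arcsine_kernel \<beta>)\<bar> \<le> B * (d * C3 * G)"
      using d by (simp add: abs_mult flip: right_diff_distrib)
    have "\<bar>(\<Sum>j\<le>m. x j) - d * integral {0..t} (arcsine_kernel \<beta>)\<bar> \<le> \<bar>y 0\<bar> + (\<bar>y n\<bar> + (\<Sum>j=1..<n. \<bar>y j\<bar>)) + B * (d * C3 * G)"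
      using 1 2 y_sum by linarith
    also have "\<dots> \<le> B * (?A * G) + (B * ((1 + Cu + d / c) * G) + B * (((1 + Cu) * ?A * C1 + d / c * K * C2) * G)) + B * (d * C3 * G)"
      by (intro add_mono y0 yn mid order_refl)
    also have "\<dots> = C * B * G" by (simp add: C_def algebra_simps)
    finally show "\<bar>(\<Sum>j\<le>nat \<lfloor>real n * t\<rfloor>. x j) - sin (pi * \<beta>) / pi * integral {0..t} (arcsine_kernel \<beta>)\<bar> \<le> C * B * real n powr - \<gamma>"
      by (simp only: m_def d_def G_def)
  qed
qed

end


section \<open>The arcsine law\<close>

text \<open>The bound is extended to the finitely many small \<open>n\<close>, at which the difference is at most
  \<open>1 + c\<close>.\<close>

lemma (in first_return) regular_tail_of_bigo:
  assumes beta: "1 / 2 < \<beta>" "\<beta> < 1" and c: "0 < c"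
    and tail: "(\<lambda>n. return_tail n - c * real n powr (- \<beta>)) \<in> O(\<lambda>n. real n powr (- 2 * \<beta>))"
  shows "\<exists>K. regular_tail return_prob return_tail \<beta> c K"
proof -
  obtain A where A: "0 < A" "eventually (\<lambda>n. norm (return_tail n - c * real n powr (- \<beta>)) \<le> A * norm (real n powr (- 2 * \<beta>))) sequentially"
    using landau_o.bigE[OF tail] by blast
  then obtain n0 where n0: "\<And>n. n0 \<le> n \<Longrightarrow> \<bar>return_tail n - c * real n powr (- \<beta>)\<bar> \<le> A * real n powr (- 2 * \<beta>)"
    unfolding eventually_sequentially by auto
  define K where "K = A + (1 + c) * (real n0 + 1) powr (2 * \<beta>)"
  have "\<bar>return_tail n - c * real n powr (- \<beta>)\<bar> \<le> K * real n powr (- 2 * \<beta>)" if n: "1 \<le> n" for n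
  proof (cases "n0 \<le> n")
    case True
    have "A * real n powr (- 2 * \<beta>) \<le> K * real n powr (- 2 * \<beta>)"
      using c by (intro mult_right_mono) (auto simp: K_def)
    then show ?thesis using n0[OF True] by linarith
  next
    case False
    have "return_tail n \<le> measure M Y"
      unfolding return_tail_def using Y emeasure_finite by (intro measure_mono_fmeasurable) (auto simp: fmeasurable_def top.not_eq_extremum)
    then have "return_tail n \<le> 1" "0 \<le> return_tail n" using Y by (auto simp: return_tail_def measure_def)
    moreover have "real n powr (- \<beta>) \<le> 1" using n beta powr_mono[of "- \<beta>" 0 "real n"] by simp
    then have "c * real n powr (- \<beta>) \<le> c" "0 \<le> c * real n powr (- \<beta>)" using c by auto
    ultimately have "\<bar>return_tail n - c * real n powr (- \<beta>)\<bar> \<le> 1 + c" by linarith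
    also have "\<dots> \<le> (1 + c) * ((real n0 + 1) powr (2 * \<beta>) * real n powr (- 2 * \<beta>))"
    proof -
      have "real n powr (2 * \<beta>) \<le> (real n0 + 1) powr (2 * \<beta>)" using False beta by (intro powr_mono2) auto
      then have "real n powr (2 * \<beta>) * real n powr (- 2 * \<beta>) \<le> (real n0 + 1) powr (2 * \<beta>) * real n powr (- 2 * \<beta>)"
        by (intro mult_right_mono) auto
      moreover have "real n powr (2 * \<beta>) * real n powr (- 2 * \<beta>) = 1"
        using n by (simp add: powr_add[symmetric])
      ultimately show ?thesis using c by simp
    qed
    also have "\<dots> \<le> K * real n powr (- 2 * \<beta>)" using A(1) by (simp add: K_def distrib_right)
    finally show ?thesis .
  qed
  then have "regular_tail return_prob return_tail \<beta> c K"
    using beta c return_prob_0 return_tail_eq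
    by unfold_locales (auto simp: return_prob_def)
  then show ?thesis by blast
qed

context return_operators
begin

abbreviation last_visit_set :: "nat \<Rightarrow> nat \<Rightarrow> 'a set" where
  "last_visit_set n j \<equiv> {y \<in> Y. last_visit f Y n y = j}"

lemma last_visit_set_eq:
  "j \<le> n \<Longrightarrow> last_visit_set n j = {y \<in> Y. (f ^^ j) y \<in> {y \<in> Y. \<phi> y > enat (n - j)}}"
  by (intro Collect_cong conj_cong refl) (simp add: last_visit_eq_iff)

lemma last_visit_set_sets: "j \<le> n \<Longrightarrow> last_visit_set n j \<in> sets M"
  unfolding last_visit_set_eq by (rule pow_vimage_sets[OF tail_sets])

lemma measure_density_last_visit:
  assumes g: "AE y in N. 0 \<le> J g y" and j: "j \<le> n"
  shows "measure (density N (\<lambda>y. ennreal (J g y))) (last_visit_set n j)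
     = pairing (visit j (indicator {y \<in> Y. \<phi> y > enat (n - j)})) g"
proof -
  let ?\<nu> = "density N (\<lambda>y. ennreal (J g y))"
  have sub: "last_visit_set n j \<inter> space ?\<nu> = last_visit_set n j" by (auto simp: space_N)
  have [measurable]: "last_visit_set n j \<in> sets N" using last_visit_set_sets[OF j] by (auto simp: sets_N)
  have "measure ?\<nu> (last_visit_set n j) = (LINT y|?\<nu>. indicator (last_visit_set n j) y)"
    by (simp only: Bochner_Integration.integral_indicator sub)
  also have "\<dots> = (LINT y|N. J g y *\<^sub>R indicator (last_visit_set n j) y)"
    using g by (intro integral_density) auto
  also have "\<dots> = (LINT y|N. J g y * visit j (indicator {y \<in> Y. \<phi> y > enat (n - j)}) y)"
    by (rule Bochner_Integration.integral_cong)
      (auto simp: last_visit_set_eq[OF j] visit_def space_N split: split_indicator)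
  also have "\<dots> = pairing (visit j (indicator {y \<in> Y. \<phi> y > enat (n - j)})) g"
    by (rule pairing_apply[symmetric, OF test_function_visit[OF test_function_tail]])
  finally show ?thesis .
qed

text \<open>The last visit up to time \<open>n\<close> is at time \<open>j\<close> if the point is in \<open>Y\<close> at time \<open>j\<close> and its
  next return takes more than \<open>n - j\<close> steps. So the renewal asymptotics are applied to the observable
  \<open>1\<^bsub>\<phi> > n - j\<^esub>\<close>, of integral \<open>return_tail (n - j)\<close>. The norm of \<open>g\<close> is at least its integral, \<open>1\<close>,
  and can therefore be a factor of all error terms.\<close>

theorem last_visit_arcsine_law:
  assumes regular: "regular_tail return_prob return_tail \<beta> c K"
    and simple: "simple_isolated_eigenvalue (return_series Rn 1) 1"
    and nonresonant: "\<And>z. norm z \<le> 1 \<Longrightarrow> z \<noteq> 1 \<Longrightarrow> 1 \<notin> spectrum (return_series Rn z)"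
  shows "\<exists>C>0. \<forall>\<nu> g. prob_space \<nu> \<and> (AE y in N. 0 \<le> J g y) \<and> \<nu> = density N (\<lambda>y. ennreal (J g y)) \<longrightarrow>
     (\<forall>n\<ge>1. \<forall>t\<in>{0..1}.
        \<bar>measure \<nu> {y \<in> Y. real (last_visit f Y n y) / real n \<le> t}
           - sin (pi * \<beta>) / pi * integral {0..t} (arcsine_kernel \<beta>)\<bar>
          \<le> C * norm g * real n powr - min (1 - \<beta>) (\<beta> - 1 / 2))"
proof -
  interpret T: regular_tail return_prob return_tail \<beta> c K by (rule regular)
  interpret O: operator_renewal return_prob return_tail \<beta> c K Rn C0 l e
    using C0 Rn_norm l_Rn_e l_Rn_sums Rn_e_sums[OF T.p_summable] l_e simple nonresonant
    by unfold_locales auto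
  let ?q = return_tail and ?u = "renewal_sequence return_prob" and ?\<kappa> = "min (2 - 2 * \<beta>) (1 / 2)"
  obtain C1 where C1: "0 \<le> C1" "\<And>t v n. O.renewal_solution t \<Longrightarrow> 1 \<le> n \<Longrightarrow>
     \<bar>blinfun_apply (t n) v - ?u n * l v * t 0 e\<bar> \<le> C1 * norm (t 0) * norm v * real n powr - ?\<kappa>"
    using O.operator_renewal_coefficients by blast
  obtain C2 where C2: "0 \<le> C2" "\<And>B n x t. 1 \<le> B \<Longrightarrow> 1 \<le> n \<Longrightarrow> \<bar>x 0\<bar> \<le> B * ?q n \<Longrightarrow>
     \<forall>j\<in>{1..n}. \<bar>x j - ?u j * ?q (n - j)\<bar> \<le> B * real j powr - ?\<kappa> * ?q (n - j) \<Longrightarrow> 0 \<le> t \<Longrightarrow> t \<le> 1 \<Longrightarrow>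
     \<bar>(\<Sum>j\<le>nat \<lfloor>real n * t\<rfloor>. x j) - sin (pi * \<beta>) / pi * integral {0..t} (arcsine_kernel \<beta>)\<bar>
       \<le> C2 * B * real n powr - min (1 - \<beta>) (\<beta> - 1 / 2)"
    using O.last_visit_estimate by blast
  show ?thesis
  proof (intro exI[of _ "C2 * max 1 C1 + 1"] conjI allI impI ballI)
    show "0 < C2 * max 1 C1 + 1" using C2(1) by (intro add_nonneg_pos mult_nonneg_nonneg) auto
    fix \<nu> :: "'a measure" and g :: 'b and n :: nat and t :: real
    assume \<nu>: "prob_space \<nu> \<and> (AE y in N. 0 \<le> J g y) \<and> \<nu> = density N (\<lambda>y. ennreal (J g y))"
      and n: "1 \<le> n" and t: "t \<in> {0..1}"
    interpret \<nu>: prob_space \<nu> by (rule conjunct1[OF \<nu>])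
    define w :: "nat \<Rightarrow> 'a \<Rightarrow> real" where "w k = indicator {y \<in> Y. \<phi> y > enat k}" for k
    have w: "test_function (w k)" for k unfolding w_def by (rule test_function_tail)
    have w_int: "(LINT y|N. \<bar>w k y\<bar>) = ?q k" "(LINT y|N. w k y) = ?q k" for k
      using integral_tail[of k] by (simp_all add: w_def)
    have w0: "pairing (visit 0 (w k)) = pairing (w k)" for k
      by (rule pairing_cong) (rule visit_0)
    have g1: "l g = 1"
    proof -
      have "l g = (LINT y|N. J g y *\<^sub>R 1)" by (simp add: pairing_apply[OF test_function_const])
      also have "\<dots> = (LINT y|\<nu>. 1)" using \<nu> by (subst integral_density[symmetric]) auto
      also have "\<dots> = 1" using \<nu>.prob_space by simp
      finally show ?thesis .
    qed
    have "1 \<le> norm g"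
      using pairing_bounded[OF test_function_const[of 1], of g] g1 N.prob_space
      by (simp add: pairing_apply[OF test_function_const])
    define B where "B = max 1 C1 * norm g"
    have B: "1 \<le> B" "norm g \<le> B" "C1 * norm g \<le> B"
    proof -
      show "norm g \<le> B" "C1 * norm g \<le> B"
        unfolding B_def using mult_right_mono[of 1 "max 1 C1" "norm g"] by (auto intro: mult_right_mono)
      then show "1 \<le> B" using \<open>1 \<le> norm g\<close> by linarith
    qed
    define x where "x j = pairing (visit j (w (n - j))) g" for j
    have "\<bar>x 0\<bar> \<le> norm g * ?q n"
      using pairing_bounded[OF w, of g n] unfolding x_def w0 pairing_apply[OF w] w_int by simp
    also have "\<dots> \<le> B * ?q n" using B T.q_nonneg by (intro mult_right_mono) auto
    finally have x0: "\<bar>x 0\<bar> \<le> B * ?q n" .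
    have xj: "\<bar>x j - ?u j * ?q (n - j)\<bar> \<le> B * real j powr - ?\<kappa> * ?q (n - j)" if j: "j \<in> {1..n}" for j
    proof -
      let ?t = "\<lambda>m. pairing (visit m (w (n - j)))"
      have "norm (?t m) \<le> 1" for m
      proof -
        have tf: "test_function (visit m (w (n - j)))" by (rule test_function_visit[OF w])
        have "norm (?t m) \<le> (LINT y|N. \<bar>visit m (w (n - j)) y\<bar>)" by (rule norm_pairing_le[OF tf])
        also have "\<dots> \<le> (LINT y|N. 1)"
        proof (rule integral_mono)
          show "\<bar>visit m (w (n - j)) y\<bar> \<le> 1" for y
            by (rule visit_bound) (auto simp: w_def split: split_indicator)
        qed (use integrable_test_function[OF tf] in auto)
        finally show ?thesis using N.prob_space by simp
      qed
      then have "O.renewal_solution ?t"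
        unfolding O.renewal_solution_def using pairing_visit_renewal[OF w] by blast
      from C1(2)[OF this, of j g] j
      have "\<bar>x j - ?u j * l g * pairing (w (n - j)) e\<bar> \<le> C1 * norm (pairing (w (n - j))) * norm g * real j powr - ?\<kappa>"
        unfolding x_def w0 by simp
      then have "\<bar>x j - ?u j * ?q (n - j)\<bar> \<le> C1 * norm (pairing (w (n - j))) * norm g * real j powr - ?\<kappa>"
        unfolding g1 pairing_e[OF w] w_int by simp
      also have "\<dots> \<le> C1 * ?q (n - j) * norm g * real j powr - ?\<kappa>"
        using norm_pairing_le[OF w, of "n - j"] C1(1) unfolding w_int
        by (intro mult_right_mono mult_left_mono) auto
      also have "\<dots> = (C1 * norm g) * (real j powr - ?\<kappa> * ?q (n - j))" by simp
      also have "\<dots> \<le> B * (real j powr - ?\<kappa> * ?q (n - j))"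
        using B T.q_nonneg by (intro mult_right_mono mult_nonneg_nonneg) auto
      finally show ?thesis by (simp only: mult.assoc)
    qed
    define m where "m = nat \<lfloor>real n * t\<rfloor>"
    have "real n * t \<le> real n * 1" using t by (intro mult_left_mono) auto
    then have mn: "m \<le> n" unfolding m_def using t by (simp add: nat_le_iff floor_le_iff)
    have "{y \<in> Y. real (last_visit f Y n y) / real n \<le> t} = (\<Union>j\<le>m. last_visit_set n j)"
    proof -
      have "real k / real n \<le> t \<longleftrightarrow> k \<le> m" for k
      proof -
        have "real k / real n \<le> t \<longleftrightarrow> real k \<le> real n * t" using n by (simp add: field_simps)
        also have "\<dots> \<longleftrightarrow> k \<le> m" unfolding m_def using t by (simp add: le_nat_iff le_floor_iff)
        finally show ?thesis .
      qed
      then show ?thesis by auto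
    qed
    then have "measure \<nu> {y \<in> Y. real (last_visit f Y n y) / real n \<le> t} = (\<Sum>j\<le>m. measure \<nu> (last_visit_set n j))"
    proof (simp only:, intro \<nu>.finite_measure_finite_Union)
      show "last_visit_set n ` {..m} \<subseteq> sets \<nu>"
        using \<nu> last_visit_set_sets mn by (auto simp: sets_N)
    qed (auto simp: disjoint_family_on_def)
    also have "\<dots> = (\<Sum>j\<le>m. x j)"
    proof (rule sum.cong[OF refl])
      fix j assume "j \<in> {..m}"
      then show "measure \<nu> (last_visit_set n j) = x j"
        using measure_density_last_visit[of g j n] \<nu> mn by (simp add: x_def w_def)
    qed
    finally have "\<bar>measure \<nu> {y \<in> Y. real (last_visit f Y n y) / real n \<le> t}
         - sin (pi * \<beta>) / pi * integral {0..t} (arcsine_kernel \<beta>)\<bar> \<le> C2 * B * real n powr - min (1 - \<beta>) (\<beta> - 1 / 2)"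
      using C2(2)[of B n x t] B(1) n x0 xj t unfolding m_def by simp
    also have "\<dots> \<le> (C2 * max 1 C1 + 1) * norm g * real n powr - min (1 - \<beta>) (\<beta> - 1 / 2)"
      by (intro mult_right_mono) (simp_all add: B_def distrib_right)
    finally show "\<bar>measure \<nu> {y \<in> Y. real (last_visit f Y n y) / real n \<le> t}
         - sin (pi * \<beta>) / pi * integral {0..t} (arcsine_kernel \<beta>)\<bar>
       \<le> (C2 * max 1 C1 + 1) * norm g * real n powr - min (1 - \<beta>) (\<beta> - 1 / 2)" .
  qed
qed

end

theorem corollary9p10:
  fixes M :: "'a measure" and f :: "'a \<Rightarrow> 'a" and Y :: "'a set"
    and R :: "('a \<Rightarrow> real) \<Rightarrow> ('a \<Rightarrow> real)"
    and J :: "'b::banach \<Rightarrow> 'a \<Rightarrow> real"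
    and Rn :: "nat \<Rightarrow> 'b \<Rightarrow>\<^sub>L 'b"
    and \<Omega> :: "'c measure" and \<zeta> :: "'c \<Rightarrow> real"
    and \<beta> c \<gamma> :: real
  defines "\<phi> \<equiv> return_time f Y"
    and "N \<equiv> restrict_space M Y"
  assumes infinite_measure: "emeasure M (space M) = \<infinity>"
    and preserving: "measure_preserving_map M f"
    and conservative: "conservative_map M f"
    and Y: "Y \<in> sets M" "emeasure M Y = 1"
    and R: "transfer_operator N (return_map f Y) R"
    and B: "banach_function_space N J"
    and Rn: "\<And>n v. 1 \<le> n \<Longrightarrow>
          AE y in N. J (blinfun_apply (Rn n) v) y = R (\<lambda>x. indicator {x. \<phi> x = enat n} x * J v x) y"
    and H1: "\<exists>C\<^sub>0>0. \<forall>n\<ge>1. norm (Rn n) \<le> C\<^sub>0 * measure M {y \<in> Y. \<phi> y = enat n}"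
    and H2_i: "simple_isolated_eigenvalue (return_series Rn 1) 1"
    and H2_ii: "\<And>z. norm z \<le> 1 \<Longrightarrow> z \<noteq> 1 \<Longrightarrow> 1 \<notin> spectrum (return_series Rn z)"
    and beta: "1 / 2 < \<beta>" "\<beta> < 1"
    and c: "c > 0"
    and tail: "(\<lambda>n. measure M {y \<in> Y. \<phi> y > enat n} - c * real n powr (- \<beta>))
                 \<in> O(\<lambda>n. real n powr (- 2 * \<beta>))"
    and gamma: "\<gamma> = min (1 - \<beta>) (\<beta> - 1 / 2)"
    and zeta: "prob_space \<Omega>" "\<zeta> \<in> borel_measurable \<Omega>" "\<And>\<omega>. \<omega> \<in> space \<Omega> \<Longrightarrow> \<zeta> \<omega> \<in> {0..1}"
    and zeta_distribution: "\<And>t. t \<in> {0..1} \<Longrightarrow>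
          measure \<Omega> {\<omega> \<in> space \<Omega>. \<zeta> \<omega> \<le> t} =
            (1 / pi * sin (\<beta> * pi)) *
            (LINT u:{0..t}|lborel. 1 / u powr (1 - \<beta>) * (1 / (1 - u) powr \<beta>))"
  shows "\<exists>C>0. \<forall>\<nu> g. prob_space \<nu> \<and> (AE y in N. 0 \<le> J g y) \<and>
             \<nu> = density N (\<lambda>y. ennreal (J g y)) \<longrightarrow>
           (\<forall>n\<ge>1. \<forall>t\<in>{0..1}.
              \<bar>measure \<nu> {y \<in> Y. real (last_visit f Y n y) / real n \<le> t}
                - measure \<Omega> {\<omega> \<in> space \<Omega>. \<zeta> \<omega> \<le> t}\<bar>
              \<le> C * norm g * real n powr (- \<gamma>))"
proof -
  interpret first_return M f Y
    using preserving Y by unfold_locales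
  have tail_eq: "return_tail n = measure M {y \<in> Y. \<phi> y > enat n}" and
    prob_eq: "return_prob n = measure M {y \<in> Y. \<phi> y = enat n}" for n
    unfolding \<phi>_def by (rule return_tail_def return_prob_def)+
  have "(\<lambda>n. return_tail n - c * real n powr (- \<beta>)) \<in> O(\<lambda>n. real n powr (- 2 * \<beta>))"
    using tail unfolding tail_eq .
  then obtain K where regular: "regular_tail return_prob return_tail \<beta> c K"
    using regular_tail_of_bigo beta c by blast
  obtain C0 where C0: "0 < C0" "\<And>n. 1 \<le> n \<Longrightarrow> norm (Rn n) \<le> C0 * return_prob n"
    using H1 unfolding prob_eq by blast
  have "return_operators M f Y R J Rn C0"
  proof (unfold_locales)
    show "transfer_operator (restrict_space M Y) (return_map f Y) R"
      and "banach_function_space (restrict_space M Y) J"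
      using R B unfolding N_def .
    show "AE y in restrict_space M Y. J (blinfun_apply (Rn n) v) y
        = R (\<lambda>x. indicator {x. return_time f Y x = enat n} x * J v x) y" if "1 \<le> n" for n v
      using Rn[OF that] unfolding N_def \<phi>_def .
    show "return_tail \<longlonglongrightarrow> 0" by (rule regular_tail.q_tendsto[OF regular])
  qed (fact C0)+
  then obtain C where C: "0 < C" "\<And>\<nu> g n t. prob_space \<nu> \<and> (AE y in N. 0 \<le> J g y) \<and> \<nu> = density N (\<lambda>y. ennreal (J g y)) \<Longrightarrow>
      1 \<le> n \<Longrightarrow> t \<in> {0..1} \<Longrightarrow>
        \<bar>measure \<nu> {y \<in> Y. real (last_visit f Y n y) / real n \<le> t}
           - sin (pi * \<beta>) / pi * integral {0..t} (arcsine_kernel \<beta>)\<bar>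
          \<le> C * norm g * real n powr - \<gamma>"
    using return_operators.last_visit_arcsine_law[OF _ regular H2_i H2_ii] unfolding N_def gamma by meson
  have distribution: "measure \<Omega> {\<omega> \<in> space \<Omega>. \<zeta> \<omega> \<le> t} = sin (pi * \<beta>) / pi * integral {0..t} (arcsine_kernel \<beta>)"
    if "t \<in> {0..1}" for t
    using zeta_distribution[OF that] arcsine_kernel_lborel_integral[of \<beta> t] beta that
    by (simp add: mult.commute)
  show ?thesis
    using C by (intro exI[of _ C]) (auto simp: distribution)
qed


end
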